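(* For every Parovičenko space $X$, the function space $C_k(X,X)$ contains a dense set of weak $P$-points. In particular, the set $\{\beta\phi\restriction\omega^* : \phi\colon\omega\to\omega\text{ injective}\}$ of extensions of injective maps on $\omega$ is a dense set of weak $P$-points in $C_k(\omega^*,\omega^* )$.
   Context: $C_k(X,X)$ denotes the set of continuous functions $X\to X$ with the compact-open topology, generated by the subbasis of sets $[C,U]=\{f : f(C)\subseteq U\}$ with $C\subseteq X$ compact and $U\subseteq X$ open. A weak $P$-point is a point $p$ that does not lie in the boundary of any countable set, i.e. $p\notin\overline{D}$ for every countable set $D$ with $p\notin D$. A cozero-set in a Tychonoff space $X$ is the complement of a set of the form $g^{-1}(0)$ with $g\colon X\to\mathbb{R}$ continuous. A subspace $Y\subseteq X$ is $C^*$-embedded if every bounded continuous real-valued function on $Y$ extends to a continuous function on $X$. An $F$-space is a Tychonoff space in which each cozero-set is $C^*$-embedded. A space has the $G_\delta$-property if every non-empty $G_\delta$-set has non-empty interior. A Parovičenko space is a zero-dimensional (having a base of clopen sets) compact Hausdorff space without isolated points which is an $F$-space and has the $G_\delta$-property. $\omega$ carries the discrete topology, $\beta\omega$ is its Stone–Čech compactification, $\omega^*=\beta\omega\setminus\omega$ is the remainder, and for injective $\phi\colon\omega\to\omega$ the Stone–Čech extension $\beta\phi\colon\beta\omega\to\beta\omega$ restricts to a continuous map $\omega^*\to\omega^*$. *)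

theory Defs
  imports "HOL-Analysis.Analysis"
begin

section \<open>Classes of topological spaces\<close>

definition Tychonoff_space :: "'a topology \<Rightarrow> bool" where
  "Tychonoff_space X \<longleftrightarrow> completely_regular_space X \<and> Hausdorff_space X"

definition cozero_set_in :: "'a topology \<Rightarrow> 'a set \<Rightarrow> bool" where
  "cozero_set_in X S \<longleftrightarrow>
     (\<exists>g. continuous_map X euclideanreal g \<and> S = topspace X - {x \<in> topspace X. g x = 0})"

definition C_star_embedded_in :: "'a topology \<Rightarrow> 'a set \<Rightarrow> bool" where
  "C_star_embedded_in X S \<longleftrightarrow>
     S \<subseteq> topspace X \<and>
     (\<forall>f. continuous_map (subtopology X S) euclideanreal f \<and> bounded (f ` S) \<longrightarrow>
          (\<exists>g. continuous_map X euclideanreal g \<and> (\<forall>x\<in>S. g x = f x)))"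

definition F_space :: "'a topology \<Rightarrow> bool" where
  "F_space X \<longleftrightarrow> Tychonoff_space X \<and> (\<forall>S. cozero_set_in X S \<longrightarrow> C_star_embedded_in X S)"

definition G_delta_property :: "'a topology \<Rightarrow> bool" where
  "G_delta_property X \<longleftrightarrow> (\<forall>S. gdelta_in X S \<and> S \<noteq> {} \<longrightarrow> X interior_of S \<noteq> {})"

definition zero_dimensional_space :: "'a topology \<Rightarrow> bool" where
  "zero_dimensional_space X \<longleftrightarrow>
     (\<exists>\<B>. (\<forall>B\<in>\<B>. openin X B \<and> closedin X B) \<and> openin X = arbitrary union_of (\<lambda>B. B \<in> \<B>))"

definition Parovicenko_space :: "'a topology \<Rightarrow> bool" where
  "Parovicenko_space X \<longleftrightarrow>
     zero_dimensional_space X \<and> compact_space X \<and> Hausdorff_space X \<and>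
     (\<forall>x\<in>topspace X. \<not> openin X {x}) \<and> F_space X \<and> G_delta_property X"

section \<open>Function spaces and weak P-points\<close>

text \<open>Points of the function space are maps that are \<^const>\<open>extensional\<close> on the domain,
  so that distinct elements of the HOL type represent distinct continuous maps.\<close>

definition continuous_maps :: "'a topology \<Rightarrow> 'b topology \<Rightarrow> ('a \<Rightarrow> 'b) set" where
  "continuous_maps X Y = {f \<in> extensional (topspace X). continuous_map X Y f}"

definition compact_open_topology :: "'a topology \<Rightarrow> 'b topology \<Rightarrow> ('a \<Rightarrow> 'b) topology" where
  "compact_open_topology X Y =
     topology_generated_by
       {{f \<in> continuous_maps X Y. f ` C \<subseteq> U} | C U. compactin X C \<and> openin Y U}"

lemma topspace_compact_open_topology [simp]:
  "topspace (compact_open_topology X Y) = continuous_maps X Y"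
proof -
  have "continuous_maps X Y \<in>
      {{f \<in> continuous_maps X Y. f ` C \<subseteq> U} | C U. compactin X C \<and> openin Y U}"
    by (rule CollectI, rule exI[of _ "{}"], rule exI[of _ "topspace Y"]) auto
  then show ?thesis
    unfolding compact_open_topology_def by (subst topology_generated_by_topspace) blast
qed

definition weak_P_point :: "'a topology \<Rightarrow> 'a \<Rightarrow> bool" where
  "weak_P_point X p \<longleftrightarrow>
     p \<in> topspace X \<and>
     (\<forall>D. D \<subseteq> topspace X \<and> countable D \<and> p \<notin> D \<longrightarrow> p \<notin> X closure_of D)"

definition dense_in :: "'a topology \<Rightarrow> 'a set \<Rightarrow> bool" where
  "dense_in X D \<longleftrightarrow> D \<subseteq> topspace X \<and> X closure_of D = topspace X"

section \<open>Stone--Cech compactifications\<close>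

text \<open>\<open>B\<close>, together with the embedding \<open>e\<close>, is a Stone--Cech compactification of \<open>X\<close>: a Hausdorff
  compactification in which the copy of \<open>X\<close> is \<open>C\<^sup>*\<close>-embedded. It is unique up to a homeomorphism
  that respects the embeddings; existence for Tychonoff \<open>X\<close> is shown below.\<close>

definition Stone_Cech_compactification :: "'a topology \<Rightarrow> ('a \<Rightarrow> 'b) \<Rightarrow> 'b topology \<Rightarrow> bool" where
  "Stone_Cech_compactification X e B \<longleftrightarrow>
     compact_space B \<and> Hausdorff_space B \<and> embedding_map X B e \<and>
     dense_in B (e ` topspace X) \<and> C_star_embedded_in B (e ` topspace X)"

definition Stone_Cech_remainder :: "'a topology \<Rightarrow> ('a \<Rightarrow> 'b) \<Rightarrow> 'b topology \<Rightarrow> 'b topology" where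
  "Stone_Cech_remainder X e B = subtopology B (topspace B - e ` topspace X)"

text \<open>The extension of \<open>\<phi> : X \<rightarrow> X\<close> to the unique continuous self-map of \<open>B\<close>.\<close>

definition Stone_Cech_extension ::
    "'a topology \<Rightarrow> ('a \<Rightarrow> 'b) \<Rightarrow> 'b topology \<Rightarrow> ('a \<Rightarrow> 'a) \<Rightarrow> 'b \<Rightarrow> 'b" where
  "Stone_Cech_extension X e B \<phi> =
     (THE h. h \<in> continuous_maps B B \<and> (\<forall>x\<in>topspace X. h (e x) = e (\<phi> x)))"

lemma Stone_Cech_compactification_exists:
  fixes X :: "'a topology"
  assumes "Tychonoff_space X"
  shows "\<exists>(e :: 'a \<Rightarrow> ('a \<Rightarrow> real) \<Rightarrow> real) B. Stone_Cech_compactification X e B"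
proof -
  define K where "K = mspace (submetric (cfunspace X euclidean_metric)
                               {f. f \<in> topspace X \<rightarrow> {0..1::real}})"
  define P where "P = product_topology (\<lambda>f. top_of_set {0..1::real}) K"
  define e where "e = (\<lambda>x. \<lambda>f\<in>K. f x)"
  define S where "S = e ` topspace X"
  define B where "B = subtopology P (P closure_of S)"
  have emb: "embedding_map X P e"
    using completely_regular_space_cube_embedding_explicit assms
    unfolding K_def P_def e_def Tychonoff_space_def by blast
  have SP: "S \<subseteq> topspace P"
    using homeomorphic_imp_continuous_map[OF emb[unfolded embedding_map_def]]
      continuous_map_image_subset_topspace[of X P e]
    unfolding S_def continuous_map_in_subtopology by simp
  then have SB: "S \<subseteq> P closure_of S"
    by (simp add: closure_of_subset)
  have topB: "topspace B = P closure_of S"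
    unfolding B_def using closure_of_subset_topspace[of P S] by auto
  have "compact_space P"
    unfolding P_def by (simp add: compact_space_product_topology compact_space_subtopology)
  then have "compact_space B"
    unfolding B_def
    by (simp add: closedin_compact_space compact_space_subtopology)
  moreover have "Hausdorff_space P"
    unfolding P_def by (simp add: Hausdorff_space_product_topology Hausdorff_space_subtopology)
  then have "Hausdorff_space B"
    unfolding B_def by (simp add: Hausdorff_space_subtopology)
  moreover have subB: "subtopology B S = subtopology P S"
    unfolding B_def using SB by (simp add: subtopology_subtopology inf.absorb2)
  then have embB: "embedding_map X B e"
    using emb unfolding embedding_map_def S_def by simp
  moreover have "dense_in B S"
    unfolding dense_in_def topB
    using SB unfolding B_def by (simp add: closure_of_subtopology inf.absorb2)
  moreover have "C_star_embedded_in B S"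
    unfolding C_star_embedded_in_def
  proof (intro conjI allI impI)
    show "S \<subseteq> topspace B"
      using SB topB by simp
  next
    fix f assume f: "continuous_map (subtopology B S) euclideanreal f \<and> bounded (f ` S)"
    then obtain M where M: "M > 0" "\<And>s. s \<in> S \<Longrightarrow> \<bar>f s\<bar> \<le> M"
      by (auto simp: bounded_pos)
    define k where "k = (\<lambda>x\<in>topspace X. (f (e x) + M) / (2 * M))"
    have "continuous_map X (subtopology B S) e"
      using embB unfolding embedding_map_def S_def by (rule homeomorphic_imp_continuous_map)
    then have "continuous_map X euclideanreal (\<lambda>x. f (e x))"
      using f continuous_map_compose[of X _ e euclideanreal f] by (simp add: o_def)
    then have "continuous_map X euclideanreal (\<lambda>x. (f (e x) + M) / (2 * M))"
      using M(1) by (intro continuous_intros) auto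
    then have kc: "continuous_map X euclideanreal k"
      by (rule continuous_map_eq) (simp add: k_def)
    have k01: "k x \<in> {0..1}" if "x \<in> topspace X" for x
      using M(1) M(2)[of "e x"] that by (auto simp: k_def S_def field_simps)
    then have "bounded (k ` topspace X)"
      by (intro bounded_subset[OF bounded_closed_interval[of 0 1]]) auto
    then have kK: "k \<in> K"
      using kc k01 unfolding K_def by (simp add: Pi_iff) (simp add: k_def)
    have "continuous_map P euclideanreal (\<lambda>p. p k)"
      using continuous_map_product_projection[OF kK, of "\<lambda>f. top_of_set {0..1::real}"]
      unfolding P_def continuous_map_in_subtopology by simp
    then have "continuous_map B euclideanreal (\<lambda>p. p k)"
      unfolding B_def by (rule continuous_map_from_subtopology)
    then have "continuous_map B euclideanreal (\<lambda>p. 2 * M * p k - M)"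
      by (intro continuous_intros) auto
    moreover have "2 * M * s k - M = f s" if "s \<in> S" for s
    proof -
      obtain x where x: "x \<in> topspace X" "s = e x"
        using \<open>s \<in> S\<close> unfolding S_def by blast
      then have "s k = k x"
        using kK by (simp add: e_def)
      then show ?thesis
        using x M(1) by (simp add: k_def field_simps)
    qed
    ultimately show "\<exists>g. continuous_map B euclideanreal g \<and> (\<forall>x\<in>S. g x = f x)"
      by blast
  qed
  ultimately have "Stone_Cech_compactification X e B"
    unfolding Stone_Cech_compactification_def S_def by blast
  then show ?thesis by blast
qed

lemma Tychonoff_space_discrete_topology: "Tychonoff_space (discrete_topology U)"
  by (simp add: Tychonoff_space_def completely_regular_space_discrete_topology)

end

theory Submission
  imports Defs
begin

text \<open>
  Both halves of the result rest on one remark about the compact-open topology: a map \<open>f\<close> is a weak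
  P-point as soon as, for every countable set \<open>D\<close> of other maps, finitely many conditions \<open>[C, U]\<close>
  can be found that hold for \<open>f\<close> and one of which fails for each member of \<open>D\<close>
  (\<open>weak_P_point_compact_openI\<close>).

  \<^bold>\<open>Parovicenko spaces.\<close> Let \<open>g\<close> be a continuous map of finite range whose values are weak P-points
  of \<open>X\<close>. Each \<open>h \<in> D\<close> differs from \<open>g\<close> at some point \<open>x\<close> of some fibre of \<open>g\<close>; the value \<open>y\<close> of
  \<open>g\<close> on that fibre is a weak P-point, so it has a neighbourhood that misses all the countably many
  points \<open>h x\<close> that arise on this fibre. The fibres and these neighbourhoods are the conditions
  required (\<open>finite_range_weak_P_point\<close>). Since \<open>X\<close> is compact and zero-dimensional, maps of finite
  range with values in a given dense set are dense (\<open>finite_range_maps_dense\<close>). So everything reduces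
  to the density of the weak P-points in \<open>X\<close> (\<open>weak_P_points_dense\<close>).

  To find a weak P-point in a clopen set \<open>W\<close>, fix countably many disjoint clopen cells in \<open>W\<close>, indexed
  by pairs \<open>(n, t)\<close> where \<open>t\<close> maps subsets of \<open>{..<n}\<close> to numbers below \<open>n\<close>. Every \<open>x \<subseteq> \<nat>\<close> determines
  a column of coordinates \<open>t (x \<inter> {..<n})\<close>, and with respect to a limit \<open>m\<close> of the counting densities
  along an ultrafilter different columns are independent. Let \<open>J\<close> be a set of \<open>\<aleph>\<^sub>1\<close> columns in order type
  \<open>\<omega>\<^sub>1\<close>. Splitting clopen sets into \<open>\<omega>\<^sub>1\<close> disjoint pieces, repeatedly, produces a notion of big
  set such that any \<open>n\<close> sets that are \<open>n\<close>-fold big in a cell have a common point there, although for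
  every countable \<open>D\<close> some such set is clopen and disjoint from \<open>D\<close> (\<open>big_linked\<close>,
  \<open>big_avoiding_countable\<close>). Counting sets as equal if they agree on big sets, in every column there
  is a clopen set that misses \<open>D\<close> and equals a slab of density as close to \<open>1\<close> as desired
  (\<open>column_avoiding_countable\<close>).

  The outer density of a set, computed modulo big sets, is submodular. A minimal submodular function
  below it is a finitely additive measure \<open>\<mu>\<close> on all sets of points (\<open>additive_measure_below\<close>), for
  which every set is determined, up to arbitrarily small error, by countably many columns
  (\<open>countable_support\<close>). Recursion along \<open>J\<close> builds families \<open>G \<beta>\<close> of sets with nonnull finite
  intersections, each deciding all sets that depend on the columns before \<open>\<beta>\<close>. After \<open>\<beta>\<close> one may
  moreover add all sets \<open>T\<close> that, for each \<open>k\<close>, contain the intersection of a member of \<open>G \<beta>\<close> with a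
  slab of density at least \<open>1 - 1 / (k + 2)\<close> in the column \<open>\<beta>\<close>: that column is independent of \<open>G \<beta>\<close>,
  so for finitely many such \<open>T\<close> one picks \<open>k\<close> to be their number (\<open>traces_centred\<close>). The union of the
  \<open>G \<beta>\<close> converges to a point \<open>z \<in> W\<close>. If \<open>D = {d\<^sub>0, d\<^sub>1, \<dots>}\<close> does not contain \<open>z\<close>, choose decreasing
  clopen neighbourhoods \<open>U k\<close> of \<open>z\<close> with \<open>d k \<notin> U k\<close>; all of them lie in one \<open>G \<beta>\<close>. Let the clopen
  set \<open>H k\<close> miss \<open>D\<close> and equal a slab in the column \<open>\<beta>\<close> of density at least \<open>1 - 1 / (k + 2)\<close>. As \<open>X\<close>
  is an F-space, there is a clopen \<open>T\<close> that contains all \<open>H k \<inter> U k\<close> and misses \<open>D\<close>, and it is one of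
  the sets that were added. Hence \<open>T\<close> is a neighbourhood of \<open>z\<close> that misses \<open>D\<close>
  (\<open>weak_P_point_in\<close>).

  \<^bold>\<open>The remainder of the natural numbers.\<close> Its clopen sets are the sets \<open>star S\<close> of the points of the
  remainder in the closure of \<open>S\<close>. A basic condition on a continuous self-map prescribes, for almost all
  \<open>n\<close>, an infinite set in which it suffices to choose \<open>\<phi> n\<close>, and this can be done injectively
  (\<open>extensions_of_injections_dense\<close>). Now let \<open>\<phi>\<close> be injective and let \<open>G 0, G 1, \<dots>\<close> be
  continuous self-maps that differ from the extension of \<open>\<phi>\<close>. There are disjoint infinite sets \<open>S n\<close>
  such that \<open>G n\<close> maps \<open>star (S n)\<close> off \<open>star (\<phi> ` S n)\<close>. Shrinking all of them infinitely often and
  diagonalising gives infinite \<open>T n \<subseteq> S n\<close> such that \<open>G n\<close> maps \<open>star (T n)\<close> off \<open>star E\<close> for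
  \<open>E = (\<Union>k. \<phi> ` T k)\<close>. The single condition \<open>[star (\<phi> -` E), star E]\<close> then holds for the extension of
  \<open>\<phi>\<close> and fails for every \<open>G n\<close> (\<open>extension_of_injection_weak_P_point\<close>).
\<close>

section \<open>Clopen sets\<close>

definition clopenin :: "'a topology \<Rightarrow> 'a set \<Rightarrow> bool" where
  "clopenin X b \<longleftrightarrow> openin X b \<and> closedin X b"

lemma clopenin_subset: "clopenin X b \<Longrightarrow> b \<subseteq> topspace X"
  by (simp add: clopenin_def openin_subset)

lemma clopenin_empty [simp]: "clopenin X {}"
  by (simp add: clopenin_def)

lemma clopenin_topspace [simp]: "clopenin X (topspace X)"
  by (simp add: clopenin_def)

lemma clopenin_Int: "clopenin X a \<Longrightarrow> clopenin X b \<Longrightarrow> clopenin X (a \<inter> b)"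
  by (auto simp: clopenin_def)

lemma clopenin_Un: "clopenin X a \<Longrightarrow> clopenin X b \<Longrightarrow> clopenin X (a \<union> b)"
  by (auto simp: clopenin_def)

lemma clopenin_Diff: "clopenin X a \<Longrightarrow> clopenin X b \<Longrightarrow> clopenin X (a - b)"
  by (auto simp: clopenin_def openin_diff closedin_diff)

lemma clopenin_UN: "finite K \<Longrightarrow> (\<And>k. k \<in> K \<Longrightarrow> clopenin X (f k)) \<Longrightarrow> clopenin X (\<Union>k\<in>K. f k)"
  by (induction K rule: finite_induct) (auto intro: clopenin_Un)

lemma clopenin_INT:
  "finite K \<Longrightarrow> K \<noteq> {} \<Longrightarrow> (\<And>k. k \<in> K \<Longrightarrow> clopenin X (f k)) \<Longrightarrow> clopenin X (\<Inter>k\<in>K. f k)"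
  by (induction K rule: finite_ne_induct) (auto intro: clopenin_Int)

lemma zero_dimensional_base:
  assumes "zero_dimensional_space X" "openin X U" "x \<in> U"
  obtains b where "clopenin X b" "x \<in> b" "b \<subseteq> U"
proof -
  obtain \<B> where \<B>: "\<forall>B\<in>\<B>. openin X B \<and> closedin X B"
    "openin X = arbitrary union_of (\<lambda>B. B \<in> \<B>)"
    using assms(1) unfolding zero_dimensional_space_def by blast
  then have "(arbitrary union_of (\<lambda>B. B \<in> \<B>)) U"
    using assms(2) by simp
  then show thesis
    using \<B>(1) assms(3) that unfolding union_of_def arbitrary_def clopenin_def by blast
qed

lemma clopen_separation:
  assumes X: "zero_dimensional_space X" "compact_space X"
    and "closedin X K" "closedin X L" "K \<inter> L = {}"
  obtains b where "clopenin X b" "K \<subseteq> b" "b \<inter> L = {}"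
proof -
  have "\<exists>b. clopenin X b \<and> x \<in> b \<and> b \<inter> L = {}" if "x \<in> K" for x
  proof -
    have "openin X (topspace X - L)" "x \<in> topspace X - L"
      using assms that closedin_subset[of X K] by auto
    then show ?thesis
      by (rule zero_dimensional_base[OF X(1)]) blast
  qed
  then obtain b where b: "\<And>x. x \<in> K \<Longrightarrow> clopenin X (b x) \<and> x \<in> b x \<and> b x \<inter> L = {}"
    by metis
  have "compactin X K"
    using assms closedin_compact_space by blast
  moreover have "\<forall>V\<in>b ` K. openin X V" "K \<subseteq> \<Union>(b ` K)"
    using b by (auto simp: clopenin_def)
  ultimately obtain F where F: "finite F" "F \<subseteq> b ` K" "K \<subseteq> \<Union>F"
    by (meson compactinD)
  have "clopenin X (\<Union>V\<in>F. V)"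
    using F b by (intro clopenin_UN) auto
  then show thesis
    using F b by (intro that[of "\<Union>F"]) auto
qed

text \<open>Sending a point of the union to the reciprocal of one plus the first index at which it is
  covered, and all other points to \<open>0\<close>, gives a continuous function, because points covered only late
  have small values.\<close>

lemma cozero_countable_Union_clopen:
  fixes w :: "nat \<Rightarrow> 'a set"
  assumes w: "\<And>k. clopenin X (w k)"
  shows "cozero_set_in X (\<Union>k. w k)"
proof -
  define W where "W = (\<Union>k. w k)"
  define g where "g x = (if x \<in> W then 1 / (1 + real (LEAST k. x \<in> w k)) else 0)" for x
  define u where "u k = w k - (\<Union>j<k. w j)" for k
  have u: "clopenin X (u k)" for k
    unfolding u_def using w by (intro clopenin_Diff clopenin_UN) auto
  have gu: "g x = 1 / (1 + real k)" if "x \<in> u k" for x k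
  proof -
    have "(LEAST k. x \<in> w k) = k"
      using that unfolding u_def by (intro Least_equality) (auto simp: not_less[symmetric])
    then show ?thesis
      using that by (auto simp: g_def u_def W_def)
  qed
  have Wu: "\<exists>k. x \<in> u k" if x: "x \<in> W" for x
  proof -
    have "\<exists>k. x \<in> w k"
      using x by (auto simp: W_def)
    then have "x \<in> w (LEAST k. x \<in> w k)"
      by (rule LeastI_ex)
    moreover have "x \<notin> w j" if "j < (LEAST k. x \<in> w k)" for j
      using not_less_Least[OF that] .
    ultimately show ?thesis
      unfolding u_def by blast
  qed
  have "continuous_map X euclideanreal g"
    unfolding continuous_map_def
  proof (intro conjI allI impI)
    fix S :: "real set"
    assume "openin euclideanreal S"
    then have S: "open S" by simp
    show "openin X {x \<in> topspace X. g x \<in> S}"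
    proof (subst openin_subopen, intro ballI)
      fix x
      assume x: "x \<in> {x \<in> topspace X. g x \<in> S}"
      show "\<exists>T. openin X T \<and> x \<in> T \<and> T \<subseteq> {x \<in> topspace X. g x \<in> S}"
      proof (cases "x \<in> W")
        case True
        then obtain k where k: "x \<in> u k"
          using Wu by blast
        then have "u k \<subseteq> {x \<in> topspace X. g x \<in> S}"
          using gu x clopenin_subset[OF u[of k]] by force
        then show ?thesis
          using k u[of k] unfolding clopenin_def by blast
      next
        case False
        then have "0 \<in> S"
          using x by (simp add: g_def)
        then obtain e where e: "e > 0" "ball 0 e \<subseteq> S"
          using S openE by blast
        obtain n where n: "inverse (real (Suc n)) < e"
          using reals_Archimedean e(1) by blast
        define T where "T = topspace X - (\<Union>j<n. w j)"
        have "clopenin X T"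
          unfolding T_def using w by (intro clopenin_Diff clopenin_UN) auto
        moreover have "g y \<in> S" if "y \<in> T" for y
        proof (cases "y \<in> W")
          case True
          then obtain k where k: "y \<in> u k"
            using Wu by blast
          have "y \<in> w k"
            using k by (auto simp: u_def)
          then have "n \<le> k"
            using that unfolding T_def by (meson DiffD2 UN_I lessThan_iff not_le)
          then have "1 / (1 + real k) \<le> inverse (real (Suc n))"
            by (simp add: field_simps)
          then have "\<bar>g y\<bar> < e"
            using gu[OF k] n by simp
          then show ?thesis
            using e(2) by (auto simp: subset_iff dist_real_def)
        qed (use \<open>0 \<in> S\<close> in \<open>auto simp: g_def\<close>)
        moreover have "x \<in> T"
          using x False by (auto simp: T_def W_def)
        ultimately show ?thesis
          by (intro exI[of _ T]) (auto simp: clopenin_def dest: openin_subset)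
      qed
    qed
  qed simp
  moreover have "W = topspace X - {x \<in> topspace X. g x = 0}"
  proof -
    have "g x \<noteq> 0" if "x \<in> W" for x
      using that by (auto simp: g_def)
    moreover have "W \<subseteq> topspace X"
      using w clopenin_subset by (auto simp: W_def)
    ultimately show ?thesis
      by (auto simp: g_def)
  qed
  ultimately show ?thesis
    unfolding cozero_set_in_def W_def by blast
qed

locale parovicenko =
  fixes X :: "'a topology"
  assumes parovicenko: "Parovicenko_space X"
begin

lemma zero_dimensional: "zero_dimensional_space X"
  and compact: "compact_space X"
  and Hausdorff: "Hausdorff_space X"
  using parovicenko by (simp_all add: Parovicenko_space_def)

lemma clopen_nbhd:
  assumes "openin X U" "x \<in> U"
  obtains b where "clopenin X b" "x \<in> b" "b \<subseteq> U"
  using zero_dimensional_base[OF zero_dimensional assms] by blast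

lemma clopen_nbhd_avoiding_closure:
  assumes "x \<in> topspace X" "x \<notin> X closure_of W"
  obtains b where "clopenin X b" "x \<in> b" "b \<inter> W = {}"
proof -
  obtain U where "openin X U" "x \<in> U" "U \<inter> W = {}"
    using assms unfolding in_closure_of by blast
  moreover from this obtain b where "clopenin X b" "x \<in> b" "b \<subseteq> U"
    using clopen_nbhd by blast
  ultimately show thesis
    using that[of b] by blast
qed

text \<open>The union of all the sets involved is a cozero-set, and on it the characteristic function
  of the union of the \<open>w k\<close> is continuous. In an F-space this function extends to all of \<open>X\<close>; a clopen
  set separates the points where the extension is at least \<open>1\<close> from those where it is at most \<open>0\<close>.\<close>

lemma countable_clopen_interpolation_nat:
  fixes w u :: "nat \<Rightarrow> 'a set"
  assumes w: "\<And>k. clopenin X (w k)" and u: "\<And>k. clopenin X (u k)"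
    and disj: "\<And>k l. w k \<inter> u l = {}"
  obtains H where "clopenin X H" "\<And>k. w k \<subseteq> H" "\<And>k. H \<inter> u k = {}"
proof -
  define W where "W = (\<Union>k. w k)"
  define O' where "O' = (\<Union>k. u k)"
  have WO: "openin X W" "openin X O'"
    unfolding W_def O'_def using w u by (auto simp: clopenin_def)
  have WO_disj: "W \<inter> O' = {}"
    unfolding W_def O'_def using disj by blast
  define Y where "Y = W \<union> O'"
  have "cozero_set_in X (\<Union>k. w k \<union> u k)"
    using w u by (intro cozero_countable_Union_clopen clopenin_Un)
  moreover have "(\<Union>k. w k \<union> u k) = Y"
    by (auto simp: Y_def W_def O'_def)
  ultimately have emb: "C_star_embedded_in X Y"
    using parovicenko by (auto simp: Parovicenko_space_def F_space_def)
  define f where "f x = (if x \<in> W then 1 else 0 :: real)" for x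
  have "continuous_map (subtopology X Y) euclideanreal f"
    unfolding continuous_map_def
  proof (intro conjI allI impI)
    fix S :: "real set"
    have "openin X ((if 1 \<in> S then W else {}) \<union> (if 0 \<in> S then O' else {}))"
      using WO by auto
    moreover have "{x \<in> topspace (subtopology X Y). f x \<in> S} =
        ((if 1 \<in> S then W else {}) \<union> (if 0 \<in> S then O' else {})) \<inter> Y"
      using WO_disj openin_subset[OF WO(1)] openin_subset[OF WO(2)]
      by (auto simp: f_def Y_def topspace_subtopology)
    ultimately show "openin (subtopology X Y) {x \<in> topspace (subtopology X Y). f x \<in> S}"
      by (metis openin_subtopology)
  qed simp
  moreover have "bounded (f ` Y)"
    by (rule bounded_subset[of "{0, 1}"]) (auto simp: f_def)
  ultimately obtain g where g: "continuous_map X euclideanreal g" "\<forall>x\<in>Y. g x = f x"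
    using emb unfolding C_star_embedded_in_def by blast
  have "closedin X {x \<in> topspace X. g x \<in> {1..}}" "closedin X {x \<in> topspace X. g x \<in> {..0}}"
    by (rule closedin_continuous_map_preimage[OF g(1)], simp)+
  then obtain H where H: "clopenin X H" "{x \<in> topspace X. g x \<in> {1..}} \<subseteq> H"
      "H \<inter> {x \<in> topspace X. g x \<in> {..0}} = {}"
    by (rule clopen_separation[OF zero_dimensional compact]) auto
  show thesis
  proof (rule that[OF H(1)])
    fix k
    have gW: "g x = 1" if "x \<in> W" for x
      using that g(2) by (simp add: f_def Y_def)
    then have "g x = 1" if "x \<in> w k" for x
      using that by (auto simp: W_def)
    then show "w k \<subseteq> H"
      using H(2) clopenin_subset[OF w[of k]] by (auto simp: subset_iff)
    have "g x = 0" if "x \<in> O'" for x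
      using that g(2) WO_disj by (auto simp: f_def Y_def)
    then have "g x = 0" if "x \<in> u k" for x
      using that by (auto simp: O'_def)
    then show "H \<inter> u k = {}"
      using H(3) clopenin_subset[OF u[of k]] by (auto simp: subset_iff)
  qed
qed

lemma countable_clopen_interpolation:
  assumes "countable \<W>" "countable \<U>"
    and W: "\<And>w. w \<in> \<W> \<Longrightarrow> clopenin X w" and U: "\<And>u. u \<in> \<U> \<Longrightarrow> clopenin X u"
    and disj: "\<And>w u. w \<in> \<W> \<Longrightarrow> u \<in> \<U> \<Longrightarrow> w \<inter> u = {}"
  obtains H where "clopenin X H" "\<And>w. w \<in> \<W> \<Longrightarrow> w \<subseteq> H" "\<And>u. u \<in> \<U> \<Longrightarrow> H \<inter> u = {}"
proof -
  define f where "f = from_nat_into (insert {} \<W>)"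
  define g where "g = from_nat_into (insert {} \<U>)"
  have f: "range f = insert {} \<W>" and g: "range g = insert {} \<U>"
    unfolding f_def g_def using assms(1,2) by simp_all
  have fW: "f k \<in> insert {} \<W>" and gU: "g k \<in> insert {} \<U>" for k
    using f g by blast+
  obtain H where "clopenin X H" "\<And>k. f k \<subseteq> H" "\<And>k. H \<inter> g k = {}"
  proof (rule countable_clopen_interpolation_nat[of f g])
    show "clopenin X (f k)" for k
      using fW[of k] W by auto
    show "clopenin X (g k)" for k
      using gU[of k] U by auto
    show "f k \<inter> g l = {}" for k l
      using fW[of k] gU[of l] disj by auto
  qed blast
  moreover have "\<exists>k. w = f k" if "w \<in> \<W>" for w
    using f that by (metis imageE insertI2)
  moreover have "\<exists>k. u = g k" if "u \<in> \<U>" for u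
    using g that by (metis imageE insertI2)
  ultimately show thesis
    using that[of H] by metis
qed

lemma disjoint_countable_Unions_closures_disjoint:
  assumes "countable \<W>" "countable \<U>"
    and W: "\<And>w. w \<in> \<W> \<Longrightarrow> clopenin X w" and U: "\<And>u. u \<in> \<U> \<Longrightarrow> clopenin X u"
    and disj: "\<And>w u. w \<in> \<W> \<Longrightarrow> u \<in> \<U> \<Longrightarrow> w \<inter> u = {}"
  shows "X closure_of \<Union>\<W> \<inter> X closure_of \<Union>\<U> = {}"
proof -
  obtain H where H: "clopenin X H" "\<And>w. w \<in> \<W> \<Longrightarrow> w \<subseteq> H" "\<And>u. u \<in> \<U> \<Longrightarrow> H \<inter> u = {}"
    using countable_clopen_interpolation[OF assms] by blast
  have "X closure_of \<Union>\<W> \<subseteq> H"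
    using H by (intro closure_of_minimal) (auto simp: clopenin_def)
  moreover have "X closure_of \<Union>\<U> \<subseteq> topspace X - H"
    using H U clopenin_subset by (intro closure_of_minimal) (fastforce simp: clopenin_def)+
  ultimately show ?thesis
    by blast
qed

text \<open>Each point of \<open>D\<close> lies outside the closure of the union of \<open>\<W>\<close>, hence in a clopen set
  disjoint from it. These countably many clopen sets can be added to \<open>\<U>\<close> before interpolating.\<close>

lemma clopen_superset_avoiding:
  assumes "countable \<W>" "\<And>w. w \<in> \<W> \<Longrightarrow> clopenin X w"
    and D: "countable D" "D \<subseteq> topspace X" "D \<inter> X closure_of \<Union>\<W> = {}"
    and \<U>: "countable \<U>" "\<And>u. u \<in> \<U> \<Longrightarrow> clopenin X u" "\<And>w u. w \<in> \<W> \<Longrightarrow> u \<in> \<U> \<Longrightarrow> w \<inter> u = {}"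
  obtains H where "clopenin X H" "\<And>w. w \<in> \<W> \<Longrightarrow> w \<subseteq> H" "H \<inter> D = {}" "\<And>u. u \<in> \<U> \<Longrightarrow> H \<inter> u = {}"
proof -
  have "\<exists>b. clopenin X b \<and> d \<in> b \<and> b \<inter> \<Union>\<W> = {}" if "d \<in> D" for d
  proof -
    have "d \<in> topspace X" "d \<notin> X closure_of \<Union>\<W>"
      using D that by auto
    then show ?thesis
      by (rule clopen_nbhd_avoiding_closure) blast
  qed
  then obtain b where b: "\<And>d. d \<in> D \<Longrightarrow> clopenin X (b d) \<and> d \<in> b d \<and> b d \<inter> \<Union>\<W> = {}"
    by metis
  obtain H where H: "clopenin X H" "\<And>w. w \<in> \<W> \<Longrightarrow> w \<subseteq> H" "\<And>u. u \<in> \<U> \<union> b ` D \<Longrightarrow> H \<inter> u = {}"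
  proof (rule countable_clopen_interpolation[of \<W> "\<U> \<union> b ` D"])
    show "w \<inter> u = {}" if "w \<in> \<W>" "u \<in> \<U> \<union> b ` D" for w u
      using that b \<U>(3) by fastforce
  qed (use assms b in auto)
  then show thesis
    using b by (intro that[of H]) fastforce+
qed

text \<open>By compactness the intersection is a nonempty \<open>G\<^sub>\<delta>\<close>-set, so it has interior points.
  This is what keeps the transfinite splitting of a clopen set going through countable limit stages.\<close>

lemma clopen_below_countable_centred:
  assumes "countable \<D>" "\<And>b. b \<in> \<D> \<Longrightarrow> clopenin X b"
    and fip: "\<And>\<F>. finite \<F> \<Longrightarrow> \<F> \<subseteq> \<D> \<Longrightarrow> topspace X \<inter> \<Inter>\<F> \<noteq> {}"
  obtains b where "clopenin X b" "b \<noteq> {}" "\<And>d. d \<in> \<D> \<Longrightarrow> b \<subseteq> d"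
proof -
  define \<D>' where "\<D>' = insert (topspace X) \<D>"
  have "\<Inter>\<D>' \<noteq> {}"
  proof -
    have "\<Inter>\<F> \<noteq> {}" if "finite \<F>" "\<F> \<subseteq> \<D>'" for \<F>
    proof -
      have "topspace X \<inter> \<Inter>(\<F> - {topspace X}) \<noteq> {}"
        using that by (intro fip) (auto simp: \<D>'_def)
      then show ?thesis
        by blast
    qed
    moreover have "\<forall>C\<in>\<D>'. closedin X C"
      using assms(2) by (auto simp: \<D>'_def clopenin_def)
    ultimately show ?thesis
      using compact[unfolded compact_space_fip, rule_format, of \<D>'] by simp
  qed
  moreover have "gdelta_in X (\<Inter>\<D>')"
    using assms by (intro gdelta_in_Inter) (auto simp: \<D>'_def clopenin_def intro: open_imp_gdelta_in)
  ultimately have "X interior_of \<Inter>\<D>' \<noteq> {}"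
    using parovicenko unfolding Parovicenko_space_def G_delta_property_def by blast
  then obtain x where "x \<in> X interior_of \<Inter>\<D>'"
    by blast
  then obtain b where "clopenin X b" "x \<in> b" "b \<subseteq> X interior_of \<Inter>\<D>'"
    by (rule clopen_nbhd[OF openin_interior_of])
  then show thesis
    using interior_of_subset[of X "\<Inter>\<D>'"] by (intro that[of b]) (auto simp: \<D>'_def)
qed

lemma clopen_split:
  assumes "clopenin X b" "b \<noteq> {}"
  obtains a a' where "clopenin X a" "clopenin X a'" "a \<noteq> {}" "a' \<noteq> {}" "a \<inter> a' = {}" "a \<union> a' \<subseteq> b"
proof -
  obtain x where x: "x \<in> b" "x \<in> topspace X"
    using assms clopenin_subset by blast
  then have "b \<noteq> {x}"
    using assms parovicenko unfolding Parovicenko_space_def clopenin_def by metis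
  then obtain y where y: "y \<in> b" "y \<noteq> x" "y \<in> topspace X"
    using x assms clopenin_subset by blast
  have "openin X (b - {y})"
    using assms y(3) closedin_Hausdorff_singleton[OF Hausdorff, of y]
    by (auto simp: clopenin_def openin_diff)
  then obtain a where a: "clopenin X a" "x \<in> a" "a \<subseteq> b - {y}"
    using clopen_nbhd[of "b - {y}" x] x y by blast
  show thesis
    by (rule that[of a "b - a"]) (use a y assms clopenin_Diff in auto)
qed

end

section \<open>Families without small finite intersections\<close>

text \<open>For the ideal \<open>{{}}\<close> this is the finite intersection property; it is used for the ideal of
  finite sets and for that of the null sets of a measure.\<close>

definition centred_mod :: "('a set \<Rightarrow> bool) \<Rightarrow> 'a set set \<Rightarrow> bool" where
  "centred_mod null \<G> \<longleftrightarrow> (\<forall>\<F>. finite \<F> \<and> \<F> \<subseteq> \<G> \<longrightarrow> \<not> null (\<Inter>\<F>))"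

lemma centred_modD: "centred_mod null \<G> \<Longrightarrow> finite \<F> \<Longrightarrow> \<F> \<subseteq> \<G> \<Longrightarrow> \<not> null (\<Inter>\<F>)"
  by (simp add: centred_mod_def)

text \<open>A maximal centred family \<open>\<M>\<close> decides \<open>b\<close>: otherwise finitely many members of \<open>\<M>\<close> meet \<open>b\<close>
  in a null set, finitely many meet \<open>- b\<close> in a null set, and all of these together have a null
  intersection.\<close>

lemma centred_mod_extension:
  assumes null_mono: "\<And>a b. null b \<Longrightarrow> a \<subseteq> b \<Longrightarrow> null a"
    and null_Un: "\<And>a b. null a \<Longrightarrow> null b \<Longrightarrow> null (a \<union> b)"
    and "\<G> \<subseteq> \<B>" "centred_mod null \<G>"
  obtains \<M> where "\<G> \<subseteq> \<M>" "\<M> \<subseteq> \<B>" "centred_mod null \<M>"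
    "\<And>b. b \<in> \<B> \<Longrightarrow> - b \<in> \<B> \<Longrightarrow> b \<in> \<M> \<or> - b \<in> \<M>"
proof -
  define A where "A = {\<M>. \<G> \<subseteq> \<M> \<and> \<M> \<subseteq> \<B> \<and> centred_mod null \<M>}"
  have "\<exists>M\<in>A. \<forall>X\<in>A. M \<subseteq> X \<longrightarrow> X = M"
  proof (rule subset_Zorn_nonempty)
    show "A \<noteq> {}"
      using assms by (auto simp: A_def)
    fix \<C> :: "'a set set set"
    assume \<C>: "\<C> \<noteq> {}" "subset.chain A \<C>"
    have CA: "\<G> \<subseteq> M \<and> M \<subseteq> \<B> \<and> centred_mod null M" if "M \<in> \<C>" for M
      using \<C>(2) that unfolding subset_chain_def A_def by blast
    have "\<not> null (\<Inter>\<F>)" if fin: "finite \<F>" "\<F> \<subseteq> \<Union>\<C>" for \<F>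
    proof -
      obtain M where "M \<in> \<C>" "\<F> \<subseteq> M"
        using finite_subset_Union_chain[OF fin \<C>] by blast
      then show ?thesis
        using CA[of M] fin by (blast dest: centred_modD)
    qed
    then have "centred_mod null (\<Union>\<C>)"
      by (simp add: centred_mod_def)
    moreover have "\<G> \<subseteq> \<Union>\<C>" "\<Union>\<C> \<subseteq> \<B>"
      using CA \<C>(1) by blast+
    ultimately show "\<Union>\<C> \<in> A"
      by (simp add: A_def)
  qed
  then obtain \<M> where \<M>: "\<M> \<in> A" "\<And>X. X \<in> A \<Longrightarrow> \<M> \<subseteq> X \<Longrightarrow> X = \<M>"
    by blast
  have adj: "\<exists>\<F>. finite \<F> \<and> \<F> \<subseteq> \<M> \<and> null (b \<inter> \<Inter>\<F>)" if "b \<in> \<B>" "b \<notin> \<M>" for b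
  proof -
    have "insert b \<M> \<notin> A"
      using \<M>(2)[of "insert b \<M>"] that by blast
    then have "\<not> centred_mod null (insert b \<M>)"
      using \<M>(1) that by (auto simp: A_def)
    then obtain \<F> where \<F>: "finite \<F>" "\<F> \<subseteq> insert b \<M>" "null (\<Inter>\<F>)"
      unfolding centred_mod_def by blast
    have "b \<inter> \<Inter>(\<F> - {b}) \<subseteq> \<Inter>\<F>"
      by blast
    then have "null (b \<inter> \<Inter>(\<F> - {b}))"
      using null_mono \<F>(3) by blast
    then show ?thesis
      using \<F> by (intro exI[of _ "\<F> - {b}"]) auto
  qed
  have "b \<in> \<M> \<or> - b \<in> \<M>" if b: "b \<in> \<B>" "- b \<in> \<B>" for b
  proof (rule ccontr)
    assume "\<not> (b \<in> \<M> \<or> - b \<in> \<M>)"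
    then obtain \<F> \<F>' where F: "finite \<F>" "\<F> \<subseteq> \<M>" "null (b \<inter> \<Inter>\<F>)"
        "finite \<F>'" "\<F>' \<subseteq> \<M>" "null (- b \<inter> \<Inter>\<F>')"
      using adj b by meson
    have "\<Inter>(\<F> \<union> \<F>') \<subseteq> (b \<inter> \<Inter>\<F>) \<union> (- b \<inter> \<Inter>\<F>')"
      by blast
    then have "null (\<Inter>(\<F> \<union> \<F>'))"
      using F null_Un null_mono by blast
    moreover have "\<not> null (\<Inter>(\<F> \<union> \<F>'))"
      using \<M>(1) F unfolding A_def by (intro centred_modD[of null \<M>]) auto
    ultimately show False
      by blast
  qed
  then show thesis
    using \<M>(1) that[of \<M>] unfolding A_def by blast
qed

section \<open>A submodular function dominates a finitely additive measure\<close>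

definition submodular :: "('a set \<Rightarrow> real) \<Rightarrow> bool" where
  "submodular \<rho> \<longleftrightarrow> \<rho> {} = 0 \<and> (\<forall>a b. a \<subseteq> b \<longrightarrow> \<rho> a \<le> \<rho> b) \<and>
     (\<forall>a b. \<rho> (a \<union> b) + \<rho> (a \<inter> b) \<le> \<rho> a + \<rho> b)"

text \<open>Up to a \<open>\<rho>\<close>-small part, \<open>b\<close> is contained in a member of \<open>\<A>\<close> that is hardly larger. For an
  additive \<open>\<rho>\<close> that agrees with \<open>\<mu>\<close> on \<open>\<A>\<close> this says that \<open>\<A>\<close> is dense for the distance
  \<open>\<rho> (b - a) + \<rho> (a - b)\<close>; the one-sided form also makes sense for submodular functions, and
  it is inherited by smaller functions.\<close>

definition approximated_by :: "'a set set \<Rightarrow> ('a set \<Rightarrow> real) \<Rightarrow> ('a set \<Rightarrow> real) \<Rightarrow> bool" where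
  "approximated_by \<A> \<mu> \<rho> \<longleftrightarrow> (\<forall>b. \<forall>e>0. \<exists>a\<in>\<A>. \<rho> (b - a) \<le> e \<and> \<mu> a \<le> \<rho> b + e)"

lemma submodularD:
  assumes "submodular \<rho>"
  shows "\<rho> {} = 0" "a \<subseteq> b \<Longrightarrow> \<rho> a \<le> \<rho> b" "\<rho> (a \<union> b) + \<rho> (a \<inter> b) \<le> \<rho> a + \<rho> b" "\<rho> a \<ge> 0"
    "\<rho> (a \<union> b) \<le> \<rho> a + \<rho> b"
proof -
  show 1: "\<rho> {} = 0" "a \<subseteq> b \<Longrightarrow> \<rho> a \<le> \<rho> b" "\<rho> (a \<union> b) + \<rho> (a \<inter> b) \<le> \<rho> a + \<rho> b" for a b
    using assms by (auto simp: submodular_def)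
  show 2: "\<rho> a \<ge> 0" for a
    using 1(1) 1(2)[of "{}" a] by simp
  show "\<rho> (a \<union> b) \<le> \<rho> a + \<rho> b"
    using 1(3)[of a b] 2[of "a \<inter> b"] by simp
qed

text \<open>Up to a reordering, the value at \<open>a\<close> is \<open>\<rho> (a \<inter> b) + (\<rho> (a \<union> b) - \<rho> b)\<close>: the size of \<open>a\<close>
  inside \<open>b\<close> plus the increase that \<open>a\<close> causes over \<open>b\<close>. The result is again submodular, lies below \<open>\<rho>\<close>,
  and equals \<open>\<rho>\<close> for every \<open>b\<close> if and only if \<open>\<rho>\<close> is modular.\<close>

definition contract :: "'a set \<Rightarrow> ('a set \<Rightarrow> real) \<Rightarrow> 'a set \<Rightarrow> real" where
  "contract b \<rho> a = \<rho> (a \<inter> b) + \<rho> (a \<union> b) - \<rho> b"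

lemma contract_le: "submodular \<rho> \<Longrightarrow> contract b \<rho> a \<le> \<rho> a"
  using submodularD(3)[of \<rho> a b] by (simp add: contract_def)

lemma submodular_contract:
  assumes "submodular \<rho>"
  shows "submodular (contract b \<rho>)"
  unfolding submodular_def
proof (intro conjI allI impI)
  show "contract b \<rho> {} = 0"
    using submodularD(1)[OF assms] by (simp add: contract_def)
  show "contract b \<rho> a \<le> contract b \<rho> c" if "a \<subseteq> c" for a c
    unfolding contract_def using that by (intro diff_right_mono add_mono submodularD(2)[OF assms]) auto
  fix a c
  have eq: "(a \<union> c) \<inter> b = (a \<inter> b) \<union> (c \<inter> b)" "(a \<inter> c) \<inter> b = (a \<inter> b) \<inter> (c \<inter> b)"
    "(a \<union> c) \<union> b = (a \<union> b) \<union> (c \<union> b)" "(a \<inter> c) \<union> b = (a \<union> b) \<inter> (c \<union> b)"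
    by auto
  show "contract b \<rho> (a \<union> c) + contract b \<rho> (a \<inter> c) \<le> contract b \<rho> a + contract b \<rho> c"
    unfolding contract_def eq
    using submodularD(3)[OF assms, of "a \<inter> b" "c \<inter> b"] submodularD(3)[OF assms, of "a \<union> b" "c \<union> b"]
    by linarith
qed

text \<open>The algebra \<open>\<A>\<close> consists of sets on which the submodular function is already additive. The
  aim is an additive function below it that keeps the approximation of all sets by members of \<open>\<A>\<close>;
  this is what a Hahn--Banach extension would not give.\<close>

locale submodular_on_algebra =
  fixes \<A> :: "'a set set" and \<rho>0 :: "'a set \<Rightarrow> real"
  assumes sub0: "submodular \<rho>0"
    and alg: "a \<in> \<A> \<Longrightarrow> - a \<in> \<A>" "a \<in> \<A> \<Longrightarrow> a' \<in> \<A> \<Longrightarrow> a \<union> a' \<in> \<A>"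
    and compl0: "a \<in> \<A> \<Longrightarrow> \<rho>0 a + \<rho>0 (- a) = \<rho>0 UNIV"
    and approx0: "approximated_by \<A> \<rho>0 \<rho>0"
begin

definition dominated :: "('a set \<Rightarrow> real) set" where
  "dominated = {\<rho>. submodular \<rho> \<and> (\<forall>a. \<rho> a \<le> \<rho>0 a) \<and> \<rho> UNIV = \<rho>0 UNIV \<and> approximated_by \<A> \<rho>0 \<rho>}"

lemma alg_Int: "a \<in> \<A> \<Longrightarrow> a' \<in> \<A> \<Longrightarrow> a \<inter> a' \<in> \<A>"
  using alg(1)[of "- a \<union> - a'"] alg by (simp add: compl_sup)

text \<open>Subadditivity bounds \<open>\<rho> a + \<rho> (- a)\<close> from below by the total mass, and both terms are at
  most the corresponding values of \<open>\<rho>0\<close>, which add up to the total mass. So nothing can decrease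
  on \<open>\<A>\<close>.\<close>

lemma eq_on_algebra:
  assumes "\<rho> \<in> dominated" "a \<in> \<A>"
  shows "\<rho> a = \<rho>0 a"
proof -
  have s: "submodular \<rho>" "\<rho> a \<le> \<rho>0 a" "\<rho> (- a) \<le> \<rho>0 (- a)" "\<rho> UNIV = \<rho>0 UNIV"
    using assms by (auto simp: dominated_def)
  have "\<rho> UNIV \<le> \<rho> a + \<rho> (- a)"
    using submodularD(5)[OF s(1), of a "- a"] by simp
  then show ?thesis
    using s compl0[OF assms(2)] by linarith
qed

lemma modular_on_algebra:
  assumes "a \<in> \<A>" "a' \<in> \<A>"
  shows "\<rho>0 (a \<union> a') + \<rho>0 (a \<inter> a') = \<rho>0 a + \<rho>0 a'"
proof -
  have "\<rho>0 (- a \<union> - a') + \<rho>0 (- a \<inter> - a') \<le> \<rho>0 (- a) + \<rho>0 (- a')"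
    by (rule submodularD(3)[OF sub0])
  moreover have "- a \<union> - a' = - (a \<inter> a')" "- a \<inter> - a' = - (a \<union> a')"
    by auto
  ultimately have "\<rho>0 (- (a \<inter> a')) + \<rho>0 (- (a \<union> a')) \<le> \<rho>0 (- a) + \<rho>0 (- a')"
    by (simp only:)
  then show ?thesis
    using submodularD(3)[OF sub0, of a a'] compl0[OF assms(1)] compl0[OF assms(2)]
      compl0[OF alg_Int[OF assms]] compl0[OF alg(2)[OF assms]] by linarith
qed

text \<open>Only the approximation of a set \<open>d\<close> by a member of \<open>\<A>\<close> needs work. Take approximations \<open>c1\<close>
  of \<open>d \<inter> b\<close>, \<open>c2\<close> of \<open>d \<union> b\<close> and \<open>c3\<close> of \<open>b\<close>, cut down so that they are nested. Inside the
  approximation of \<open>b\<close> use \<open>c1\<close>, outside it use \<open>c2\<close>.\<close>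

lemma contract_dominated:
  assumes \<rho>: "\<rho> \<in> dominated"
  shows "contract b \<rho> \<in> dominated"
proof -
  have s: "submodular \<rho>" and U: "\<rho> UNIV = \<rho>0 UNIV" and le: "\<And>a. \<rho> a \<le> \<rho>0 a"
    and ap: "approximated_by \<A> \<rho>0 \<rho>"
    using \<rho> by (auto simp: dominated_def)
  note mono = submodularD(2)[OF s] and un = submodularD(5)[OF s]
  have s': "submodular (contract b \<rho>)"
    using s by (rule submodular_contract)
  have "approximated_by \<A> \<rho>0 (contract b \<rho>)"
    unfolding approximated_by_def
  proof (intro allI impI)
    fix d and e :: real
    assume "e > 0"
    \<comment> \<open>The three estimates below add up to seven times the accuracy of the approximations.\<close>
    define h where "h = e / 8"
    have h: "h > 0" "e = 8 * h"
      using \<open>e > 0\<close> by (auto simp: h_def)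
    obtain c1 where c1: "c1 \<in> \<A>" "\<rho> ((d \<inter> b) - c1) \<le> h" "\<rho>0 c1 \<le> \<rho> (d \<inter> b) + h"
      using ap h unfolding approximated_by_def by blast
    obtain c2 where c2: "c2 \<in> \<A>" "\<rho> ((d \<union> b) - c2) \<le> h" "\<rho>0 c2 \<le> \<rho> (d \<union> b) + h"
      using ap h unfolding approximated_by_def by blast
    obtain c3 where c3: "c3 \<in> \<A>" "\<rho> (b - c3) \<le> h" "\<rho>0 c3 \<le> \<rho> b + h"
      using ap h unfolding approximated_by_def by blast
    define k3 where "k3 = c3 \<inter> c2"
    define k1 where "k1 = c1 \<inter> k3"
    define c where "c = k1 \<union> (c2 \<inter> - k3)"
    have k: "k3 \<in> \<A>" "k1 \<in> \<A>" "c2 \<inter> - k3 \<in> \<A>" "c \<in> \<A>"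
      unfolding k3_def k1_def c_def using c1 c2 c3 alg alg_Int by simp_all
    have b3: "\<rho> (b - k3) \<le> 2 * h"
    proof -
      have "\<rho> (b - k3) \<le> \<rho> ((b - c3) \<union> ((d \<union> b) - c2))"
        by (rule mono) (auto simp: k3_def)
      also have "\<dots> \<le> \<rho> (b - c3) + \<rho> ((d \<union> b) - c2)"
        by (rule un)
      finally show ?thesis
        using c2 c3 by simp
    qed
    have k3_ge: "\<rho> b \<le> \<rho>0 k3 + 2 * h"
    proof -
      have "\<rho> b \<le> \<rho> (k3 \<union> (b - k3))"
        by (rule mono) auto
      also have "\<dots> \<le> \<rho> k3 + \<rho> (b - k3)"
        by (rule un)
      finally show ?thesis
        using b3 eq_on_algebra[OF \<rho> k(1)] by simp
    qed
    have k3_le: "\<rho>0 k3 \<le> \<rho> b + h"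
      using submodularD(2)[OF sub0, of k3 c3] c3 by (simp add: k3_def)
    have k1_le: "\<rho>0 k1 \<le> \<rho> (d \<inter> b) + h"
      using submodularD(2)[OF sub0, of k1 c1] c1 by (simp add: k1_def)
    have "\<rho>0 c + \<rho>0 {} = \<rho>0 k1 + \<rho>0 (c2 \<inter> - k3)"
      using modular_on_algebra[OF k(2,3)] by (simp add: c_def k1_def Int_ac)
    moreover have "\<rho>0 c2 + \<rho>0 {} = \<rho>0 k3 + \<rho>0 (c2 \<inter> - k3)"
    proof -
      have "k3 \<union> (c2 \<inter> - k3) = c2" "k3 \<inter> (c2 \<inter> - k3) = {}"
        by (auto simp: k3_def)
      then show ?thesis
        using modular_on_algebra[OF k(1,3)] by simp
    qed
    ultimately have "\<rho>0 c = \<rho>0 k1 + \<rho>0 c2 - \<rho>0 k3"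
      by simp
    then have up: "\<rho>0 c \<le> contract b \<rho> d + e"
      using k1_le c2 k3_ge h unfolding contract_def by linarith
    have "contract b \<rho> (d - c) \<le> contract b \<rho> ((d - c2) \<union> (((d \<inter> b) - k1) \<union> (k3 - b)))"
      by (rule submodularD(2)[OF s']) (auto simp: c_def)
    also have "\<dots> \<le> contract b \<rho> (d - c2) + (contract b \<rho> ((d \<inter> b) - k1) + contract b \<rho> (k3 - b))"
      using submodularD(5)[OF s', of "d - c2" "((d \<inter> b) - k1) \<union> (k3 - b)"]
        submodularD(5)[OF s', of "(d \<inter> b) - k1" "k3 - b"] by linarith
    also have "contract b \<rho> (d - c2) \<le> h"
      using contract_le[OF s, of b "d - c2"] mono[of "d - c2" "(d \<union> b) - c2"] c2 by force
    also have "contract b \<rho> ((d \<inter> b) - k1) \<le> 3 * h"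
    proof -
      have "contract b \<rho> ((d \<inter> b) - k1) \<le> \<rho> (((d \<inter> b) - c1) \<union> (b - k3))"
        by (rule order_trans[OF contract_le[OF s]], rule mono) (auto simp: k1_def)
      also have "\<dots> \<le> \<rho> ((d \<inter> b) - c1) + \<rho> (b - k3)"
        by (rule un)
      finally show ?thesis
        using c1 b3 by simp
    qed
    also have "contract b \<rho> (k3 - b) \<le> 3 * h"
    proof -
      have "(k3 - b) \<inter> b = {}" "(k3 - b) \<union> b = k3 \<union> (b - k3)"
        by auto
      then have "contract b \<rho> (k3 - b) = \<rho> (k3 \<union> (b - k3)) - \<rho> b"
        using submodularD(1)[OF s] by (simp add: contract_def)
      also have "\<dots> \<le> \<rho>0 k3 + \<rho> (b - k3) - \<rho> b"
        using un[of k3 "b - k3"] eq_on_algebra[OF \<rho> k(1)] by simp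
      finally show ?thesis
        using k3_le b3 by simp
    qed
    finally have "contract b \<rho> (d - c) \<le> e"
      using h by simp
    then show "\<exists>a\<in>\<A>. contract b \<rho> (d - a) \<le> e \<and> \<rho>0 a \<le> contract b \<rho> d + e"
      using up k(4) by blast
  qed
  moreover have "contract b \<rho> a \<le> \<rho>0 a" for a
    using contract_le[OF s, of b a] le[of a] by linarith
  moreover have "contract b \<rho> UNIV = \<rho>0 UNIV"
    by (simp add: contract_def U)
  ultimately show ?thesis
    using s' by (simp add: dominated_def)
qed

text \<open>Inequalities between values at finitely many sets pass to the infimum, since in a chain one
  function is close to the infimum at all of these sets simultaneously.\<close>

lemma INF_chain_dominated:
  assumes ch: "C \<noteq> {}" "C \<subseteq> dominated" "\<And>\<rho> \<rho>'. \<rho> \<in> C \<Longrightarrow> \<rho>' \<in> C \<Longrightarrow> \<rho> \<le> \<rho>' \<or> \<rho>' \<le> \<rho>"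
  shows "(\<lambda>a. INF \<rho>\<in>C. \<rho> a) \<in> dominated"
proof -
  define i where "i a = (INF \<rho>\<in>C. \<rho> a)" for a
  have s: "submodular \<rho>" and le: "\<rho> a \<le> \<rho>0 a" and U: "\<rho> UNIV = \<rho>0 UNIV"
    and ap: "approximated_by \<A> \<rho>0 \<rho>" if "\<rho> \<in> C" for \<rho> a
    using that ch(2) by (auto simp: dominated_def)
  have bdd: "bdd_below ((\<lambda>\<rho>. \<rho> a) ` C)" for a
    using submodularD(4)[OF s] by (intro bdd_belowI2[of _ 0]) auto
  have lower: "i a \<le> \<rho> a" if "\<rho> \<in> C" for \<rho> a
    unfolding i_def using that bdd by (intro cINF_lower) auto
  have near: "\<exists>\<rho>\<in>C. \<rho> a < i a + e" if "e > 0" for a e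
    using cINF_less_iff[OF ch(1) bdd, of a "i a + e"] that by (simp add: i_def)
  have "submodular i"
    unfolding submodular_def
  proof (intro conjI allI impI)
    have "(\<lambda>\<rho>. \<rho> {}) ` C = (\<lambda>\<rho>. 0) ` C"
      using submodularD(1)[OF s] by (intro image_cong) auto
    then have "(\<lambda>\<rho>. \<rho> {}) ` C = {0}"
      using ch(1) by auto
    then show "i {} = 0"
      by (simp add: i_def)
    show "i a \<le> i b" if "a \<subseteq> b" for a b
    proof (rule field_le_epsilon)
      fix e :: real
      assume "e > 0"
      then obtain \<rho> where "\<rho> \<in> C" "\<rho> b < i b + e"
        using near by blast
      then show "i a \<le> i b + e"
        using lower[of \<rho> a] submodularD(2)[OF s that, of \<rho>] by simp
    qed
    fix a b
    show "i (a \<union> b) + i (a \<inter> b) \<le> i a + i b"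
    proof (rule field_le_epsilon)
      fix e :: real
      assume "e > 0"
      then obtain \<rho>1 \<rho>2 where "\<rho>1 \<in> C" "\<rho>1 a < i a + e / 2" "\<rho>2 \<in> C" "\<rho>2 b < i b + e / 2"
        using near[of "e / 2"] by (metis half_gt_zero)
      then obtain \<rho> where "\<rho> \<in> C" "\<rho> a < i a + e / 2" "\<rho> b < i b + e / 2"
        using ch(3)[of \<rho>1 \<rho>2] by (auto simp: le_fun_def) (meson le_less_trans)+
      then show "i (a \<union> b) + i (a \<inter> b) \<le> i a + i b + e"
        using lower[of \<rho> "a \<union> b"] lower[of \<rho> "a \<inter> b"] submodularD(3)[OF s, of \<rho> a b] by simp
    qed
  qed
  moreover have "i a \<le> \<rho>0 a" for a
    using ch(1) lower le by (meson all_not_in_conv order_trans)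
  moreover have "i UNIV = \<rho>0 UNIV"
  proof -
    have "(\<lambda>\<rho>. \<rho> UNIV) ` C = (\<lambda>\<rho>. \<rho>0 UNIV) ` C"
      using U by (intro image_cong) auto
    then have "(\<lambda>\<rho>. \<rho> UNIV) ` C = {\<rho>0 UNIV}"
      using ch(1) by auto
    then show ?thesis
      by (simp add: i_def)
  qed
  moreover have "approximated_by \<A> \<rho>0 i"
    unfolding approximated_by_def
  proof (intro allI impI)
    fix b and e :: real
    assume "e > 0"
    then obtain \<rho> where \<rho>: "\<rho> \<in> C" "\<rho> b < i b + e / 2"
      using near[of "e / 2"] by (metis half_gt_zero)
    obtain a where "a \<in> \<A>" "\<rho> (b - a) \<le> e / 2" "\<rho>0 a \<le> \<rho> b + e / 2"
      using ap[OF \<rho>(1)] \<open>e > 0\<close> unfolding approximated_by_def by (meson half_gt_zero)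
    then show "\<exists>a\<in>\<A>. i (b - a) \<le> e \<and> \<rho>0 a \<le> i b + e"
      using lower[OF \<rho>(1), of "b - a"] \<rho>(2) \<open>e > 0\<close> by (intro bexI[of _ a]) auto
  qed
  ultimately show ?thesis
    unfolding dominated_def i_def by simp
qed

text \<open>A minimal element of \<open>dominated\<close> equals all of its contractions, hence is modular.\<close>

theorem additive_measure_below:
  obtains \<mu> where "\<mu> {} = 0" "\<And>a. \<mu> a \<ge> 0" "\<And>a b. a \<inter> b = {} \<Longrightarrow> \<mu> (a \<union> b) = \<mu> a + \<mu> b"
    "\<mu> UNIV = \<rho>0 UNIV" "\<And>a. \<mu> a \<le> \<rho>0 a" "\<And>b e. e > 0 \<Longrightarrow> \<exists>a\<in>\<A>. \<mu> (b - a) + \<mu> (a - b) < e"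
proof -
  have "\<exists>m\<in>dominated. \<forall>\<rho>\<in>dominated. m \<ge> \<rho> \<longrightarrow> \<rho> = m"
  proof (rule predicate_Zorn)
    show "partial_order_on dominated (relation_of (\<ge>) dominated)"
      by (rule partial_order_on_relation_ofI) auto
    fix C
    assume "C \<in> Chains (relation_of (\<ge>) dominated)"
    then have C: "\<rho> \<in> dominated \<and> \<rho>' \<in> dominated \<and> (\<rho> \<le> \<rho>' \<or> \<rho>' \<le> \<rho>)" if "\<rho> \<in> C" "\<rho>' \<in> C" for \<rho> \<rho>'
      using that unfolding Chains_def relation_of_def by blast
    show "\<exists>u\<in>dominated. \<forall>a\<in>C. a \<ge> u"
    proof (cases "C = {}")
      case True
      have "\<rho>0 \<in> dominated"
        using sub0 approx0 by (simp add: dominated_def)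
      then show ?thesis
        using True by blast
    next
      case False
      have bdd: "bdd_below ((\<lambda>\<rho>. \<rho> a) ` C)" for a
        using C submodularD(4) unfolding dominated_def by (intro bdd_belowI2[of _ 0]) blast
      have "(\<lambda>a. INF \<rho>\<in>C. \<rho> a) \<in> dominated"
        using C False by (intro INF_chain_dominated) blast+
      moreover have "\<rho> \<ge> (\<lambda>a. INF \<rho>\<in>C. \<rho> a)" if "\<rho> \<in> C" for \<rho>
        using that bdd by (auto simp: le_fun_def intro: cINF_lower)
      ultimately show ?thesis
        by blast
    qed
  qed
  then obtain \<mu> where \<mu>: "\<mu> \<in> dominated" "\<And>\<rho>. \<rho> \<in> dominated \<Longrightarrow> \<rho> \<le> \<mu> \<Longrightarrow> \<rho> = \<mu>"
    by blast
  have s: "submodular \<mu>" and le: "\<And>a. \<mu> a \<le> \<rho>0 a" and U: "\<mu> UNIV = \<rho>0 UNIV"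
    and ap: "approximated_by \<A> \<rho>0 \<mu>"
    using \<mu>(1) by (auto simp: dominated_def)
  have "contract b \<mu> = \<mu>" for b
    using contract_dominated[OF \<mu>(1)] contract_le[OF s] by (intro \<mu>(2)) (auto simp: le_fun_def)
  then have "\<mu> (a \<inter> b) + \<mu> (a \<union> b) - \<mu> b = \<mu> a" for a b
    by (metis contract_def)
  then have modular: "\<mu> (a \<inter> b) + \<mu> (a \<union> b) = \<mu> a + \<mu> b" for a b
    by (simp add: diff_eq_eq)
  have add: "\<mu> (a \<union> b) = \<mu> a + \<mu> b" if "a \<inter> b = {}" for a b
    using modular[of a b] that submodularD(1)[OF s] by simp
  have "\<exists>a\<in>\<A>. \<mu> (b - a) + \<mu> (a - b) < e" if "e > 0" for b e
  proof -
    obtain a where a: "a \<in> \<A>" "\<mu> (b - a) \<le> e / 4" "\<rho>0 a \<le> \<mu> b + e / 4"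
      using ap \<open>e > 0\<close> unfolding approximated_by_def by (metis zero_less_divide_iff zero_less_numeral)
    have "\<mu> a = \<mu> (a \<inter> b) + \<mu> (a - b)"
      using add[of "a \<inter> b" "a - b"] by (simp add: Int_Diff_Un Int_Diff_disjoint)
    moreover have "\<mu> b = \<mu> (a \<inter> b) + \<mu> (b - a)"
      using add[of "b \<inter> a" "b - a"] by (simp add: Int_Diff_Un Int_Diff_disjoint Int_commute[of a b])
    ultimately have "\<mu> (b - a) + \<mu> (a - b) < e"
      using a le[of a] \<open>e > 0\<close> by linarith
    then show ?thesis
      using a(1) by blast
  qed
  then show thesis
    using add le U submodularD(1,4)[OF s] by (intro that[of \<mu>]) auto
qed

end

section \<open>Ultrafilter limits of densities\<close>

text \<open>A maximal family of sets of natural numbers with infinite finite intersections.\<close>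

lemma nonprincipal_ultrafilter_nat:
  obtains F :: "nat filter" where "F \<noteq> bot" "F \<le> sequentially"
    "\<And>P. eventually P F \<or> eventually (\<lambda>n. \<not> P n) F"
proof -
  obtain \<M> :: "nat set set" where \<M>: "centred_mod finite \<M>" "\<And>b. b \<in> \<M> \<or> - b \<in> \<M>"
  proof (rule centred_mod_extension[of "finite :: nat set \<Rightarrow> bool" "{}" UNIV])
    show "centred_mod finite ({} :: nat set set)"
      by (simp add: centred_mod_def)
  qed (auto intro: finite_subset)
  define F where "F = (INF S\<in>\<M>. principal S)"
  have ev: "eventually (\<lambda>n. n \<in> S) F" if "S \<in> \<M>" for S
    using that unfolding F_def by (metis INF_lower eventually_principal filter_leD)
  show thesis
  proof (rule that)
    show "F \<noteq> bot"
      unfolding F_def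
    proof (rule INF_filter_not_bot)
      fix \<F>
      assume "\<F> \<subseteq> \<M>" "finite \<F>"
      then have "\<Inter>\<F> \<noteq> {}"
        using centred_modD[OF \<M>(1)] by (metis finite.emptyI)
      then show "(INF S\<in>\<F>. principal S) \<noteq> bot"
        using INF_principal_finite[OF \<open>finite \<F>\<close>, of "\<lambda>S. S"] by (simp add: principal_eq_bot_iff)
    qed
    show alt: "eventually P F \<or> eventually (\<lambda>n. \<not> P n) F" for P
      using \<M>(2)[of "{n. P n}"] ev[of "{n. P n}"] ev[of "- {n. P n}"] by auto
    have "{N..} \<in> \<M>" for N
    proof (rule ccontr)
      assume "{N..} \<notin> \<M>"
      then have "- {N..} \<in> \<M>"
        using \<M>(2) by blast
      then have "\<not> finite (\<Inter>{- {N..}})"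
        using centred_modD[OF \<M>(1), of "{- {N..}}"] by blast
      then show False
        by (simp add: Compl_atLeast)
    qed
    then have "eventually (\<lambda>n. n \<ge> N) F" for N
      using ev[of "{N..}"] by simp
    then show "F \<le> sequentially"
      by (simp add: filterlim_at_top filterlim_def[symmetric] filterlim_ident
          eventually_sequentially le_filter_def) (meson eventually_mono)
  qed
qed

lemma ultrafilter_convergent:
  fixes f :: "nat \<Rightarrow> real"
  assumes F: "F \<noteq> bot" "\<And>P. eventually P F \<or> eventually (\<lambda>n. \<not> P n) F"
    and f: "\<And>n. f n \<in> {a..b}"
  shows "\<exists>l. (f \<longlongrightarrow> l) F"
proof -
  have "filtermap f F \<noteq> bot" "eventually (\<lambda>x. x \<in> {a..b}) (filtermap f F)"
    using F(1) f by (auto simp: filtermap_bot_iff eventually_filtermap)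
  then obtain x where x: "inf (nhds x) (filtermap f F) \<noteq> bot"
    using compact_Icc[of a b] unfolding compact_filter by blast
  have "eventually (\<lambda>n. f n \<in> S) F" if S: "open S" "x \<in> S" for S
  proof (rule ccontr)
    assume "\<not> eventually (\<lambda>n. f n \<in> S) F"
    then have "eventually (\<lambda>y. y \<notin> S) (filtermap f F)"
      using F(2) by (simp add: eventually_filtermap) blast
    moreover have "eventually (\<lambda>y. y \<in> S) (nhds x)"
      using S eventually_nhds by blast
    ultimately have "eventually (\<lambda>y. False) (inf (nhds x) (filtermap f F))"
      unfolding eventually_inf by blast
    then show False
      using x by simp
  qed
  then show ?thesis
    by (auto simp: tendsto_def)
qed

text \<open>A cell is a pair \<open>(n, t)\<close> with \<open>t\<close> in the \<open>n\<close>-th block. A set \<open>x\<close> of natural numbers picks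
  the coordinate \<open>x \<inter> {..<n}\<close> of \<open>t\<close>; distinct sets \<open>x\<close> pick distinct coordinates for all large \<open>n\<close>,
  so that there are uncountably many asymptotically independent columns on countably many cells.
  The number of values of a coordinate grows with \<open>n\<close>, which makes room for avoiding more and more
  residue classes at small cost.\<close>

definition block :: "nat \<Rightarrow> (nat set \<Rightarrow> nat) set" where
  "block n = PiE (Pow {..<n}) (\<lambda>_. {..<n})"

definition cells :: "(nat \<times> (nat set \<Rightarrow> nat)) set" where
  "cells = (SIGMA n:UNIV. block n)"

definition slab :: "nat set \<Rightarrow> (nat \<Rightarrow> nat set) \<Rightarrow> (nat \<times> (nat set \<Rightarrow> nat)) set" where
  "slab x A = {(n, t) \<in> cells. t (x \<inter> {..<n}) \<in> A n}"

definition determined_by :: "nat set set \<Rightarrow> (nat \<times> (nat set \<Rightarrow> nat)) set \<Rightarrow> bool" where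
  "determined_by E M \<longleftrightarrow> (\<forall>n. \<forall>t\<in>block n. \<forall>t'\<in>block n.
     (\<forall>x\<in>E. t (x \<inter> {..<n}) = t' (x \<inter> {..<n})) \<longrightarrow> ((n, t) \<in> M \<longleftrightarrow> (n, t') \<in> M))"

definition cylinders :: "nat set set \<Rightarrow> (nat \<times> (nat set \<Rightarrow> nat)) set set" where
  "cylinders S = {M. M \<subseteq> cells \<and> (\<exists>E. finite E \<and> E \<subseteq> S \<and> determined_by E M)}"

definition block_density :: "(nat \<times> (nat set \<Rightarrow> nat)) set \<Rightarrow> nat \<Rightarrow> real" where
  "block_density M n = real (card {t \<in> block n. (n, t) \<in> M}) / real (card (block n))"

lemma finite_block [simp]: "finite (block n)"
  by (simp add: block_def finite_PiE)

lemma countable_cells: "countable cells"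
  by (simp add: cells_def countable_finite)

lemma block_nonempty: "n > 0 \<Longrightarrow> block n \<noteq> {}"
  by (auto simp: block_def PiE_eq_empty_iff)

lemma block_density_bounds: "block_density M n \<in> {0..1}"
  using card_mono[of "block n" "{t \<in> block n. (n, t) \<in> M}"]
  by (auto simp: block_density_def divide_le_eq_1)

lemma determined_by_mono: "determined_by E M \<Longrightarrow> E \<subseteq> E' \<Longrightarrow> determined_by E' M"
  unfolding determined_by_def by (meson subsetD)

lemma cylinders_mono: "S \<subseteq> S' \<Longrightarrow> cylinders S \<subseteq> cylinders S'"
  by (auto simp: cylinders_def)

lemma cylinders_empty [simp]: "{} \<in> cylinders S"
  by (auto simp: cylinders_def determined_by_def)

lemma cylinders_subset: "M \<in> cylinders S \<Longrightarrow> M \<subseteq> cells"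
  by (simp add: cylinders_def)

lemma cylinders_Diff: "M \<in> cylinders S \<Longrightarrow> cells - M \<in> cylinders S"
  unfolding cylinders_def determined_by_def by (auto simp: cells_def)

lemma cylinders_Un:
  assumes "M \<in> cylinders S" "M' \<in> cylinders S"
  shows "M \<union> M' \<in> cylinders S"
proof -
  obtain E E' where E: "finite E" "E \<subseteq> S" "determined_by E M" "finite E'" "E' \<subseteq> S" "determined_by E' M'"
    using assms unfolding cylinders_def by blast
  then have "determined_by (E \<union> E') M" "determined_by (E \<union> E') M'"
    by (auto elim: determined_by_mono)
  then have "determined_by (E \<union> E') (M \<union> M')"
    unfolding determined_by_def by blast
  then show ?thesis
    using E assms unfolding cylinders_def by blast
qed

lemma cylinders_Int:
  assumes "M \<in> cylinders S" "M' \<in> cylinders S"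
  shows "M \<inter> M' \<in> cylinders S"
proof -
  have "M \<inter> M' = cells - ((cells - M) \<union> (cells - M'))"
    using assms cylinders_subset by blast
  then show ?thesis
    using assms cylinders_Un cylinders_Diff by metis
qed

lemma slab_cylinder: "x \<in> S \<Longrightarrow> slab x A \<in> cylinders S"
  unfolding cylinders_def determined_by_def slab_def
  by (auto simp: cells_def intro!: exI[of _ "{x}"])

lemma slab_Int: "slab x A \<inter> slab x A' = slab x (\<lambda>n. A n \<inter> A' n)"
  by (auto simp: slab_def)

text \<open>Changing the coordinate \<open>s\<close> is a bijection between the fibres over any two of its values, so
  all fibres are as large as the one over \<open>0\<close>.\<close>

lemma card_slab_fibre:
  assumes s: "s \<in> Pow {..<n}" and P: "P \<subseteq> block n"
    and inv: "\<And>t a. t \<in> P \<Longrightarrow> a < n \<Longrightarrow> t(s := a) \<in> P"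
  shows "card {t \<in> P. t s \<in> A} = card (A \<inter> {..<n}) * card {t \<in> P. t s = 0}"
proof -
  have fin: "finite P"
    using P finite_subset finite_block by blast
  have *: "card {t \<in> P. t s = a} = card {t \<in> P. t s = 0}" if "a < n" for a
  proof (rule bij_betw_same_card[of "\<lambda>t. t(s := 0)"], rule bij_betw_byWitness[where f' = "\<lambda>t. t(s := a)"])
    show "(\<lambda>t. t(s := 0)) ` {t \<in> P. t s = a} \<subseteq> {t \<in> P. t s = 0}"
      using that by (auto intro!: inv)
    show "(\<lambda>t. t(s := a)) ` {t \<in> P. t s = 0} \<subseteq> {t \<in> P. t s = a}"
      using that by (auto intro!: inv)
  qed auto
  have "(\<Sum>a\<in>A \<inter> {..<n}. card {t \<in> P. t s = a}) = (\<Sum>a\<in>A \<inter> {..<n}. card {t \<in> P. t s = 0})"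
    by (rule sum.cong[OF refl], rule *) blast
  then have sum: "(\<Sum>a\<in>A \<inter> {..<n}. card {t \<in> P. t s = a}) = card (A \<inter> {..<n}) * card {t \<in> P. t s = 0}"
    by (simp only: sum_constant of_nat_id)
  have "{t \<in> P. t s \<in> A} = (\<Union>a\<in>A \<inter> {..<n}. {t \<in> P. t s = a})"
    using P s by (auto simp: block_def PiE_def Pi_def)
  also have "card \<dots> = (\<Sum>a\<in>A \<inter> {..<n}. card {t \<in> P. t s = a})"
    using fin by (intro card_UN_disjoint) auto
  finally show ?thesis
    by (simp only: sum)
qed

lemma block_update: "t \<in> block n \<Longrightarrow> s \<in> Pow {..<n} \<Longrightarrow> a < n \<Longrightarrow> t(s := a) \<in> block n"
  unfolding block_def by (rule PiE_I) (auto simp: PiE_def extensional_def)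

lemma block_density_slab:
  assumes "n > 0"
  shows "block_density (slab x A) n = real (card (A n \<inter> {..<n})) / real n"
proof -
  let ?s = "x \<inter> {..<n}"
  let ?c = "card {t \<in> block n. t ?s = 0}"
  have eq: "{t \<in> block n. (n, t) \<in> slab x A} = {t \<in> block n. t ?s \<in> A n}"
    by (auto simp: slab_def cells_def)
  have "card {t \<in> block n. t ?s \<in> B} = card (B \<inter> {..<n}) * ?c" for B
    by (rule card_slab_fibre) (auto intro: block_update)
  from this[of "A n"] this[of UNIV]
  have "card {t \<in> block n. t ?s \<in> A n} = card (A n \<inter> {..<n}) * ?c" "card (block n) = n * ?c"
    by auto
  moreover have "card (block n) \<noteq> 0"
    using block_nonempty[OF assms] by simp
  ultimately show ?thesis
    unfolding block_density_def eq by simp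
qed

text \<open>As soon as \<open>n\<close> exceeds points at which \<open>x\<close> differs from the members of \<open>E\<close>, the coordinate
  of \<open>x\<close> is not among those on which \<open>M\<close> depends, so the part of \<open>M\<close> in the block is closed under
  changing it.\<close>

lemma block_density_independent:
  assumes E: "finite E" "determined_by E M" "x \<notin> E" and M: "M \<subseteq> cells"
  shows "eventually (\<lambda>n. block_density (M \<inter> slab x A) n = block_density M n * block_density (slab x A) n) sequentially"
proof -
  have "\<exists>k. (k \<in> e) \<noteq> (k \<in> x)" if "e \<in> E" for e
  proof -
    have "e \<noteq> x"
      using E(3) that by blast
    then show ?thesis
      by (auto simp: set_eq_iff)
  qed
  then obtain k where k: "\<And>e. e \<in> E \<Longrightarrow> (k e \<in> e) \<noteq> (k e \<in> x)"
    by metis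
  have "block_density (M \<inter> slab x A) n = block_density M n * block_density (slab x A) n"
    if n: "n > Max (insert 0 (k ` E))" for n
  proof -
    have "n > 0" and "k e < n" if "e \<in> E" for e
      using n E(1) that by (auto simp: Max_less_iff)
    then have ne: "e \<inter> {..<n} \<noteq> x \<inter> {..<n}" if "e \<in> E" for e
      using k[OF that] that by blast
    have "n > 0"
      using n E(1) by (auto simp: Max_less_iff)
    let ?s = "x \<inter> {..<n}"
    let ?P = "{t \<in> block n. (n, t) \<in> M}"
    have "card {t \<in> ?P. t ?s \<in> B} = card (B \<inter> {..<n}) * card {t \<in> ?P. t ?s = 0}" for B
    proof (rule card_slab_fibre)
      fix t a
      assume t: "t \<in> ?P" "a < n"
      then have "t(?s := a) \<in> block n"
        by (auto intro: block_update)
      moreover have "(t(?s := a)) (e \<inter> {..<n}) = t (e \<inter> {..<n})" if "e \<in> E" for e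
        using ne[OF that] by simp
      ultimately show "t(?s := a) \<in> ?P"
        using E(2) t unfolding determined_by_def by blast
    qed auto
    from this[of "A n"] this[of UNIV]
    have "card {t \<in> ?P. t ?s \<in> A n} = card (A n \<inter> {..<n}) * card {t \<in> ?P. t ?s = 0}"
      "card ?P = n * card {t \<in> ?P. t ?s = 0}"
      by auto
    moreover have "{t \<in> block n. (n, t) \<in> M \<inter> slab x A} = {t \<in> ?P. t ?s \<in> A n}"
      using M by (auto simp: slab_def)
    ultimately show ?thesis
      using block_density_slab[OF \<open>n > 0\<close>, of x A] \<open>n > 0\<close> by (simp add: block_density_def)
  qed
  then show ?thesis
    unfolding eventually_sequentially by (intro exI[of _ "Suc (Max (insert 0 (k ` E)))"]) simp
qed

locale block_measure =
  fixes F :: "nat filter" and m :: "(nat \<times> (nat set \<Rightarrow> nat)) set \<Rightarrow> real"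
  assumes F: "F \<noteq> bot" "F \<le> sequentially"
    and lim: "(block_density M \<longlongrightarrow> m M) F"
begin

lemma evF: "eventually P sequentially \<Longrightarrow> eventually P F"
  using F(2) by (simp add: le_filter_def)

text \<open>Only the blocks of large index matter, because the ultrafilter is nonprincipal.\<close>

lemma m_mono:
  assumes "\<And>n t. n \<ge> N \<Longrightarrow> t \<in> block n \<Longrightarrow> (n, t) \<in> M \<Longrightarrow> (n, t) \<in> M'"
  shows "m M \<le> m M'"
proof (rule tendsto_le[OF F(1) lim[of M'] lim[of M]])
  show "eventually (\<lambda>n. block_density M n \<le> block_density M' n) F"
  proof (rule evF, unfold eventually_sequentially, intro exI[of _ N] allI impI)
    fix n
    assume "N \<le> n"
    then have "card {t \<in> block n. (n, t) \<in> M} \<le> card {t \<in> block n. (n, t) \<in> M'}"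
      using assms by (intro card_mono) auto
    then show "block_density M n \<le> block_density M' n"
      by (simp add: block_density_def divide_right_mono)
  qed
qed

lemma m_modular: "m (M \<union> M') + m (M \<inter> M') = m M + m M'"
proof -
  have "block_density (M \<union> M') n + block_density (M \<inter> M') n = block_density M n + block_density M' n" for n
  proof -
    let ?b = "\<lambda>M. {t \<in> block n. (n, t) \<in> M}"
    have "card (?b M) + card (?b M') = card (?b M \<union> ?b M') + card (?b M \<inter> ?b M')"
      by (intro card_Un_Int) auto
    moreover have "?b M \<union> ?b M' = ?b (M \<union> M')" "?b M \<inter> ?b M' = ?b (M \<inter> M')"
      by auto
    ultimately have "card (?b M) + card (?b M') = card (?b (M \<union> M')) + card (?b (M \<inter> M'))"
      by (simp only:)
    then have "real (card (?b (M \<union> M'))) + real (card (?b (M \<inter> M'))) = real (card (?b M)) + real (card (?b M'))"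
      by linarith
    then show ?thesis
      unfolding block_density_def add_divide_distrib[symmetric] by (rule arg_cong)
  qed
  then have "((\<lambda>n. block_density M n + block_density M' n) \<longlongrightarrow> m (M \<union> M') + m (M \<inter> M')) F"
    using tendsto_add[OF lim[of "M \<union> M'"] lim[of "M \<inter> M'"]] by simp
  then show ?thesis
    using tendsto_unique[OF F(1)] tendsto_add[OF lim[of M] lim[of M']] by blast
qed

lemma m_empty [simp]: "m {} = 0"
proof -
  have "block_density {} = (\<lambda>n. 0)"
    by (simp add: block_density_def fun_eq_iff)
  then show ?thesis
    using tendsto_unique[OF F(1) lim[of "{}"]] by simp
qed

lemma m_cells [simp]: "m cells = 1"
proof -
  have "eventually (\<lambda>n. block_density cells n = 1) F"
  proof (rule evF, unfold eventually_sequentially, intro exI[of _ 1] allI impI)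
    fix n :: nat
    assume "1 \<le> n"
    then have "card (block n) \<noteq> 0"
      using block_nonempty[of n] by simp
    then show "block_density cells n = 1"
      by (simp add: block_density_def cells_def)
  qed
  then have "(block_density cells \<longlongrightarrow> 1) F"
    by (rule tendsto_eventually)
  then show ?thesis
    using tendsto_unique[OF F(1) lim] by blast
qed

lemma m_nonneg: "m M \<ge> 0"
  using m_mono[of 0 "{}" M] by simp

lemma m_Diff: "M \<subseteq> cells \<Longrightarrow> m (cells - M) = 1 - m M"
  using m_modular[of M "cells - M"] by (simp add: Un_absorb1)

lemma m_independent:
  assumes "M \<in> cylinders S" "x \<notin> S"
  shows "m (M \<inter> slab x A) = m M * m (slab x A)"
proof -
  obtain E where E: "finite E" "E \<subseteq> S" "determined_by E M" "M \<subseteq> cells"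
    using assms(1) unfolding cylinders_def by blast
  then have "x \<notin> E"
    using assms(2) by blast
  have "eventually (\<lambda>n. block_density M n * block_density (slab x A) n = block_density (M \<inter> slab x A) n) sequentially"
    by (rule eventually_mono[OF block_density_independent[OF E(1,3) \<open>x \<notin> E\<close> E(4), of A]]) simp
  then have "eventually (\<lambda>n. block_density M n * block_density (slab x A) n = block_density (M \<inter> slab x A) n) F"
    by (rule evF)
  then have "(block_density (M \<inter> slab x A) \<longlongrightarrow> m M * m (slab x A)) F"
    using Lim_transform_eventually[OF tendsto_mult[OF lim[of M] lim[of "slab x A"]]] by blast
  then show ?thesis
    using tendsto_unique[OF F(1) lim] by blast
qed

lemma m_slab_ge:
  assumes "\<And>n. n > 0 \<Longrightarrow> real (card (A n \<inter> {..<n})) \<ge> e * real n"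
  shows "m (slab x A) \<ge> e"
proof (rule tendsto_le[OF F(1) lim[of "slab x A"] tendsto_const])
  show "eventually (\<lambda>n. e \<le> block_density (slab x A) n) F"
  proof (rule evF, unfold eventually_sequentially, intro exI[of _ 1] allI impI)
    fix n :: nat
    assume "1 \<le> n"
    then show "e \<le> block_density (slab x A) n"
      using assms[of n] by (simp add: block_density_slab pos_le_divide_eq)
  qed
qed

lemma m_slab_INT:
  assumes "finite K" "\<And>k. k \<in> K \<Longrightarrow> m (slab x (A k)) \<ge> 1 - e"
  shows "m (slab x (\<lambda>n. \<Inter>k\<in>K. A k n)) \<ge> 1 - real (card K) * e"
  using assms
proof (induction K rule: finite_induct)
  case empty
  have "slab x (\<lambda>n. UNIV) = cells"
    by (auto simp: slab_def)
  then show ?case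
    by simp
next
  case (insert k K)
  let ?A = "\<lambda>n. \<Inter>k\<in>K. A k n"
  have "slab x (\<lambda>n. \<Inter>k\<in>insert k K. A k n) = slab x (A k) \<inter> slab x ?A"
    by (auto simp: slab_Int)
  moreover have "m (slab x (A k) \<union> slab x ?A) \<le> 1"
    using m_mono[of 0 "slab x (A k) \<union> slab x ?A" cells] by (auto simp: slab_def)
  ultimately have "m (slab x (\<lambda>n. \<Inter>k\<in>insert k K. A k n)) \<ge> m (slab x (A k)) + m (slab x ?A) - 1"
    using m_modular[of "slab x (A k)" "slab x ?A"] by simp
  moreover have "m (slab x ?A) \<ge> 1 - real (card K) * e" "m (slab x (A k)) \<ge> 1 - e"
    using insert by auto
  moreover have "real (card (insert k K)) * e = e + real (card K) * e"
    using insert.hyps by (simp add: algebra_simps)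
  ultimately show ?case
    by linarith
qed

end

lemma block_measure_exists: "\<exists>F m. block_measure F m"
proof -
  obtain F :: "nat filter" where F: "F \<noteq> bot" "F \<le> sequentially"
    "\<And>P. eventually P F \<or> eventually (\<lambda>n. \<not> P n) F"
    using nonprincipal_ultrafilter_nat by blast
  have "\<exists>l. (block_density M \<longlongrightarrow> l) F" for M
    using ultrafilter_convergent[OF F(1,3) block_density_bounds] .
  then obtain m where "\<And>M. (block_density M \<longlongrightarrow> m M) F"
    by metis
  then show ?thesis
    using F by (auto simp: block_measure_def)
qed

section \<open>An uncountable well-order with countable initial segments\<close>

text \<open>The members of \<open>J\<close> serve both as ordinals below \<open>\<omega>\<^sub>1\<close> and as columns, whence their type.\<close>

locale omega1 =
  fixes J :: "nat set set" and lt :: "nat set \<Rightarrow> nat set \<Rightarrow> bool" (infix "\<sqsubset>" 50)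
  assumes wf: "wf {(x, y). x \<sqsubset> y}"
    and trans: "x \<sqsubset> y \<Longrightarrow> y \<sqsubset> z \<Longrightarrow> x \<sqsubset> z"
    and total: "x \<in> J \<Longrightarrow> y \<in> J \<Longrightarrow> x \<sqsubset> y \<or> x = y \<or> y \<sqsubset> x"
    and countable_below: "x \<in> J \<Longrightarrow> countable {y \<in> J. y \<sqsubset> x}"
    and uncountable: "uncountable J"
begin

lemma irrefl: "\<not> x \<sqsubset> x"
  using wf by (auto dest: wf_not_refl)

lemma least:
  assumes "S \<subseteq> J" "S \<noteq> {}"
  obtains x where "x \<in> S" "\<And>y. y \<in> S \<Longrightarrow> y = x \<or> x \<sqsubset> y"
proof -
  obtain x where x: "x \<in> S" "\<And>y. y \<sqsubset> x \<Longrightarrow> y \<notin> S"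
  proof -
    obtain x0 where "x0 \<in> S"
      using assms(2) by blast
    then show thesis
      by (rule wfE_min[OF wf]) (use that in auto)
  qed
  then show thesis
    using total assms(1) that by (metis subsetD)
qed

lemma greatest_finite:
  assumes "finite S" "S \<subseteq> J" "S \<noteq> {}"
  obtains x where "x \<in> S" "\<And>y. y \<in> S \<Longrightarrow> y = x \<or> y \<sqsubset> x"
proof -
  have "\<exists>x\<in>S. \<forall>y\<in>S. y = x \<or> y \<sqsubset> x"
    using assms(1,3,2)
  proof (induction S rule: finite_ne_induct)
    case (insert a S)
    then have "\<exists>x\<in>S. \<forall>y\<in>S. y = x \<or> y \<sqsubset> x"
      by simp
    then obtain x where x: "x \<in> S" "\<forall>y\<in>S. y = x \<or> y \<sqsubset> x"
      by (rule bexE)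
    have "a \<in> J" "x \<in> J"
      using insert.prems x(1) by auto
    then have "a \<sqsubset> x \<or> a = x \<or> x \<sqsubset> a"
      by (rule total)
    then consider "x \<sqsubset> a" | "a = x \<or> a \<sqsubset> x"
      by blast
    then show ?case
    proof cases
      case 1
      then have "\<forall>y\<in>insert a S. y = a \<or> y \<sqsubset> a"
        using x(2) trans[of _ x a] by auto
      then show ?thesis
        by blast
    next
      case 2
      then have "\<forall>y\<in>insert a S. y = x \<or> y \<sqsubset> x"
        using x(2) by auto
      then show ?thesis
        using x(1) by blast
    qed
  qed auto
  then show thesis
    using that by blast
qed

lemma strict_upper_bound:
  assumes "countable S" "S \<subseteq> J"
  obtains b where "b \<in> J" "\<And>s. s \<in> S \<Longrightarrow> s \<sqsubset> b"
proof -
  have "countable (\<Union>s\<in>S. insert s {y \<in> J. y \<sqsubset> s})"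
    using assms countable_below by (intro countable_UN) auto
  then have "\<not> J \<subseteq> (\<Union>s\<in>S. insert s {y \<in> J. y \<sqsubset> s})"
    using uncountable countable_subset by blast
  then obtain b where "b \<in> J" "\<And>s. s \<in> S \<Longrightarrow> b \<noteq> s \<and> \<not> b \<sqsubset> s"
    by blast
  then show thesis
    using that[of b] total assms(2) by blast
qed

end

text \<open>In a well-ordering of the real line, represented as the power set of the natural numbers,
  take the least uncountable initial segment, or the whole line if every proper initial segment is
  countable.\<close>

lemma omega1_exists: "\<exists>J lt. omega1 J lt"
proof -
  obtain r :: "nat set rel" where "Well_order r \<and> Field r = UNIV"
    using well_ordering ..
  then have r: "well_order_on UNIV r"
    by auto
  define lt where "lt x y \<longleftrightarrow> (x, y) \<in> r - Id" for x y
  have wf: "wf {(x, y). lt x y}"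
  proof -
    have "{(x, y). lt x y} = r - Id"
      by (auto simp: lt_def)
    then show ?thesis
      using r by (simp add: well_order_on_def)
  qed
  have tr: "lt x z" if "lt x y" "lt y z" for x y z
  proof -
    have "trans r" "antisym r"
      using r by (simp_all add: order_on_defs)
    then show ?thesis
      using that unfolding lt_def by (auto dest: transD antisymD)
  qed
  have tot: "lt x y \<or> x = y \<or> lt y x" for x y
    using r unfolding lt_def order_on_defs total_on_def by auto
  show ?thesis
  proof (cases "\<exists>x. uncountable {y. lt y x}")
    case True
    then obtain x0 where "x0 \<in> {x. uncountable {y. lt y x}}"
      by blast
    then obtain x where x: "uncountable {y. lt y x}" "\<And>z. lt z x \<Longrightarrow> countable {y. lt y z}"
      by (rule wfE_min[OF wf]) auto
    have "countable {y \<in> {y. lt y x}. lt y z}" if "z \<in> {y. lt y x}" for z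
      by (rule countable_subset[OF _ x(2)]) (use that in auto)
    then have "omega1 {y. lt y x} lt"
      using wf tr tot x(1) by (intro omega1.intro) assumption+
    then show ?thesis
      by blast
  next
    case False
    have "uncountable (UNIV :: nat set set)"
    proof
      assume "countable (UNIV :: nat set set)"
      then have "range (from_nat_into (UNIV :: nat set set)) = Pow UNIV"
        by simp
      then show False
        using Cantors_theorem by blast
    qed
    then have "omega1 UNIV lt"
      using wf tr tot False by (intro omega1.intro) auto
    then show ?thesis
      by blast
  qed
qed

section \<open>Linked families that avoid countable sets\<close>

locale parovicenko_omega1 = parovicenko X + omega1 J lt
  for X :: "'a topology" and J and lt (infix "\<sqsubset>" 50)
begin

text \<open>Recursively split a nonempty clopen set into two pieces, keep the first and split inside the
  second one. At a countable stage a nonempty clopen set lies below all second pieces so far.\<close>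

lemma omega1_disjoint_clopens:
  assumes b: "clopenin X b" "b \<noteq> {}"
  shows "\<exists>v. (\<forall>j\<in>J. clopenin X (v j) \<and> v j \<noteq> {} \<and> v j \<subseteq> b) \<and> disjoint_family_on v J"
proof -
  define P where "P f j y \<longleftrightarrow> (j \<in> J \<longrightarrow>
      clopenin X (fst y) \<and> clopenin X (snd y) \<and> fst y \<noteq> {} \<and> snd y \<noteq> {} \<and> fst y \<inter> snd y = {} \<and>
      fst y \<union> snd y \<subseteq> b \<and> (\<forall>z\<in>J. z \<sqsubset> j \<longrightarrow> fst y \<union> snd y \<subseteq> snd (f z)))"
    for f :: "nat set \<Rightarrow> 'a set \<times> 'a set" and j and y :: "'a set \<times> 'a set"
  have "\<exists>f. \<forall>j. P f j (f j)"
  proof (rule dependent_wf_choice[OF wf])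
    fix f g :: "nat set \<Rightarrow> 'a set \<times> 'a set" and x r
    assume "\<And>z. (z, x) \<in> {(x, y). x \<sqsubset> y} \<Longrightarrow> f z = g z"
    then show "P f x r = P g x r"
      by (auto simp: P_def)
  next
    fix j and f :: "nat set \<Rightarrow> 'a set \<times> 'a set"
    assume "\<And>y. (y, j) \<in> {(x, y). x \<sqsubset> y} \<Longrightarrow> P f y (f y)"
    then have IH: "P f z (f z)" if "z \<sqsubset> j" for z
      using that by blast
    show "\<exists>r. P f j r"
    proof (cases "j \<in> J")
      case True
      define Z where "Z = {z \<in> J. z \<sqsubset> j}"
      have Z: "clopenin X (snd (f z))" "snd (f z) \<noteq> {}" "snd (f z) \<subseteq> b"
        "\<And>w. w \<in> Z \<Longrightarrow> w \<sqsubset> z \<Longrightarrow> snd (f z) \<subseteq> snd (f w)" if "z \<in> Z" for z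
        using IH[of z] that unfolding P_def Z_def by auto
      obtain c where c: "clopenin X c" "c \<noteq> {}" "\<And>d. d \<in> insert b ((\<lambda>z. snd (f z)) ` Z) \<Longrightarrow> c \<subseteq> d"
      proof (rule clopen_below_countable_centred[of "insert b ((\<lambda>z. snd (f z)) ` Z)"])
        show "countable (insert b ((\<lambda>z. snd (f z)) ` Z))"
          using countable_below[OF True] by (simp add: Z_def)
        show "clopenin X d" if "d \<in> insert b ((\<lambda>z. snd (f z)) ` Z)" for d
          using that b Z by auto
        fix \<F>
        assume F: "finite \<F>" "\<F> \<subseteq> insert b ((\<lambda>z. snd (f z)) ` Z)"
        then have "\<F> - {b} \<subseteq> (\<lambda>z. snd (f z)) ` Z"
          by blast
        then obtain Z' where Z': "Z' \<subseteq> Z" "finite Z'" "\<F> - {b} = (\<lambda>z. snd (f z)) ` Z'"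
          using F(1) finite_subset_image[of "\<F> - {b}" "\<lambda>z. snd (f z)" Z] by auto
        show "topspace X \<inter> \<Inter>\<F> \<noteq> {}"
        proof (cases "Z' = {}")
          case True
          then have "\<F> \<subseteq> {b}"
            using Z' by auto
          then show ?thesis
            using b clopenin_subset[OF b(1)] by blast
        next
          case False
          have "Z' \<subseteq> J"
            using Z' by (auto simp: Z_def)
          then obtain z where z: "z \<in> Z'" "\<And>w. w \<in> Z' \<Longrightarrow> w = z \<or> w \<sqsubset> z"
            using greatest_finite[OF Z'(2) _ False] by blast
          then have zZ: "z \<in> Z"
            using Z' by blast
          have "snd (f z) \<subseteq> d" if d: "d \<in> \<F>" for d
          proof (cases "d = b")
            case False
            then have "d \<in> (\<lambda>z. snd (f z)) ` Z'"
              using d Z'(3) by blast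
            then obtain w where "w \<in> Z'" "d = snd (f w)"
              by blast
            then show ?thesis
              using z(2)[of w] Z(4)[OF zZ, of w] Z'(1) by blast
          qed (use Z(3)[OF zZ] in blast)
          then have "snd (f z) \<subseteq> topspace X \<inter> \<Inter>\<F>"
            using clopenin_subset[OF Z(1)[OF zZ]] by blast
          then show ?thesis
            using Z(2)[OF zZ] by blast
        qed
      qed blast
      obtain a a' where a: "clopenin X a" "clopenin X a'" "a \<noteq> {}" "a' \<noteq> {}" "a \<inter> a' = {}" "a \<union> a' \<subseteq> c"
        using clopen_split[OF c(1,2)] by blast
      have "c \<subseteq> b" "\<And>z. z \<in> Z \<Longrightarrow> c \<subseteq> snd (f z)"
        using c(3) by simp_all
      then have "a \<union> a' \<subseteq> b" "\<And>z. z \<in> J \<Longrightarrow> z \<sqsubset> j \<Longrightarrow> a \<union> a' \<subseteq> snd (f z)"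
        using a(6) unfolding Z_def by blast+
      then have "P f j (a, a')"
        using a unfolding P_def fst_conv snd_conv by blast
      then show ?thesis
        by blast
    qed (simp add: P_def)
  qed
  then obtain f where f: "\<And>j. P f j (f j)"
    by blast
  have "fst (f i) \<inter> fst (f j) = {}" if "i \<in> J" "j \<in> J" "i \<sqsubset> j" for i j
    using f[of i] f[of j] that unfolding P_def by blast
  then have "disjoint_family_on (\<lambda>j. fst (f j)) J"
    unfolding disjoint_family_on_def using total by blast
  moreover have "clopenin X (fst (f j)) \<and> fst (f j) \<noteq> {} \<and> fst (f j) \<subseteq> b" if "j \<in> J" for j
    using f[of j] that unfolding P_def by blast
  ultimately show ?thesis
    by (intro exI[of _ "\<lambda>j. fst (f j)"]) blast
qed

end

text \<open>Iterating \<open>v\<close> yields a tree of clopen sets of height \<open>\<omega>\<close> in which every node has uncountably many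
  disjoint successors.\<close>

locale splitting_tree = parovicenko_omega1 X J lt
  for X :: "'a topology" and J and lt (infix "\<sqsubset>" 50) +
  fixes v :: "'a set \<Rightarrow> nat set \<Rightarrow> 'a set"
  assumes v: "clopenin X b \<Longrightarrow> b \<noteq> {} \<Longrightarrow> j \<in> J \<Longrightarrow> clopenin X (v b j) \<and> v b j \<noteq> {} \<and> v b j \<subseteq> b"
    and v_disjoint: "clopenin X b \<Longrightarrow> b \<noteq> {} \<Longrightarrow> i \<in> J \<Longrightarrow> j \<in> J \<Longrightarrow> i \<noteq> j \<Longrightarrow> v b i \<inter> v b j = {}"
begin

text \<open>The set contains a whole piece \<open>v c j\<close>, and in all earlier pieces it is big to the next lower degree.
  Of several sets that are big in the same \<open>c\<close>, one with the least \<open>j\<close> contains the piece \<open>v c j\<close>, and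
  the others are big in that piece or contain it. To be big, a set has to
  meet only countably many of the uncountably many pieces of \<open>c\<close>, which is why it can avoid countable sets.\<close>

primrec big :: "nat \<Rightarrow> 'a set \<Rightarrow> 'a set \<Rightarrow> bool" where
  "big 0 c G \<longleftrightarrow> True"
| "big (Suc n) c G \<longleftrightarrow> (\<exists>j\<in>J. v c j \<subseteq> G \<and> (\<forall>i\<in>J. i \<sqsubset> j \<longrightarrow> big n (v c i) G))"

lemma big_mono: "big n c G \<Longrightarrow> G \<subseteq> G' \<Longrightarrow> big n c G'"
proof (induction n arbitrary: c)
  case (Suc n)
  then obtain j where "j \<in> J" "v c j \<subseteq> G" "\<forall>i\<in>J. i \<sqsubset> j \<longrightarrow> big n (v c i) G"
    by auto
  then show ?case
    using Suc by (auto intro!: bexI[of _ j])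
qed simp

lemma big_superset:
  assumes "clopenin X c" "c \<noteq> {}" "c \<subseteq> G"
  shows "big n c G"
proof (cases n)
  case (Suc k)
  have "J \<noteq> {}"
    using uncountable by auto
  then obtain j where j: "j \<in> J" "\<And>i. i \<in> J \<Longrightarrow> i = j \<or> j \<sqsubset> i"
    using least[of J] by blast
  have "\<not> i \<sqsubset> j" if "i \<in> J" for i
    using j(2)[OF that] irrefl trans by blast
  moreover have "v c j \<subseteq> G"
    using j(1) v[OF assms(1,2), of j] assms(3) by blast
  ultimately show ?thesis
    using j(1) Suc by auto
qed simp

lemma big_restrict:
  assumes "clopenin X c" "c \<noteq> {}" "big n c G"
  shows "big n c (G \<inter> c)"
  using assms
proof (induction n arbitrary: c)
  case (Suc n)
  then obtain j where j: "j \<in> J" "v c j \<subseteq> G" "\<forall>i\<in>J. i \<sqsubset> j \<longrightarrow> big n (v c i) G"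
    by auto
  have "big n (v c i) (G \<inter> c)" if "i \<in> J" "i \<sqsubset> j" for i
  proof -
    have "big n (v c i) (G \<inter> v c i)"
      using Suc.IH v[OF Suc.prems(1,2) that(1)] j(3) that by blast
    moreover have "G \<inter> v c i \<subseteq> G \<inter> c"
      using v[OF Suc.prems(1,2) that(1)] by blast
    ultimately show ?thesis
      by (rule big_mono)
  qed
  then show ?case
    using j v[OF Suc.prems(1,2) j(1)] by auto
qed simp

text \<open>Choose the set \<open>G\<close> whose index \<open>f G\<close> is least. The piece \<open>v c (f G)\<close> lies in \<open>G\<close>, and all other
  sets are big there to the degree \<open>n\<close>, so the induction hypothesis provides a common point
  inside that piece.\<close>

lemma big_linked:
  assumes "clopenin X c" "c \<noteq> {}" "finite \<D>" "card \<D> \<le> n" "\<And>G. G \<in> \<D> \<Longrightarrow> big n c G"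
  shows "c \<inter> \<Inter>\<D> \<noteq> {}"
  using assms
proof (induction n arbitrary: c \<D>)
  case (Suc n)
  show ?case
  proof (cases "\<D> = {}")
    case False
    have "\<forall>G\<in>\<D>. \<exists>j\<in>J. v c j \<subseteq> G \<and> (\<forall>i\<in>J. i \<sqsubset> j \<longrightarrow> big n (v c i) G)"
      using Suc.prems(5) by simp
    then obtain f where f: "\<And>G. G \<in> \<D> \<Longrightarrow> f G \<in> J \<and> v c (f G) \<subseteq> G \<and> (\<forall>i\<in>J. i \<sqsubset> f G \<longrightarrow> big n (v c i) G)"
      by metis
    have "f ` \<D> \<subseteq> J" "f ` \<D> \<noteq> {}"
      using f False by auto
    then obtain x where x: "x \<in> f ` \<D>" "\<And>y. y \<in> f ` \<D> \<Longrightarrow> y = x \<or> x \<sqsubset> y"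
      by (rule least) simp
    then obtain G where G0: "G \<in> \<D>" "x = f G"
      by blast
    have G: "G \<in> \<D>" "\<And>H. H \<in> \<D> \<Longrightarrow> f H = f G \<or> f G \<sqsubset> f H"
      using G0 x(2) by blast+
    define c' where "c' = v c (f G)"
    have c': "clopenin X c'" "c' \<noteq> {}" "c' \<subseteq> c" "c' \<subseteq> G"
      using v[OF Suc.prems(1,2)] f[OF G(1)] by (auto simp: c'_def)
    have "big n c' H" if "H \<in> \<D>" for H
    proof (cases "f H = f G")
      case True
      then show ?thesis
        using f[OF that] c' by (intro big_superset) (auto simp: c'_def)
    next
      case False
      then show ?thesis
        using f[OF that] G(2)[OF that] f[OF G(1)] by (auto simp: c'_def)
    qed
    moreover have "card (\<D> - {G}) \<le> n"
      using Suc.prems(3,4) G(1) by simp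
    ultimately have "c' \<inter> \<Inter>(\<D> - {G}) \<noteq> {}"
      using c' Suc.prems(3) by (intro Suc.IH) auto
    then show ?thesis
      using c' by blast
  qed (use Suc.prems in simp)
qed simp

text \<open>For fixed \<open>j\<close> let \<open>\<W> j\<close> consist of the \<open>j\<close>-th pieces of all the sets in \<open>\<C>\<close>. The unions of
  the \<open>\<W> j\<close> have disjoint closures, so each point of \<open>D\<close> is in at most one of these closures, and some
  closure, that of \<open>\<W> j\<close>, misses \<open>D\<close>. A clopen set covers this \<open>\<W> j\<close> and avoids \<open>D\<close>. The countably many
  pieces with an index before \<open>j\<close> are dealt with by the induction hypothesis, all at once.\<close>

lemma big_avoiding_countable:
  assumes \<C>: "countable \<C>" "disjoint \<C>" "\<And>c. c \<in> \<C> \<Longrightarrow> clopenin X c \<and> c \<noteq> {}"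
    and D: "countable D" "D \<subseteq> topspace X"
  obtains H where "clopenin X H" "H \<inter> D = {}" "\<And>c. c \<in> \<C> \<Longrightarrow> big n c H"
proof -
  have "\<exists>H. clopenin X H \<and> H \<inter> D = {} \<and> (\<forall>c\<in>\<C>. big n c H)"
    using \<C>
  proof (induction n arbitrary: \<C>)
    case 0
    then show ?case
      by (intro exI[of _ "{}"]) auto
  next
    case (Suc n)
    define \<W> where "\<W> j = (\<lambda>c. v c j) ` \<C>" for j
    have W: "countable (\<W> j)" "\<And>w. w \<in> \<W> j \<Longrightarrow> clopenin X w" if "j \<in> J" for j
      using Suc.prems that v by (auto simp: \<W>_def)
    have disj: "v c i \<inter> v c' j = {}" if "i \<in> J" "j \<in> J" "c \<in> \<C>" "c' \<in> \<C>" "(c, i) \<noteq> (c', j)" for i j c c'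
    proof (cases "c = c'")
      case True
      then show ?thesis
        using that v_disjoint Suc.prems(3) by blast
    next
      case False
      then have "c \<inter> c' = {}"
        using Suc.prems(2) that by (auto simp: disjoint_def)
      then show ?thesis
        using that v Suc.prems(3) by blast
    qed
    have one: "i = j" if "i \<in> J" "j \<in> J" "d \<in> X closure_of \<Union>(\<W> i)" "d \<in> X closure_of \<Union>(\<W> j)" for i j d
    proof (rule ccontr)
      assume "i \<noteq> j"
      have "w \<inter> u = {}" if wu: "w \<in> \<W> i" "u \<in> \<W> j" for w u
      proof -
        obtain c c' where "c \<in> \<C>" "w = v c i" "c' \<in> \<C>" "u = v c' j"
          using wu unfolding \<W>_def by blast
        then show ?thesis
          using disj[OF \<open>i \<in> J\<close> \<open>j \<in> J\<close>] \<open>i \<noteq> j\<close> by blast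
      qed
      then have "X closure_of \<Union>(\<W> i) \<inter> X closure_of \<Union>(\<W> j) = {}"
        using W \<open>i \<in> J\<close> \<open>j \<in> J\<close> by (intro disjoint_countable_Unions_closures_disjoint) blast+
      then show False
        using that by blast
    qed
    have cnt: "countable {j \<in> J. d \<in> X closure_of \<Union>(\<W> j)}" for d
    proof -
      have "i = j" if "i \<in> {j \<in> J. d \<in> X closure_of \<Union>(\<W> j)}" "j \<in> {j \<in> J. d \<in> X closure_of \<Union>(\<W> j)}" for i j
        using that by (intro one[of i j d]) auto
      then have "\<exists>j. {j \<in> J. d \<in> X closure_of \<Union>(\<W> j)} \<subseteq> {j}"
        by (metis (lifting) singletonI subsetI)
      then show ?thesis
        using countable_subset[OF _ countable_finite[OF finite.insertI[OF finite.emptyI]]] by metis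
    qed
    define B where "B = (\<Union>d\<in>D. {j \<in> J. d \<in> X closure_of \<Union>(\<W> j)})"
    have "countable B"
      unfolding B_def using D(1) by (rule countable_UN) (rule cnt)
    then have "\<not> J \<subseteq> B"
      using uncountable countable_subset[of J B] by blast
    then obtain j where "j \<in> J" "j \<notin> B"
      by blast
    then have j: "j \<in> J" "D \<inter> X closure_of \<Union>(\<W> j) = {}"
      by (auto simp: B_def)
    obtain H' where H': "clopenin X H'" "\<And>w. w \<in> \<W> j \<Longrightarrow> w \<subseteq> H'" "H' \<inter> D = {}"
      using clopen_superset_avoiding[OF W(1)[OF j(1)] W(2)[OF j(1)] D j(2), of "{}"] by auto
    define \<C>' where "\<C>' = (\<lambda>(c, i). v c i) ` (\<C> \<times> {i \<in> J. i \<sqsubset> j})"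
    have "\<exists>H. clopenin X H \<and> H \<inter> D = {} \<and> (\<forall>c\<in>\<C>'. big n c H)"
    proof (rule Suc.IH)
      show "countable \<C>'"
        using Suc.prems(1) countable_below[OF j(1)] by (auto simp: \<C>'_def)
      show "disjoint \<C>'"
        unfolding disjoint_def \<C>'_def using disj by fastforce
      show "clopenin X c \<and> c \<noteq> {}" if "c \<in> \<C>'" for c
        using that v Suc.prems(3) by (auto simp: \<C>'_def)
    qed
    then obtain H where H: "clopenin X H" "H \<inter> D = {}" "\<And>c. c \<in> \<C>' \<Longrightarrow> big n c H"
      by blast
    have "big (Suc n) c (H \<union> H')" if "c \<in> \<C>" for c
    proof -
      have "v c j \<subseteq> H \<union> H'"
        using H'(2) that by (auto simp: \<W>_def)
      moreover have "big n (v c i) (H \<union> H')" if "i \<in> J" "i \<sqsubset> j" for i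
        using H(3)[of "v c i"] that \<open>c \<in> \<C>\<close> by (auto simp: \<C>'_def intro: big_mono)
      ultimately show ?thesis
        using j(1) by auto
    qed
    then show ?case
      using H H' by (intro exI[of _ "H \<union> H'"]) (auto intro: clopenin_Un)
  qed
  then show thesis
    using that by blast
qed

end

lemma (in parovicenko_omega1) splitting_tree_exists: "\<exists>v. splitting_tree X J lt v"
proof -
  have "\<forall>b. \<exists>v. clopenin X b \<and> b \<noteq> {} \<longrightarrow>
      (\<forall>j\<in>J. clopenin X (v j) \<and> v j \<noteq> {} \<and> v j \<subseteq> b) \<and> disjoint_family_on v J"
    using omega1_disjoint_clopens by blast
  then obtain v where "\<And>b. clopenin X b \<and> b \<noteq> {} \<longrightarrow>
      (\<forall>j\<in>J. clopenin X (v b j) \<and> v b j \<noteq> {} \<and> v b j \<subseteq> b) \<and> disjoint_family_on (v b) J"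
    by metis
  then have "splitting_tree X J lt v"
    by unfold_locales (auto simp: disjoint_family_on_def)
  then show ?thesis
    by blast
qed

section \<open>A measure on the space\<close>

lemma card_residue_class:
  assumes "(0::nat) < q"
  shows "real (card {a \<in> {..<n}. a mod q = l}) \<le> real n / real q + 1"
proof -
  have "card {a \<in> {..<n}. a mod q = l} \<le> card {..n div q}"
  proof (rule card_inj_on_le)
    show "inj_on (\<lambda>a. a div q) {a \<in> {..<n}. a mod q = l}"
      by (rule inj_onI) (metis (mono_tags, lifting) div_mult_mod_eq mem_Collect_eq)
    show "(\<lambda>a. a div q) ` {a \<in> {..<n}. a mod q = l} \<subseteq> {..n div q}"
      by (auto intro: div_le_mono)
  qed simp
  then have "real (card {a \<in> {..<n}. a mod q = l}) \<le> real (n div q) + 1"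
    by simp
  also have "real (n div q) \<le> real n / real q"
    using of_nat_div_le_of_nat by blast
  finally show ?thesis
    by simp
qed

text \<open>The \<open>k\<close>-th forbidden class has density \<open>2 ^ - (k + 1 + q)\<close>, and these densities add up to at most
  \<open>2 ^ - q\<close>. A residue class can have one element more than its density predicts; the restriction to
  \<open>Suc k * 2 ^ q \<le> n\<close> keeps the sum of these errors below \<open>n / 2 ^ q\<close>.\<close>

lemma card_avoiding_residues:
  fixes l :: "nat \<Rightarrow> nat"
  shows "real (card ({a. \<not> (\<exists>k. Suc k * 2 ^ q \<le> n \<and> a mod 2 ^ (Suc k + q) = l k)} \<inter> {..<n}))
    \<ge> (1 - 2 / 2 ^ q) * real n"
proof -
  define K where "K = n div 2 ^ q"
  define B where "B = (\<Union>k<K. {a \<in> {..<n}. a mod 2 ^ (Suc k + q) = l k})"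
  have K: "Suc k * 2 ^ q \<le> n \<longleftrightarrow> k < K" for k
    using less_eq_div_iff_mult_less_eq[of "2 ^ q" "Suc k" n] by (simp add: K_def Suc_le_eq)
  have "real (card B) \<le> (\<Sum>k<K. real (card {a \<in> {..<n}. a mod 2 ^ (Suc k + q) = l k}))"
  proof -
    have "card B \<le> (\<Sum>k<K. card {a \<in> {..<n}. a mod 2 ^ (Suc k + q) = l k})"
      unfolding B_def by (rule card_UN_le) simp
    then have "real (card B) \<le> real (\<Sum>k<K. card {a \<in> {..<n}. a mod 2 ^ (Suc k + q) = l k})"
      by (simp only: of_nat_le_iff)
    then show ?thesis
      by (simp only: of_nat_sum)
  qed
  also have "\<dots> \<le> (\<Sum>k<K. real n / 2 ^ (Suc k + q) + 1)"
  proof (rule sum_mono)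
    show "real (card {a \<in> {..<n}. a mod 2 ^ (Suc k + q) = l k}) \<le> real n / 2 ^ (Suc k + q) + 1" for k
      using card_residue_class[of "2 ^ (Suc k + q)" n "l k"] by (simp only: of_nat_power of_nat_numeral zero_less_power zero_less_numeral)
  qed
  also have "\<dots> = (real n / 2 ^ q) * (\<Sum>k<K. (1 / 2) ^ Suc k) + real K"
  proof -
    have "real n / 2 ^ (Suc k + q) + 1 = (real n / 2 ^ q) * (1 / 2) ^ Suc k + 1" for k
      by (simp add: power_add power_one_over field_simps)
    then show ?thesis
      by (simp only: sum.distrib sum_distrib_left) simp
  qed
  also have "\<dots> \<le> (real n / 2 ^ q) * 1 + real n / 2 ^ q"
  proof (intro add_mono mult_left_mono)
    have "(\<Sum>k<K. (1 / 2 :: real) ^ Suc k) = 1 - (1 / 2) ^ K"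
      by (induction K) (auto simp: field_simps)
    then show "(\<Sum>k<K. (1 / 2 :: real) ^ Suc k) \<le> 1"
      by simp
    show "real K \<le> real n / 2 ^ q"
      unfolding K_def using of_nat_div_le_of_nat[of n "2 ^ q", where ?'a = real] by simp
  qed simp
  finally have B: "real (card B) \<le> 2 / 2 ^ q * real n"
    by simp
  have "{a. \<not> (\<exists>k. Suc k * 2 ^ q \<le> n \<and> a mod 2 ^ (Suc k + q) = l k)} \<inter> {..<n} = {..<n} - B"
    by (auto simp: B_def K simp del: mult_Suc power_Suc)
  moreover have "B \<subseteq> {..<n}"
    by (auto simp: B_def)
  ultimately show ?thesis
    using B card_mono[of "{..<n}" B] by (simp add: card_Diff_subset finite_subset of_nat_diff algebra_simps)
qed

locale cell_family = splitting_tree X J lt v + block_measure F m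
  for X :: "'a topology" and J and lt (infix "\<sqsubset>" 50) and v and F and m +
  fixes W :: "'a set" and c :: "nat \<times> (nat set \<Rightarrow> nat) \<Rightarrow> 'a set"
  assumes W: "clopenin X W"
    and c: "i \<in> cells \<Longrightarrow> clopenin X (c i) \<and> c i \<noteq> {} \<and> c i \<subseteq> W"
    and c_disjoint: "i \<in> cells \<Longrightarrow> i' \<in> cells \<Longrightarrow> i \<noteq> i' \<Longrightarrow> c i \<inter> c i' = {}"
begin

definition lift :: "(nat \<times> (nat set \<Rightarrow> nat)) set \<Rightarrow> 'a set" where
  "lift M = (\<Union>i\<in>M. c i)"

text \<open>Big in each cell, to a degree that grows with the index of the block: finitely many large
  sets have a common point in every cell of all but finitely many blocks.\<close>

definition large :: "'a set \<Rightarrow> bool" where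
  "large G \<longleftrightarrow> (\<forall>i\<in>cells. big (fst i) (c i) G)"

text \<open>Modulo large sets, \<open>b\<close> touches no cells outside \<open>M\<close>. In particular \<open>covers {} b\<close> says that \<open>b\<close>
  is negligible.\<close>

definition covers :: "(nat \<times> (nat set \<Rightarrow> nat)) set \<Rightarrow> 'a set \<Rightarrow> bool" where
  "covers M b \<longleftrightarrow> (\<exists>\<D>. finite \<D> \<and> (\<forall>G\<in>\<D>. large G) \<and> (\<forall>i\<in>cells - M. b \<inter> \<Inter>\<D> \<inter> c i = {}))"

definition outer :: "'a set \<Rightarrow> real" where
  "outer b = (INF M\<in>{M \<in> cylinders J. covers M b}. m M)"

lemma lift_mono: "M \<subseteq> N \<Longrightarrow> lift M \<subseteq> lift N"
  by (auto simp: lift_def)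

lemma lift_Un: "lift (M \<union> N) = lift M \<union> lift N"
  by (auto simp: lift_def)

lemma cell_unique: "i \<in> cells \<Longrightarrow> j \<in> cells \<Longrightarrow> y \<in> c i \<Longrightarrow> y \<in> c j \<Longrightarrow> i = j"
  using c_disjoint[of i j] by (cases "i = j") auto

lemma lift_cell: "M \<subseteq> cells \<Longrightarrow> i \<in> cells \<Longrightarrow> i \<notin> M \<Longrightarrow> lift M \<inter> c i = {}"
proof (rule ccontr)
  assume *: "M \<subseteq> cells" "i \<in> cells" "i \<notin> M" "lift M \<inter> c i \<noteq> {}"
  then obtain y j where "y \<in> c i" "j \<in> M" "y \<in> c j"
    unfolding lift_def by blast
  then have "i = j"
    using * by (intro cell_unique) auto
  then show False
    using * \<open>j \<in> M\<close> by simp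
qed

lemma lift_disjoint: "M \<subseteq> cells \<Longrightarrow> N \<subseteq> cells \<Longrightarrow> M \<inter> N = {} \<Longrightarrow> lift M \<inter> lift N = {}"
proof -
  assume *: "M \<subseteq> cells" "N \<subseteq> cells" "M \<inter> N = {}"
  have "lift M \<inter> c i = {}" if "i \<in> N" for i
    using * that by (intro lift_cell) auto
  then show ?thesis
    unfolding lift_def[of N] by blast
qed

lemma lift_Int:
  assumes "M \<subseteq> cells" "N \<subseteq> cells"
  shows "lift (M \<inter> N) = lift M \<inter> lift N"
proof
  show "lift M \<inter> lift N \<subseteq> lift (M \<inter> N)"
  proof
    fix y
    assume "y \<in> lift M \<inter> lift N"
    then obtain i j where "i \<in> M" "y \<in> c i" "j \<in> N" "y \<in> c j"
      by (auto simp: lift_def)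
    moreover from this have "i = j"
      using assms by (intro cell_unique) auto
    ultimately show "y \<in> lift (M \<inter> N)"
      by (auto simp: lift_def)
  qed
qed (auto simp: lift_def)

lemma coversI: "(\<And>i. i \<in> cells \<Longrightarrow> i \<notin> M \<Longrightarrow> b \<inter> c i = {}) \<Longrightarrow> covers M b"
  unfolding covers_def by (intro exI[of _ "{}"]) auto

lemma coversI_large: "large G \<Longrightarrow> (\<And>i. i \<in> cells \<Longrightarrow> i \<notin> M \<Longrightarrow> b \<inter> G \<inter> c i = {}) \<Longrightarrow> covers M b"
  unfolding covers_def by (intro exI[of _ "{G}"]) auto

lemma coversE:
  assumes "covers M b"
  obtains \<D> where "finite \<D>" "\<forall>G\<in>\<D>. large G" "\<forall>i\<in>cells - M. b \<inter> \<Inter>\<D> \<inter> c i = {}"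
proof -
  obtain \<D> where *: "finite \<D> \<and> (\<forall>G\<in>\<D>. large G) \<and> (\<forall>i\<in>cells - M. b \<inter> \<Inter>\<D> \<inter> c i = {})"
    using assms unfolding covers_def ..
  then show thesis
    by (intro that[of \<D>]) simp_all
qed

lemma coversI_finite:
  assumes "finite \<D>" "\<And>G. G \<in> \<D> \<Longrightarrow> large G"
    and "\<And>i. i \<in> cells \<Longrightarrow> i \<notin> M \<Longrightarrow> b \<inter> \<Inter>\<D> \<inter> c i = {}"
  shows "covers M b"
  unfolding covers_def using assms by (intro exI[of _ \<D>] conjI ballI) simp_all

lemma covers_mono:
  assumes "covers M b" "a \<subseteq> b"
  shows "covers M a"
proof -
  obtain \<D> where D: "finite \<D>" "\<forall>G\<in>\<D>. large G" "\<forall>i\<in>cells - M. b \<inter> \<Inter>\<D> \<inter> c i = {}"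
    using assms(1) by (rule coversE)
  have "a \<inter> \<Inter>\<D> \<inter> c i = {}" if "i \<in> cells" "i \<notin> M" for i
    using bspec[OF D(3), of i] that assms(2) by blast
  then show ?thesis
    using D(1,2) by (intro coversI_finite[of \<D>]) simp_all
qed

lemma covers_Un_Int:
  assumes "covers M a" "covers N b"
  shows "covers (M \<union> N) (a \<union> b)" "covers (M \<inter> N) (a \<inter> b)"
proof -
  obtain \<D> where D: "finite \<D>" "\<forall>G\<in>\<D>. large G" "\<forall>i\<in>cells - M. a \<inter> \<Inter>\<D> \<inter> c i = {}"
    using assms(1) by (rule coversE)
  obtain \<E> where E: "finite \<E>" "\<forall>G\<in>\<E>. large G" "\<forall>i\<in>cells - N. b \<inter> \<Inter>\<E> \<inter> c i = {}"
    using assms(2) by (rule coversE)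
  have fin: "finite (\<D> \<union> \<E>)" and large: "\<And>G. G \<in> \<D> \<union> \<E> \<Longrightarrow> large G"
    using D(1,2) E(1,2) by auto
  show "covers (M \<union> N) (a \<union> b)"
  proof (rule coversI_finite[OF fin large])
    fix i
    assume "i \<in> cells" "i \<notin> M \<union> N"
    then have "a \<inter> \<Inter>\<D> \<inter> c i = {}" "b \<inter> \<Inter>\<E> \<inter> c i = {}"
      using bspec[OF D(3), of i] bspec[OF E(3), of i] by simp_all
    then show "(a \<union> b) \<inter> \<Inter>(\<D> \<union> \<E>) \<inter> c i = {}"
      by blast
  qed
  show "covers (M \<inter> N) (a \<inter> b)"
  proof (rule coversI_finite[OF fin large])
    fix i
    assume "i \<in> cells" "i \<notin> M \<inter> N"
    then have "a \<inter> \<Inter>\<D> \<inter> c i = {} \<or> b \<inter> \<Inter>\<E> \<inter> c i = {}"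
      using bspec[OF D(3), of i] bspec[OF E(3), of i] by (cases "i \<in> M") simp_all
    then show "(a \<inter> b) \<inter> \<Inter>(\<D> \<union> \<E>) \<inter> c i = {}"
      by blast
  qed
qed

text \<open>If the cells in \<open>N\<close> are contained in \<open>b\<close>, then in almost all blocks finitely many large sets
  meet each of them, so a set \<open>M\<close> that covers \<open>b\<close> has to contain them.\<close>

lemma m_le_covers:
  assumes "covers M b" "N \<subseteq> cells" "lift N \<subseteq> b"
  shows "m N \<le> m M"
proof -
  obtain \<D> where D: "finite \<D>" "\<forall>G\<in>\<D>. large G" "\<forall>i\<in>cells - M. b \<inter> \<Inter>\<D> \<inter> c i = {}"
    using assms(1) by (rule coversE)
  show ?thesis
  proof (rule m_mono[of "card \<D>"])
    fix n t
    assume n: "card \<D> \<le> n" "(n, t) \<in> N"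
    then have i: "(n, t) \<in> cells"
      using assms(2) by blast
    have "big n (c (n, t)) G" if "G \<in> \<D>" for G
      using bspec[OF D(2) that] bspec[OF _ i, of "\<lambda>i. big (fst i) (c i) G"] by (simp add: large_def)
    then have "c (n, t) \<inter> \<Inter>\<D> \<noteq> {}"
      using c[OF i] D(1) n(1) by (intro big_linked[of _ _ n]) auto
    moreover have "c (n, t) \<subseteq> b"
      using assms(3) n(2) by (auto simp: lift_def)
    ultimately have "b \<inter> \<Inter>\<D> \<inter> c (n, t) \<noteq> {}"
      by blast
    then show "(n, t) \<in> M"
      using bspec[OF D(3), of "(n, t)"] i by (cases "(n, t) \<in> M") simp_all
  qed
qed

lemma outer_le: "M \<in> cylinders J \<Longrightarrow> covers M b \<Longrightarrow> outer b \<le> m M"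
  unfolding outer_def using m_nonneg by (intro cINF_lower bdd_belowI2[of _ 0]) auto

lemma cells_cylinder: "cells \<in> cylinders S"
  using cylinders_Diff[OF cylinders_empty] by simp

lemma covering_cylinders_nonempty: "{M \<in> cylinders J. covers M b} \<noteq> {}"
  using cells_cylinder coversI[of cells b] by blast

lemma outer_near: "e > 0 \<Longrightarrow> \<exists>M\<in>cylinders J. covers M b \<and> m M < outer b + e"
proof -
  assume "e > 0"
  then have "outer b < outer b + e"
    by simp
  moreover have "bdd_below (m ` {M \<in> cylinders J. covers M b})"
    using m_nonneg by (intro bdd_belowI2[of _ 0])
  ultimately show ?thesis
    using cINF_less_iff[OF covering_cylinders_nonempty[of b], of m "outer b + e"]
    by (simp add: outer_def[symmetric]) blast
qed

lemma outer_ge: "N \<subseteq> cells \<Longrightarrow> lift N \<subseteq> b \<Longrightarrow> m N \<le> outer b"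
  unfolding outer_def using m_le_covers covering_cylinders_nonempty by (intro cINF_greatest) auto

lemma outer_UNIV: "outer UNIV = 1"
  using outer_ge[of cells UNIV] outer_le[OF cells_cylinder coversI, of UNIV] by simp

lemma outer_covers_empty: "covers {} b \<Longrightarrow> outer b = 0"
  using outer_le[OF cylinders_empty, of b] outer_ge[of "{}" b] by (simp add: lift_def)

lemma submodular_outer: "submodular outer"
  unfolding submodular_def
proof (intro conjI allI impI)
  show "outer {} = 0"
    by (rule outer_covers_empty) (simp add: coversI)
  show "outer a \<le> outer b" if "a \<subseteq> b" for a b
  proof (rule field_le_epsilon)
    fix e :: real
    assume "e > 0"
    then obtain M where "M \<in> cylinders J" "covers M b" "m M < outer b + e"
      using outer_near by blast
    then show "outer a \<le> outer b + e"
      using outer_le[of M a] covers_mono that by fastforce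
  qed
  fix a b
  show "outer (a \<union> b) + outer (a \<inter> b) \<le> outer a + outer b"
  proof (rule field_le_epsilon)
    fix e :: real
    assume "e > 0"
    then have "e / 2 > 0"
      by simp
    then obtain M N where MN: "M \<in> cylinders J" "covers M a" "m M < outer a + e / 2"
      "N \<in> cylinders J" "covers N b" "m N < outer b + e / 2"
      using outer_near by meson
    have "outer (a \<union> b) \<le> m (M \<union> N)" "outer (a \<inter> b) \<le> m (M \<inter> N)"
      using MN by (auto intro!: outer_le cylinders_Un cylinders_Int covers_Un_Int)
    then show "outer (a \<union> b) + outer (a \<inter> b) \<le> outer a + outer b + e"
      using m_modular[of M N] MN by linarith
  qed
qed

text \<open>Outside the cells \<open>a\<close> is arbitrary. This makes the coded sets closed under complements in the
  whole type.\<close>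

definition coded :: "(nat \<times> (nat set \<Rightarrow> nat)) set \<Rightarrow> 'a set \<Rightarrow> bool" where
  "coded M a \<longleftrightarrow> lift M \<subseteq> a \<and> a \<inter> lift (cells - M) = {}"

lemma coded_lift: "M \<subseteq> cells \<Longrightarrow> coded M (lift M)"
  by (simp add: coded_def lift_disjoint)

lemma outer_coded:
  assumes "M \<in> cylinders J" "coded M a"
  shows "outer a = m M"
proof (rule antisym)
  show "outer a \<le> m M"
    using assms by (intro outer_le coversI) (auto simp: coded_def lift_def)
  show "m M \<le> outer a"
    using assms cylinders_subset by (intro outer_ge) (auto simp: coded_def)
qed

text \<open>A cylinder \<open>M\<close> that covers \<open>b\<close> almost optimally yields the approximation \<open>lift M\<close>: the rest
  \<open>b - lift M\<close> is negligible.\<close>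

lemma coded_sets_submodular: "submodular_on_algebra {a. \<exists>M\<in>cylinders J. coded M a} outer"
proof (unfold_locales, rule submodular_outer)
  have compl: "coded (cells - M) (- a)" if "M \<in> cylinders J" "coded M a" for M a
  proof -
    have "cells - (cells - M) = M"
      using cylinders_subset[OF that(1)] by blast
    then show ?thesis
      using that(2) by (auto simp: coded_def)
  qed
  fix a
  assume "a \<in> {a. \<exists>M\<in>cylinders J. coded M a}"
  then obtain M where M: "M \<in> cylinders J" "coded M a"
    by blast
  show "- a \<in> {a. \<exists>M\<in>cylinders J. coded M a}"
    using compl[OF M] cylinders_Diff[OF M(1)] by blast
  show "outer a + outer (- a) = outer UNIV"
    using outer_coded[OF M] outer_coded[OF cylinders_Diff[OF M(1)] compl[OF M]]
      m_Diff[OF cylinders_subset[OF M(1)]] by (simp add: outer_UNIV)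
  fix a'
  assume "a' \<in> {a. \<exists>M\<in>cylinders J. coded M a}"
  then obtain M' where M': "M' \<in> cylinders J" "coded M' a'"
    by blast
  have "lift (cells - (M \<union> M')) \<subseteq> lift (cells - M)" "lift (cells - (M \<union> M')) \<subseteq> lift (cells - M')"
    by (auto intro!: lift_mono)
  then have "coded (M \<union> M') (a \<union> a')"
    using M(2) M'(2) unfolding coded_def lift_Un by blast
  then show "a \<union> a' \<in> {a. \<exists>M\<in>cylinders J. coded M a}"
    using cylinders_Un[OF M(1) M'(1)] by blast
next
  show "approximated_by {a. \<exists>M\<in>cylinders J. coded M a} outer outer"
    unfolding approximated_by_def
  proof (intro allI impI)
    fix b and e :: real
    assume "e > 0"
    then obtain M where M: "M \<in> cylinders J" "covers M b" "m M < outer b + e"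
      using outer_near by blast
    obtain \<D> where D: "finite \<D>" "\<forall>G\<in>\<D>. large G" "\<forall>i\<in>cells - M. b \<inter> \<Inter>\<D> \<inter> c i = {}"
      using M(2) by (rule coversE)
    have "(b - lift M) \<inter> \<Inter>\<D> \<inter> c i = {}" if "i \<in> cells" for i
    proof (cases "i \<in> M")
      case False
      then show ?thesis
        using bspec[OF D(3), of i] that by blast
    qed (auto simp: lift_def)
    then have "covers {} (b - lift M)"
      using D(1,2) by (intro coversI_finite[of \<D>]) simp_all
    then have "outer (b - lift M) = 0"
      by (rule outer_covers_empty)
    moreover have "outer (lift M) = m M"
      using M(1) cylinders_subset by (intro outer_coded coded_lift) auto
    moreover have "coded M (lift M)"
      using cylinders_subset[OF M(1)] by (rule coded_lift)
    ultimately show "\<exists>a\<in>{a. \<exists>M\<in>cylinders J. coded M a}. outer (b - a) \<le> e \<and> outer a \<le> outer b + e"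
      using M \<open>e > 0\<close> by (intro bexI[of _ "lift M"]) auto
  qed
qed

end

section \<open>Columns avoid countable sets\<close>

context cell_family
begin

lemma countable_c_image: "M \<subseteq> cells \<Longrightarrow> countable (f ` M)"
  using countable_cells countable_subset by blast

lemma lift_eq_Union: "lift M = \<Union>(c ` M)"
  by (auto simp: lift_def)

lemma closures_of_disjoint_lifts:
  assumes "M \<subseteq> cells" "N \<subseteq> cells" "M \<inter> N = {}"
  shows "X closure_of lift M \<inter> X closure_of lift N = {}"
  unfolding lift_eq_Union
proof (rule disjoint_countable_Unions_closures_disjoint)
  show "w \<inter> u = {}" if wu: "w \<in> c ` M" "u \<in> c ` N" for w u
  proof -
    obtain i j where ij: "i \<in> M" "w = c i" "j \<in> N" "u = c j"
      using wu by blast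
    then have "i \<noteq> j"
      using assms(3) by blast
    then show ?thesis
      using c_disjoint[of i j] ij assms by blast
  qed
qed (use assms c countable_c_image in auto)

text \<open>The cells are partitioned into finitely many residue classes of the coordinate in column \<open>x\<close>.
  If \<open>d\<close> is in the closure of the union of all cells, it is in the closure of the union of one class,
  and then not in that of the other classes together.\<close>

lemma residue_class_off_closure:
  assumes "q > 0"
  obtains l where "d \<notin> X closure_of lift {(n, t) \<in> cells. t (x \<inter> {..<n}) mod q \<noteq> l}"
proof -
  define L where "L l = {(n, t) \<in> cells. t (x \<inter> {..<n}) mod q = l}" for l
  define L' where "L' l = {(n, t) \<in> cells. t (x \<inter> {..<n}) mod q \<noteq> l}" for l
  have LL: "L l \<subseteq> cells" "L' l \<subseteq> cells" "L l \<inter> L' l = {}" for l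
    by (auto simp: L_def L'_def)
  have disj: "X closure_of lift (L l) \<inter> X closure_of lift (L' l) = {}" for l
    using closures_of_disjoint_lifts[OF LL] .
  have "\<exists>l. d \<notin> X closure_of lift (L' l)"
  proof (cases "d \<in> X closure_of lift cells")
    case True
    have "lift cells \<subseteq> \<Union>((\<lambda>l. lift (L l)) ` {..<q})"
    proof
      fix y
      assume "y \<in> lift cells"
      then obtain n t where "(n, t) \<in> cells" "y \<in> c (n, t)"
        by (auto simp: lift_def)
      then have "y \<in> lift (L (t (x \<inter> {..<n}) mod q))"
        by (auto simp: lift_def L_def)
      moreover have "t (x \<inter> {..<n}) mod q \<in> {..<q}"
        using assms by simp
      ultimately show "y \<in> \<Union>((\<lambda>l. lift (L l)) ` {..<q})"
        by (intro UN_I)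
    qed
    then have "d \<in> X closure_of \<Union>((\<lambda>l. lift (L l)) ` {..<q})"
      using True by (rule closure_of_mono[THEN subsetD])
    moreover have "finite ((\<lambda>l. lift (L l)) ` {..<q})"
      by simp
    ultimately have "d \<in> (\<Union>S\<in>(\<lambda>l. lift (L l)) ` {..<q}. X closure_of S)"
      by (simp only: closure_of_Union)
    then obtain l where "d \<in> X closure_of lift (L l)"
      by (elim UN_E imageE) simp
    then show ?thesis
      using disj[of l] by blast
  next
    case False
    have "lift (L' 0) \<subseteq> lift cells"
      by (rule lift_mono) (auto simp: L'_def)
    then show ?thesis
      using False closure_of_mono by blast
  qed
  then show thesis
    using that unfolding L'_def by blast
qed

lemma finite_initial_cells: "finite {i \<in> cells. fst i < N}"
proof (rule finite_subset)
  show "{i \<in> cells. fst i < N} \<subseteq> (SIGMA n:{..<N}. block n)"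
    by (auto simp: cells_def)
qed simp

text \<open>Choose in each cell a big clopen set \<open>h i\<close> disjoint from \<open>D\<close>; their union \<open>G\<close> over all
  cells is large. The union of all \<open>h i \<inter> c i\<close> may still accumulate at points of \<open>D\<close> outside the
  cells. For the \<open>k\<close>-th point of \<open>D\<close> this is prevented by keeping only the cells whose coordinate in column
  \<open>x\<close> avoids one residue class modulo \<open>2 ^ (k + 1 + q)\<close>: the point is off the closure of the
  other classes. Summed over \<open>k\<close>, this costs little density.\<close>

lemma column_avoiding_countable:
  assumes D: "countable D" "D \<subseteq> topspace X" and e: "e > 0"
  obtains A H where "\<And>n. n > 0 \<Longrightarrow> real (card (A n \<inter> {..<n})) \<ge> (1 - e) * real n"
    "clopenin X H" "H \<inter> D = {}" "covers {} (lift (slab x A) - H)" "covers {} (H - lift (slab x A))"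
proof -
  have "\<exists>H. clopenin X H \<and> H \<inter> D = {} \<and> big (fst i) (c i) H" if "i \<in> cells" for i
  proof -
    obtain H where "clopenin X H" "H \<inter> D = {}" "\<And>b. b \<in> {c i} \<Longrightarrow> big (fst i) b H"
    proof (rule big_avoiding_countable[of "{c i}" D "fst i"])
      show "clopenin X b \<and> b \<noteq> {}" if "b \<in> {c i}" for b
        using c[OF \<open>i \<in> cells\<close>] that by simp
    qed (use D in auto)
    then show ?thesis
      by blast
  qed
  then obtain h where h: "\<And>i. i \<in> cells \<Longrightarrow> clopenin X (h i) \<and> h i \<inter> D = {} \<and> big (fst i) (c i) (h i)"
    by metis
  define G where "G = (\<Union>i\<in>cells. h i \<inter> c i)"
  have "large G"
    unfolding large_def
  proof
    fix i
    assume i: "i \<in> cells"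
    then have "big (fst i) (c i) (h i \<inter> c i)"
      using h c by (intro big_restrict) auto
    then show "big (fst i) (c i) G"
      by (rule big_mono) (use i in \<open>auto simp: G_def\<close>)
  qed
  have Gc: "G \<inter> c i = h i \<inter> c i" if "i \<in> cells" for i
    using that cell_unique[OF _ that] unfolding G_def by blast
  obtain q where q: "2 / 2 ^ q < e"
  proof -
    obtain q where "(1 / 2 :: real) ^ q < e / 2"
      using real_arch_pow_inv[of "e / 2" "1 / 2"] e by auto
    then show thesis
      using that[of q] by (simp add: power_one_over field_simps)
  qed
  define d where "d = from_nat_into D"
  have d: "\<exists>k. y = d k" if "y \<in> D" for y
    using from_nat_into_surj[OF D(1) that] by (auto simp: d_def)
  define off_class where "off_class k r \<longleftrightarrow>
    d k \<notin> X closure_of lift {(n, t) \<in> cells. t (x \<inter> {..<n}) mod 2 ^ (Suc k + q) \<noteq> r}" for k r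
  have "\<exists>r. off_class k r" for k
    unfolding off_class_def by (rule residue_class_off_closure[of "2 ^ (Suc k + q)" "d k" x]) auto
  then obtain l where "\<And>k. off_class k (l k)"
    by metis
  then have l: "d k \<notin> X closure_of lift {(n, t) \<in> cells. t (x \<inter> {..<n}) mod 2 ^ (Suc k + q) \<noteq> l k}" for k
    unfolding off_class_def .
  \<comment> \<open>The \<open>k\<close>-th class is avoided from block \<open>Suc k * 2 ^ q\<close> on. The finitely many earlier blocks have
    finitely many cells, whose union is closed.\<close>
  define A where "A n = {a. \<not> (\<exists>k. Suc k * 2 ^ q \<le> n \<and> a mod 2 ^ (Suc k + q) = l k)}" for n
  define S where "S = slab x A"
  have S: "S \<subseteq> cells"
    by (auto simp: S_def slab_def)
  define \<W> where "\<W> = (\<lambda>i. h i \<inter> c i) ` S"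
  have W_lift: "\<Union>\<W> \<subseteq> lift S"
    by (auto simp: \<W>_def lift_def)
  have off: "y \<notin> X closure_of \<Union>\<W>" if y: "y \<in> D" for y
  proof (cases "y \<in> lift cells")
    case True
    then obtain i where i: "i \<in> cells" "y \<in> c i"
      by (auto simp: lift_def)
    have "openin X (c i - h i)"
      using c[OF i(1)] h[OF i(1)] clopenin_Diff unfolding clopenin_def by blast
    moreover have "y \<in> c i - h i"
      using i h[OF i(1)] y by blast
    moreover have "(c i - h i) \<inter> \<Union>\<W> = {}"
    proof -
      have "(c i - h i) \<inter> (h j \<inter> c j) = {}" if "j \<in> S" for j
        using c_disjoint[OF i(1), of j] that S by (cases "i = j") auto
      then show ?thesis
        unfolding \<W>_def by auto
    qed
    ultimately show ?thesis
      unfolding in_closure_of by blast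
  next
    case False
    obtain k where k: "y = d k"
      using d[OF y] by blast
    let ?L = "{(n, t) \<in> cells. t (x \<inter> {..<n}) mod 2 ^ (Suc k + q) \<noteq> l k}"
    let ?I = "{i \<in> cells. fst i < Suc k * 2 ^ q}"
    have "S \<subseteq> ?L \<union> ?I"
    proof
      fix i
      assume "i \<in> S"
      moreover obtain n t where "i = (n, t)"
        by (cases i)
      ultimately show "i \<in> ?L \<union> ?I"
        unfolding S_def slab_def A_def by (cases "n < Suc k * 2 ^ q") (auto simp: not_less simp del: mult_Suc power_Suc)
    qed
    then have "\<Union>\<W> \<subseteq> lift ?L \<union> lift ?I"
      using W_lift lift_mono[of S "?L \<union> ?I"] lift_Un by blast
    then have "X closure_of \<Union>\<W> \<subseteq> X closure_of lift ?L \<union> X closure_of lift ?I"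
      using closure_of_mono[of "\<Union>\<W>" "lift ?L \<union> lift ?I" X] by (simp only: closure_of_Un)
    moreover have "closedin X (lift ?I)"
    proof -
      have "clopenin X (lift ?I)"
        unfolding lift_def using finite_initial_cells c by (intro clopenin_UN) auto
      then show ?thesis
        by (simp add: clopenin_def)
    qed
    moreover have "lift ?I \<subseteq> lift cells"
      by (rule lift_mono) auto
    ultimately show ?thesis
      using l[of k] False k closure_of_closedin by blast
  qed
  obtain H where H: "clopenin X H" "\<And>w. w \<in> \<W> \<Longrightarrow> w \<subseteq> H" "H \<inter> D = {}"
    "\<And>u. u \<in> c ` (cells - S) \<Longrightarrow> H \<inter> u = {}"
  proof (rule clopen_superset_avoiding[of \<W> D "c ` (cells - S)"])
    show "countable \<W>" "countable (c ` (cells - S))"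
      unfolding \<W>_def using S by (auto intro!: countable_c_image)
    show "clopenin X w" if "w \<in> \<W>" for w
      using that h c S clopenin_Int unfolding \<W>_def by blast
    show "clopenin X u" if "u \<in> c ` (cells - S)" for u
      using that c by blast
    show "D \<inter> X closure_of \<Union>\<W> = {}"
      using off by blast
    show "w \<inter> u = {}" if wu: "w \<in> \<W>" "u \<in> c ` (cells - S)" for w u
    proof -
      obtain i where "u = c i" "i \<in> cells" "i \<notin> S"
        using wu(2) by blast
      then have "lift S \<inter> u = {}"
        using lift_cell[OF S] by blast
      then show ?thesis
        using wu(1) W_lift by blast
    qed
  qed (use D in auto)
  show thesis
  proof (rule that)
    show "real (card (A n \<inter> {..<n})) \<ge> (1 - e) * real n" if "n > 0" for n
    proof -
      have "(1 - e) * real n \<le> (1 - 2 / 2 ^ q) * real n"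
        using q by (intro mult_right_mono) auto
      then show ?thesis
        using card_avoiding_residues[of q n l] unfolding A_def by linarith
    qed
    show "covers {} (lift (slab x A) - H)"
    proof (rule coversI_large[OF \<open>large G\<close>])
      fix i
      assume i: "i \<in> cells"
      show "(lift (slab x A) - H) \<inter> G \<inter> c i = {}"
      proof (cases "i \<in> S")
        case True
        then have "G \<inter> c i \<subseteq> H"
          using Gc[OF i] H(2)[of "h i \<inter> c i"] by (auto simp: \<W>_def)
        then show ?thesis
          by blast
      next
        case False
        then show ?thesis
          using lift_cell[OF S i] unfolding S_def by blast
      qed
    qed
    show "covers {} (H - lift (slab x A))"
    proof (rule coversI)
      fix i
      assume i: "i \<in> cells"
      show "(H - lift (slab x A)) \<inter> c i = {}"
      proof (cases "i \<in> S")
        case True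
        then show ?thesis
          by (auto simp: S_def lift_def)
      next
        case False
        then show ?thesis
          using H(4)[of "c i"] i by blast
      qed
    qed
  qed (use H in auto)
qed

end

section \<open>Sets supported by countably many columns\<close>

text \<open>The finitely additive measure is defined on all sets of points, so that no class of measurable
  sets has to be tracked.\<close>

locale cell_measure = cell_family X J lt v F m W c
  for X :: "'a topology" and J and lt (infix "\<sqsubset>" 50) and v and F and m and W and c +
  fixes \<mu> :: "'a set \<Rightarrow> real"
  assumes mu_empty: "\<mu> {} = 0" and mu_nonneg: "\<mu> a \<ge> 0"
    and mu_add: "a \<inter> b = {} \<Longrightarrow> \<mu> (a \<union> b) = \<mu> a + \<mu> b"
    and mu_UNIV: "\<mu> UNIV = 1" and mu_le: "\<mu> a \<le> outer a"
    and mu_dense: "e > 0 \<Longrightarrow> \<exists>M\<in>cylinders J. \<exists>a. coded M a \<and> \<mu> (b - a) + \<mu> (a - b) < e"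
begin

lemma mu_mono:
  assumes "a \<subseteq> b"
  shows "\<mu> a \<le> \<mu> b"
proof -
  have "a \<union> (b - a) = b"
    using assms by blast
  then show ?thesis
    using mu_add[of a "b - a"] mu_nonneg[of "b - a"] by simp
qed

lemma mu_split: "\<mu> a = \<mu> (a \<inter> b) + \<mu> (a - b)"
  using mu_add[of "a \<inter> b" "a - b"] by (simp add: Int_Diff_Un Int_Diff_disjoint)

lemma mu_subadd: "\<mu> (a \<union> b) \<le> \<mu> a + \<mu> b"
  using mu_add[of a "b - a"] mu_mono[of "b - a" b] by auto

lemma mu_diff_triangle: "\<mu> (a - c') \<le> \<mu> (a - b) + \<mu> (b - c')"
  by (rule order_trans[OF mu_mono mu_subadd]) auto

lemma mu_le_plus_diff: "\<mu> a \<le> \<mu> b + \<mu> (a - b)"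
  using mu_split[of a b] mu_mono[of "a \<inter> b" b] by auto

lemma mu_null_Un: "\<mu> a = 0 \<Longrightarrow> \<mu> b = 0 \<Longrightarrow> \<mu> (a \<union> b) = 0"
  using mu_subadd[of a b] mu_nonneg[of "a \<union> b"] by simp

lemma mu_null_mono: "\<mu> b = 0 \<Longrightarrow> a \<subseteq> b \<Longrightarrow> \<mu> a = 0"
  using mu_mono[of a b] mu_nonneg[of a] by simp

lemma mu_null_UN: "finite K \<Longrightarrow> (\<And>k. k \<in> K \<Longrightarrow> \<mu> (f k) = 0) \<Longrightarrow> \<mu> (\<Union>k\<in>K. f k) = 0"
  by (induction K rule: finite_induct) (auto simp: mu_empty intro: mu_null_Un)

lemma mu_covers: "covers {} b \<Longrightarrow> \<mu> b = 0"
  using mu_le[of b] outer_covers_empty[of b] mu_nonneg[of b] by simp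

lemma mu_outside: "\<mu> (- lift cells) = 0"
  by (intro mu_covers coversI) (auto simp: lift_def)

text \<open>Both \<open>\<mu> (lift M)\<close> and the measure of its complement in the cells are at most the corresponding
  densities, and both pairs add up to \<open>1\<close>.\<close>

lemma mu_lift:
  assumes "M \<in> cylinders J"
  shows "\<mu> (lift M) = m M"
proof -
  have M: "M \<subseteq> cells"
    using assms cylinders_subset by blast
  have le: "\<mu> (lift N) \<le> m N" if "N \<in> cylinders J" for N
    using mu_le[of "lift N"] outer_coded[OF that coded_lift] cylinders_subset[OF that] by simp
  have "\<mu> (lift cells) = 1"
    using mu_add[of "lift cells" "- lift cells"] mu_outside mu_UNIV by (simp add: Compl_partition)
  moreover have "lift cells = lift M \<union> lift (cells - M)"
    using lift_Un[of M "cells - M"] M by (simp add: Un_absorb1)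
  ultimately have "\<mu> (lift M) + \<mu> (lift (cells - M)) = 1"
    using mu_add[OF lift_disjoint[OF M, of "cells - M"]] by simp
  then show ?thesis
    using le[OF assms] le[OF cylinders_Diff[OF assms]] m_Diff[OF M] by simp
qed

text \<open>The sets that, up to measure zero, belong to the completion of the cylinders over the columns
  in \<open>S\<close>.\<close>

definition supported :: "nat set set \<Rightarrow> 'a set set" where
  "supported S = {b. \<forall>e>0. \<exists>M\<in>cylinders S. \<mu> (b - lift M) + \<mu> (lift M - b) < e}"

lemma supported_mono: "S \<subseteq> S' \<Longrightarrow> supported S \<subseteq> supported S'"
  unfolding supported_def using cylinders_mono by blast

lemma supportedD:
  assumes "b \<in> supported S" "e > 0"
  obtains M where "M \<in> cylinders S" "\<mu> (b - lift M) + \<mu> (lift M - b) < e"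
  using assms unfolding supported_def by blast

lemma supported_limit:
  assumes "\<And>e. e > 0 \<Longrightarrow> \<exists>b'\<in>supported S. \<mu> (b - b') + \<mu> (b' - b) < e"
  shows "b \<in> supported S"
  unfolding supported_def
proof (intro CollectI allI impI)
  fix e :: real
  assume "e > 0"
  then have e2: "e / 2 > 0"
    by simp
  obtain b' where b': "b' \<in> supported S" "\<mu> (b - b') + \<mu> (b' - b) < e / 2"
    using assms[OF e2] by blast
  obtain M where "M \<in> cylinders S" "\<mu> (b' - lift M) + \<mu> (lift M - b') < e / 2"
    using supportedD[OF b'(1) e2] by blast
  then show "\<exists>M\<in>cylinders S. \<mu> (b - lift M) + \<mu> (lift M - b) < e"
    using b'(2) mu_diff_triangle[of b "lift M" b'] mu_diff_triangle[of "lift M" b b']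
    by (intro bexI[of _ M]) auto
qed

lemma supported_lift: "M \<in> cylinders S \<Longrightarrow> lift M \<in> supported S"
  unfolding supported_def using mu_empty by (auto intro!: bexI[of _ M])

lemma supported_null:
  assumes "b \<in> supported S" "\<mu> (b - b') = 0" "\<mu> (b' - b) = 0"
  shows "b' \<in> supported S"
  by (rule supported_limit) (use assms in \<open>auto intro!: bexI[of _ b]\<close>)

lemma supported_Compl:
  assumes "b \<in> supported S"
  shows "- b \<in> supported S"
  unfolding supported_def
proof (intro CollectI allI impI)
  fix e :: real
  assume "e > 0"
  then obtain M where M: "M \<in> cylinders S" "\<mu> (b - lift M) + \<mu> (lift M - b) < e"
    using supportedD[OF assms] by blast
  let ?N = "cells - M"
  have "lift M \<inter> lift ?N = {}" "lift M \<union> lift ?N = lift cells"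
    using cylinders_subset[OF M(1)] lift_disjoint[of M ?N] lift_Un[of M ?N] by (simp_all add: Un_absorb1)
  then have "- b - lift ?N \<subseteq> (lift M - b) \<union> - lift cells" "lift ?N - - b \<subseteq> b - lift M"
    by blast+
  then have "\<mu> (- b - lift ?N) \<le> \<mu> ((lift M - b) \<union> - lift cells)" "\<mu> (lift ?N - - b) \<le> \<mu> (b - lift M)"
    by (blast intro: mu_mono)+
  then have "\<mu> (- b - lift ?N) \<le> \<mu> (lift M - b)" "\<mu> (lift ?N - - b) \<le> \<mu> (b - lift M)"
    using mu_subadd[of "lift M - b" "- lift cells"] mu_outside by linarith+
  then show "\<exists>M\<in>cylinders S. \<mu> (- b - lift M) + \<mu> (lift M - - b) < e"
    using M cylinders_Diff[OF M(1)] by (intro bexI[of _ ?N]) auto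
qed

lemma supported_Un:
  assumes "a \<in> supported S" "b \<in> supported S"
  shows "a \<union> b \<in> supported S"
  unfolding supported_def
proof (intro CollectI allI impI)
  fix e :: real
  assume "e > 0"
  then have "e / 2 > 0"
    by simp
  then obtain M N where M: "M \<in> cylinders S" "\<mu> (a - lift M) + \<mu> (lift M - a) < e / 2"
      and N: "N \<in> cylinders S" "\<mu> (b - lift N) + \<mu> (lift N - b) < e / 2"
    using assms unfolding supported_def by blast
  have "(a \<union> b) - lift (M \<union> N) \<subseteq> (a - lift M) \<union> (b - lift N)"
    "lift (M \<union> N) - (a \<union> b) \<subseteq> (lift M - a) \<union> (lift N - b)"
    by (auto simp: lift_Un)
  then have "\<mu> ((a \<union> b) - lift (M \<union> N)) \<le> \<mu> (a - lift M) + \<mu> (b - lift N)"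
    "\<mu> (lift (M \<union> N) - (a \<union> b)) \<le> \<mu> (lift M - a) + \<mu> (lift N - b)"
    using mu_subadd by (blast intro: order_trans mu_mono)+
  then show "\<exists>M\<in>cylinders S. \<mu> ((a \<union> b) - lift M) + \<mu> (lift M - (a \<union> b)) < e"
    using M N by (intro bexI[of _ "M \<union> N"] cylinders_Un) auto
qed

lemma supported_Int: "a \<in> supported S \<Longrightarrow> b \<in> supported S \<Longrightarrow> a \<inter> b \<in> supported S"
  using supported_Compl[OF supported_Un[OF supported_Compl supported_Compl, of a S b]] by simp

lemma supported_UNIV: "UNIV \<in> supported S"
proof (rule supported_null[OF supported_lift[OF cells_cylinder]])
  show "\<mu> (UNIV - lift cells) = 0"
    using mu_outside by (simp add: Compl_eq_Diff_UNIV)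
  show "\<mu> (lift cells - UNIV) = 0"
    by (simp add: mu_empty)
qed

lemma supported_Inter: "finite \<F> \<Longrightarrow> \<F> \<subseteq> supported S \<Longrightarrow> \<Inter>\<F> \<in> supported S"
  by (induction \<F> rule: finite_induct) (auto simp: supported_UNIV intro: supported_Int)

text \<open>Independence holds for cylinders and both sides are continuous in \<open>b\<close>.\<close>

lemma slab_independent:
  assumes b: "b \<in> supported S" and "S \<subseteq> J" "x \<in> J" "x \<notin> S"
  shows "\<mu> (b \<inter> lift (slab x A)) = \<mu> b * m (slab x A)"
proof -
  let ?s = "slab x A"
  have s: "?s \<in> cylinders J" "m ?s \<le> 1"
    using slab_cylinder assms(3) m_mono[of 0 ?s cells] by (auto simp: slab_def)
  have le: "\<bar>\<mu> (b \<inter> lift ?s) - \<mu> b * m ?s\<bar> \<le> e" if "e > 0" for e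
  proof -
    have "e / 2 > 0"
      using that by simp
    then obtain M where M: "M \<in> cylinders S" "\<mu> (b - lift M) + \<mu> (lift M - b) < e / 2"
      using supportedD[OF b] by blast
    have MJ: "M \<in> cylinders J"
      using M(1) assms(2) cylinders_mono by blast
    have eq: "\<mu> (lift M \<inter> lift ?s) = \<mu> (lift M) * m ?s"
      using mu_lift[OF cylinders_Int[OF MJ s(1)]] mu_lift[OF MJ] m_independent[OF M(1) assms(4)]
        lift_Int[OF cylinders_subset[OF MJ] cylinders_subset[OF s(1)]] by simp
    have near: "\<bar>\<mu> a - \<mu> a'\<bar> \<le> e / 2" if "a - a' \<subseteq> b - lift M" "a' - a \<subseteq> lift M - b" for a a'
      using mu_le_plus_diff[of a a'] mu_le_plus_diff[of a' a] mu_mono[OF that(1)] mu_mono[OF that(2)]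
        M(2) mu_nonneg[of "b - lift M"] mu_nonneg[of "lift M - b"] by linarith
    have "\<bar>\<mu> (b \<inter> lift ?s) - \<mu> (lift M \<inter> lift ?s)\<bar> \<le> e / 2"
      by (rule near) auto
    moreover have "\<bar>\<mu> b * m ?s - \<mu> (lift M) * m ?s\<bar> \<le> e / 2"
    proof -
      have "\<bar>\<mu> b * m ?s - \<mu> (lift M) * m ?s\<bar> = \<bar>\<mu> b - \<mu> (lift M)\<bar> * m ?s"
        using m_nonneg[of ?s] by (simp add: left_diff_distrib[symmetric] abs_mult)
      also have "\<dots> \<le> \<bar>\<mu> b - \<mu> (lift M)\<bar>"
        using s(2) m_nonneg[of ?s] by (intro mult_left_le) auto
      also have "\<dots> \<le> e / 2"
        by (rule near) auto
      finally show ?thesis .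
    qed
    ultimately show ?thesis
      unfolding eq by linarith
  qed
  have "\<bar>\<mu> (b \<inter> lift ?s) - \<mu> b * m ?s\<bar> \<le> 0"
  proof (rule field_le_epsilon)
    fix e :: real
    assume "0 < e"
    from le[OF this] show "\<bar>\<mu> (b \<inter> lift ?s) - \<mu> b * m ?s\<bar> \<le> 0 + e"
      by (simp only: add_0)
  qed
  then show ?thesis
    by simp
qed

text \<open>Each \<open>b k\<close> is a limit of countably many cylinders, which depend on finitely many columns each.
  Countably many columns are bounded in \<open>J\<close>.\<close>

lemma countable_support:
  fixes b :: "nat \<Rightarrow> 'a set"
  obtains \<beta> where "\<beta> \<in> J" "\<And>k. b k \<in> supported {\<gamma> \<in> J. \<gamma> \<sqsubset> \<beta>}"
proof -
  have "\<exists>M E. M \<subseteq> cells \<and> finite E \<and> E \<subseteq> J \<and> determined_by E M \<and>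
      \<mu> (b k - lift M) + \<mu> (lift M - b k) < 1 / real (Suc j)" for k j
  proof -
    have "1 / real (Suc j) > 0"
      by simp
    then obtain M a where M: "M \<in> cylinders J" "coded M a"
        "\<mu> (b k - a) + \<mu> (a - b k) < 1 / real (Suc j)"
      using mu_dense[of "1 / real (Suc j)" "b k"] by blast
    have "lift M \<union> lift (cells - M) = lift cells"
      using cylinders_subset[OF M(1)] lift_Un[of M "cells - M"] by (simp add: Un_absorb1)
    then have "b k - lift M \<subseteq> (b k - a) \<union> - lift cells" "lift M - b k \<subseteq> a - b k"
      using M(2) unfolding coded_def by blast+
    then have "\<mu> (b k - lift M) \<le> \<mu> ((b k - a) \<union> - lift cells)" "\<mu> (lift M - b k) \<le> \<mu> (a - b k)"
      by (blast intro: mu_mono)+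
    then have "\<mu> (b k - lift M) \<le> \<mu> (b k - a)" "\<mu> (lift M - b k) \<le> \<mu> (a - b k)"
      using mu_subadd[of "b k - a" "- lift cells"] mu_outside by linarith+
    then have "\<mu> (b k - lift M) + \<mu> (lift M - b k) < 1 / real (Suc j)"
      using M(3) by linarith
    moreover obtain E where "finite E" "E \<subseteq> J" "determined_by E M" "M \<subseteq> cells"
      using M(1) unfolding cylinders_def by blast
    ultimately show ?thesis
      by (intro exI[of _ M] exI[of _ E] conjI)
  qed
  then obtain M E where ME: "\<And>k j. M k j \<subseteq> cells \<and> finite (E k j) \<and> E k j \<subseteq> J \<and> determined_by (E k j) (M k j) \<and>
      \<mu> (b k - lift (M k j)) + \<mu> (lift (M k j) - b k) < 1 / real (Suc j)"
    by metis
  have "countable (\<Union>k j. E k j)" "(\<Union>k j. E k j) \<subseteq> J"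
    using ME by (auto simp: countable_finite)
  then obtain \<beta> where \<beta>: "\<beta> \<in> J" "\<And>s. s \<in> (\<Union>k j. E k j) \<Longrightarrow> s \<sqsubset> \<beta>"
    by (rule strict_upper_bound) blast
  have "b k \<in> supported {\<gamma> \<in> J. \<gamma> \<sqsubset> \<beta>}" for k
    unfolding supported_def
  proof (intro CollectI allI impI)
    fix e :: real
    assume "e > 0"
    then obtain j where "1 / real (Suc j) < e"
      using nat_approx_posE by blast
    moreover have "E k j \<subseteq> {\<gamma> \<in> J. \<gamma> \<sqsubset> \<beta>}"
      using \<beta>(2) ME by blast
    then have "M k j \<in> cylinders {\<gamma> \<in> J. \<gamma> \<sqsubset> \<beta>}"
      using ME[of k j] unfolding cylinders_def by blast
    ultimately show "\<exists>M\<in>cylinders {\<gamma> \<in> J. \<gamma> \<sqsubset> \<beta>}. \<mu> (b k - lift M) + \<mu> (lift M - b k) < e"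
      using ME[of k j] by (intro bexI[of _ "M k j"]) linarith+
  qed
  then show thesis
    using \<beta>(1) that by blast
qed

end

section \<open>Weak P-points\<close>

context cell_measure
begin

definition below :: "nat set \<Rightarrow> nat set set" where
  "below \<beta> = {\<gamma> \<in> J. \<gamma> \<sqsubset> \<beta>}"

definition upto :: "nat set \<Rightarrow> nat set set" where
  "upto \<beta> = insert \<beta> (below \<beta>)"

text \<open>The sets added at stage \<open>\<gamma>\<close>: up to null sets, \<open>T\<close> contains members of \<open>\<G>\<close> intersected with
  slabs of density arbitrarily close to \<open>1\<close> in the new column. The bound \<open>1 - 1 / (k + 2)\<close> is such that
  \<open>k\<close> of these slabs have an intersection of positive density.\<close>

definition traces :: "nat set \<Rightarrow> 'a set set \<Rightarrow> 'a set set" where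
  "traces \<gamma> \<G> = {T \<in> supported (upto \<gamma>). \<exists>N A. (\<forall>k. N k \<in> \<G>) \<and>
     (\<forall>k. m (slab \<gamma> (A k)) \<ge> 1 - 1 / real (k + 2)) \<and>
     (\<forall>k. \<mu> (N k \<inter> lift (slab \<gamma> (A k)) - T) = 0)}"

abbreviation centred :: "'a set set \<Rightarrow> bool" where
  "centred \<equiv> centred_mod (\<lambda>a. \<mu> a = 0)"

lemma below_subset: "below \<beta> \<subseteq> J"
  by (auto simp: below_def)

lemma upto_below: "\<gamma> \<in> J \<Longrightarrow> \<gamma> \<sqsubset> \<beta> \<Longrightarrow> upto \<gamma> \<subseteq> below \<beta>"
  unfolding upto_def below_def using trans by blast

text \<open>For \<open>k\<close> sets \<open>T\<close> use the \<open>k\<close>-th slab of each. The intersection of the slabs has density at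
  least \<open>1 - k / (k + 2) > 0\<close>, and by independence it meets the intersection of the relevant members of
  \<open>\<G>\<close> in positive measure; almost all of that is in every \<open>T\<close>.\<close>

lemma traces_centred:
  assumes \<gamma>: "\<gamma> \<in> J" and G: "\<G> \<subseteq> supported (below \<gamma>)" "centred \<G>"
  shows "centred (\<G> \<union> traces \<gamma> \<G>)"
  unfolding centred_mod_def
proof (intro allI impI)
  fix \<F>
  assume F: "finite \<F> \<and> \<F> \<subseteq> \<G> \<union> traces \<gamma> \<G>"
  define \<T> where "\<T> = \<F> - \<G>"
  have T: "finite \<T>" "\<And>T. T \<in> \<T> \<Longrightarrow> T \<in> traces \<gamma> \<G>"
    using F by (auto simp: \<T>_def)
  have "\<exists>N A. (\<forall>k. N k \<in> \<G>) \<and> (\<forall>k. m (slab \<gamma> (A k)) \<ge> 1 - 1 / real (k + 2)) \<and>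
      (\<forall>k. \<mu> (N k \<inter> lift (slab \<gamma> (A k)) - T) = 0)" if "T \<in> \<T>" for T
    using T(2)[OF that] unfolding traces_def by simp
  then obtain N A where NA: "\<And>T. T \<in> \<T> \<Longrightarrow> (\<forall>k. N T k \<in> \<G>) \<and>
      (\<forall>k. m (slab \<gamma> (A T k)) \<ge> 1 - 1 / real (k + 2)) \<and>
      (\<forall>k. \<mu> (N T k \<inter> lift (slab \<gamma> (A T k)) - T) = 0)"
    by metis
  define k where "k = card \<T>"
  define \<E> where "\<E> = (\<F> \<inter> \<G>) \<union> (\<lambda>T. N T k) ` \<T>"
  have E: "finite \<E>" "\<E> \<subseteq> \<G>"
    using F T(1) NA by (auto simp: \<E>_def)
  define B where "B n = (\<Inter>T\<in>\<T>. A T k n)" for n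
  have "m (slab \<gamma> (\<lambda>n. \<Inter>T\<in>\<T>. A T k n)) \<ge> 1 - real (card \<T>) * (1 / real (k + 2))"
    using T(1) NA by (intro m_slab_INT) auto
  moreover have "real (card \<T>) * (1 / real (k + 2)) < 1"
    by (simp add: k_def)
  ultimately have "m (slab \<gamma> B) > 0"
    unfolding B_def by linarith
  moreover have "\<mu> (\<Inter>\<E>) > 0"
    using centred_modD[OF G(2) E] mu_nonneg[of "\<Inter>\<E>"] by simp
  moreover have "\<mu> (\<Inter>\<E> \<inter> lift (slab \<gamma> B)) = \<mu> (\<Inter>\<E>) * m (slab \<gamma> B)"
  proof (rule slab_independent[OF _ below_subset \<gamma>])
    show "\<Inter>\<E> \<in> supported (below \<gamma>)"
      using E G(1) by (intro supported_Inter) auto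
    show "\<gamma> \<notin> below \<gamma>"
      using irrefl by (simp add: below_def)
  qed
  ultimately have pos: "\<mu> (\<Inter>\<E> \<inter> lift (slab \<gamma> B)) > 0"
    by simp
  have sub: "\<Inter>\<E> \<inter> lift (slab \<gamma> B) - \<Inter>\<F> \<subseteq> (\<Union>T\<in>\<T>. N T k \<inter> lift (slab \<gamma> (A T k)) - T)"
  proof
    fix y
    assume y: "y \<in> \<Inter>\<E> \<inter> lift (slab \<gamma> B) - \<Inter>\<F>"
    then obtain T where T': "T \<in> \<F>" "y \<notin> T"
      by blast
    then have "T \<notin> \<F> \<inter> \<G>"
      using y by (auto simp: \<E>_def)
    then have TT: "T \<in> \<T>"
      using T' by (auto simp: \<T>_def)
    have "slab \<gamma> B \<subseteq> slab \<gamma> (A T k)"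
      using TT by (auto simp: slab_def B_def)
    then have "y \<in> lift (slab \<gamma> (A T k))"
      using y lift_mono by blast
    moreover have "y \<in> N T k"
      using y TT by (auto simp: \<E>_def)
    ultimately show "y \<in> (\<Union>T\<in>\<T>. N T k \<inter> lift (slab \<gamma> (A T k)) - T)"
      using T' TT by blast
  qed
  have "\<mu> (\<Union>T\<in>\<T>. N T k \<inter> lift (slab \<gamma> (A T k)) - T) = 0"
    using T(1) NA by (intro mu_null_UN) auto
  then have "\<mu> (\<Inter>\<E> \<inter> lift (slab \<gamma> B) - \<Inter>\<F>) = 0"
    using sub by (rule mu_null_mono)
  then have "\<mu> (\<Inter>\<F>) > 0"
    using mu_le_plus_diff[of "\<Inter>\<E> \<inter> lift (slab \<gamma> B)" "\<Inter>\<F>"] pos by linarith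
  then show "\<mu> (\<Inter>\<F>) \<noteq> 0"
    by simp
qed

text \<open>At stage \<open>\<beta>\<close> everything gathered before is centred, as finitely many sets were already present
  at one earlier stage together with its traces. Extend it to a family that decides all sets supported
  by the columns before \<open>\<beta>\<close>.\<close>

lemma coherent_filters:
  obtains G where "\<And>\<beta> \<gamma>. \<beta> \<in> J \<Longrightarrow> \<gamma> \<in> J \<Longrightarrow> \<gamma> \<sqsubset> \<beta> \<Longrightarrow> G \<gamma> \<union> traces \<gamma> (G \<gamma>) \<subseteq> G \<beta>"
    "\<And>\<beta>. \<beta> \<in> J \<Longrightarrow> centred (G \<beta>)"
    "\<And>\<beta> b. \<beta> \<in> J \<Longrightarrow> b \<in> supported (below \<beta>) \<Longrightarrow> b \<in> G \<beta> \<or> - b \<in> G \<beta>"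
proof -
  define P where "P G \<beta> H \<longleftrightarrow> (\<beta> \<in> J \<longrightarrow>
      (\<forall>\<gamma>\<in>J. \<gamma> \<sqsubset> \<beta> \<longrightarrow> G \<gamma> \<union> traces \<gamma> (G \<gamma>) \<subseteq> H) \<and> H \<subseteq> supported (below \<beta>) \<and> centred H \<and>
      (\<forall>b\<in>supported (below \<beta>). b \<in> H \<or> - b \<in> H))" for G :: "nat set \<Rightarrow> 'a set set" and \<beta> H
  have "\<exists>G. \<forall>\<beta>. P G \<beta> (G \<beta>)"
  proof (rule dependent_wf_choice[OF wf])
    fix f g :: "nat set \<Rightarrow> 'a set set" and x r
    assume "\<And>z. (z, x) \<in> {(x, y). x \<sqsubset> y} \<Longrightarrow> f z = g z"
    then show "P f x r = P g x r"
      by (auto simp: P_def)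
  next
    fix \<beta> and G :: "nat set \<Rightarrow> 'a set set"
    assume "\<And>y. (y, \<beta>) \<in> {(x, y). x \<sqsubset> y} \<Longrightarrow> P G y (G y)"
    then have IH: "P G \<gamma> (G \<gamma>)" if "\<gamma> \<sqsubset> \<beta>" for \<gamma>
      using that by blast
    show "\<exists>H. P G \<beta> H"
    proof (cases "\<beta> \<in> J")
      case True
      have sup: "G \<gamma> \<subseteq> supported (below \<gamma>)" and cen: "centred (G \<gamma>)"
        and coh: "\<And>\<delta>. \<delta> \<in> J \<Longrightarrow> \<delta> \<sqsubset> \<gamma> \<Longrightarrow> G \<delta> \<union> traces \<delta> (G \<delta>) \<subseteq> G \<gamma>"
        if "\<gamma> \<in> below \<beta>" for \<gamma>
        using IH[of \<gamma>] that unfolding P_def below_def by simp_all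
      define \<H> where "\<H> = (\<Union>\<gamma>\<in>below \<beta>. G \<gamma> \<union> traces \<gamma> (G \<gamma>))"
      have H_sup: "\<H> \<subseteq> supported (below \<beta>)"
      proof -
        have "G \<gamma> \<union> traces \<gamma> (G \<gamma>) \<subseteq> supported (below \<beta>)" if "\<gamma> \<in> below \<beta>" for \<gamma>
        proof -
          have *: "upto \<gamma> \<subseteq> below \<beta>"
            using that by (intro upto_below) (auto simp: below_def)
          then have "below \<gamma> \<subseteq> below \<beta>"
            by (simp add: upto_def)
          then show ?thesis
            using sup[OF that] supported_mono[OF *] supported_mono[of "below \<gamma>" "below \<beta>"]
            by (auto simp: traces_def)
        qed
        then show ?thesis
          unfolding \<H>_def by blast
      qed
      have H_centred: "centred \<H>"
        unfolding centred_mod_def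
      proof (intro allI impI)
        fix \<F>
        assume F: "finite \<F> \<and> \<F> \<subseteq> \<H>"
        show "\<mu> (\<Inter>\<F>) \<noteq> 0"
        proof (cases "\<F> = {}")
          case True
          then show ?thesis
            using mu_UNIV by simp
        next
          case False
          have "\<forall>f\<in>\<F>. \<exists>\<gamma>\<in>below \<beta>. f \<in> G \<gamma> \<union> traces \<gamma> (G \<gamma>)"
            using F unfolding \<H>_def by blast
          then obtain h where h: "\<And>f. f \<in> \<F> \<Longrightarrow> h f \<in> below \<beta> \<and> f \<in> G (h f) \<union> traces (h f) (G (h f))"
            by metis
          have "finite (h ` \<F>)" "h ` \<F> \<subseteq> J" "h ` \<F> \<noteq> {}"
            using F h False below_subset by auto
          then obtain \<gamma> where \<gamma>: "\<gamma> \<in> h ` \<F>" "\<And>y. y \<in> h ` \<F> \<Longrightarrow> y = \<gamma> \<or> y \<sqsubset> \<gamma>"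
            by (rule greatest_finite) blast
          have \<gamma>\<beta>: "\<gamma> \<in> below \<beta>"
            using \<gamma>(1) h by auto
          have "f \<in> G \<gamma> \<union> traces \<gamma> (G \<gamma>)" if "f \<in> \<F>" for f
          proof (cases "h f = \<gamma>")
            case True
            then show ?thesis
              using h[OF that] by simp
          next
            case False
            then have "h f \<sqsubset> \<gamma>" "h f \<in> J"
              using \<gamma>(2)[of "h f"] that h[OF that] below_subset by auto
            then show ?thesis
              using coh[OF \<gamma>\<beta>, of "h f"] h[OF that] by blast
          qed
          moreover have "centred (G \<gamma> \<union> traces \<gamma> (G \<gamma>))"
            using \<gamma>\<beta> below_subset sup[OF \<gamma>\<beta>] cen[OF \<gamma>\<beta>] by (intro traces_centred) auto
          ultimately show ?thesis
            using F by (intro centred_modD[of "\<lambda>a. \<mu> a = 0"]) auto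
        qed
      qed
      obtain H where H: "\<H> \<subseteq> H" "H \<subseteq> supported (below \<beta>)" "centred H"
        "\<And>b. b \<in> supported (below \<beta>) \<Longrightarrow> - b \<in> supported (below \<beta>) \<Longrightarrow> b \<in> H \<or> - b \<in> H"
        by (rule centred_mod_extension[of "\<lambda>a. \<mu> a = 0", OF mu_null_mono mu_null_Un H_sup H_centred]) blast+
      have "G \<gamma> \<union> traces \<gamma> (G \<gamma>) \<subseteq> H" if "\<gamma> \<in> J" "\<gamma> \<sqsubset> \<beta>" for \<gamma>
        using H(1) that unfolding \<H>_def below_def by blast
      then have "P G \<beta> H"
        unfolding P_def using H(2-4) supported_Compl by blast
      then show ?thesis
        by blast
    qed (simp add: P_def)
  qed
  then obtain G where "\<And>\<beta>. P G \<beta> (G \<beta>)"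
    by blast
  then have "(\<forall>\<gamma>\<in>J. \<gamma> \<sqsubset> \<beta> \<longrightarrow> G \<gamma> \<union> traces \<gamma> (G \<gamma>) \<subseteq> G \<beta>) \<and> centred (G \<beta>) \<and>
      (\<forall>b\<in>supported (below \<beta>). b \<in> G \<beta> \<or> - b \<in> G \<beta>)" if "\<beta> \<in> J" for \<beta>
    using that unfolding P_def by simp
  then show thesis
    by (intro that[of G]) simp_all
qed

lemma mu_null_if_contained_off: "b \<inter> lift cells = {} \<Longrightarrow> \<mu> b = 0"
  using mu_null_mono[OF mu_outside, of b] by blast

text \<open>The union \<open>p\<close> of the coherent families is an ultrafilter of sets of positive measure; by compactness
  it converges to a point \<open>z\<close>. Every clopen set in \<open>p\<close> contains \<open>z\<close>. So it is enough to find, for a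
  countable \<open>D\<close> that does not contain \<open>z\<close>, a clopen member of \<open>p\<close> that misses \<open>D\<close>.\<close>

theorem weak_P_point_in: "\<exists>z\<in>W. weak_P_point X z"
proof -
  obtain G where coh: "\<And>\<beta> \<gamma>. \<beta> \<in> J \<Longrightarrow> \<gamma> \<in> J \<Longrightarrow> \<gamma> \<sqsubset> \<beta> \<Longrightarrow> G \<gamma> \<union> traces \<gamma> (G \<gamma>) \<subseteq> G \<beta>"
    and cen: "\<And>\<beta>. \<beta> \<in> J \<Longrightarrow> centred (G \<beta>)"
    and dec: "\<And>\<beta> b. \<beta> \<in> J \<Longrightarrow> b \<in> supported (below \<beta>) \<Longrightarrow> b \<in> G \<beta> \<or> - b \<in> G \<beta>"
    using coherent_filters by blast
  define p where "p = (\<Union>\<beta>\<in>J. G \<beta>)"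
  have mono: "G \<gamma> \<subseteq> G \<beta>" if "\<gamma> \<in> J" "\<beta> \<in> J" "\<gamma> = \<beta> \<or> \<gamma> \<sqsubset> \<beta>" for \<gamma> \<beta>
    using coh[of \<beta> \<gamma>] that by blast
  have p_centred: "\<mu> (\<Inter>\<F>) \<noteq> 0" if F: "finite \<F>" "\<F> \<subseteq> p" for \<F>
  proof -
    have "\<forall>f\<in>\<F>. \<exists>\<beta>\<in>J. f \<in> G \<beta>"
      using F by (auto simp: p_def)
    then obtain h where h: "\<And>f. f \<in> \<F> \<Longrightarrow> h f \<in> J \<and> f \<in> G (h f)"
      by metis
    have "countable (h ` \<F>)" "h ` \<F> \<subseteq> J"
      using F h by (auto simp: countable_finite)
    then obtain \<beta> where \<beta>: "\<beta> \<in> J" "\<And>s. s \<in> h ` \<F> \<Longrightarrow> s \<sqsubset> \<beta>"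
      by (rule strict_upper_bound) blast
    have "\<F> \<subseteq> G \<beta>"
      using h mono \<beta> by blast
    then show ?thesis
      using centred_modD[OF cen[OF \<beta>(1)] F(1)] by blast
  qed
  have p_decides: "b \<in> p \<or> - b \<in> p" for b
  proof -
    obtain \<beta> where "\<beta> \<in> J" "b \<in> supported (below \<beta>)"
      using countable_support[of "\<lambda>_. b"] unfolding below_def by blast
    then show ?thesis
      using dec unfolding p_def by blast
  qed
  have p_disjoint: False if "a \<in> p" "b \<in> p" "a \<inter> b = {}" for a b
    using p_centred[of "{a, b}"] that mu_empty by simp
  have p_null: False if "a \<in> p" "\<mu> a = 0" for a
    using p_centred[of "{a}"] that by simp
  have "\<exists>z\<in>topspace X. \<forall>U. openin X U \<and> z \<in> U \<longrightarrow> U \<in> p"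
  proof (rule ccontr)
    assume "\<not> ?thesis"
    then have "\<forall>z\<in>topspace X. \<exists>U. openin X U \<and> z \<in> U \<and> U \<notin> p"
      by blast
    then obtain U where U: "\<And>z. z \<in> topspace X \<Longrightarrow> openin X (U z) \<and> z \<in> U z \<and> U z \<notin> p"
      by metis
    have "\<forall>V\<in>U ` topspace X. openin X V" "topspace X \<subseteq> \<Union>(U ` topspace X)"
      using U by blast+
    then obtain \<F> where F: "finite \<F>" "\<F> \<subseteq> U ` topspace X" "topspace X \<subseteq> \<Union>\<F>"
      using compact unfolding compact_space_alt by metis
    have "uminus ` \<F> \<subseteq> p"
      using F(2) U p_decides by blast
    then have "\<mu> (\<Inter>(uminus ` \<F>)) \<noteq> 0"
      using F(1) by (intro p_centred) auto
    moreover have "\<Inter>(uminus ` \<F>) \<inter> lift cells = {}"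
    proof -
      have "lift cells \<subseteq> topspace X"
        using c clopenin_subset unfolding lift_def by blast
      then show ?thesis
        using F(3) by blast
    qed
    ultimately show False
      using mu_null_if_contained_off by blast
  qed
  then obtain z where z: "z \<in> topspace X" "\<And>U. openin X U \<Longrightarrow> z \<in> U \<Longrightarrow> U \<in> p"
    by blast
  have "z \<in> W"
  proof (rule ccontr)
    assume "z \<notin> W"
    then have "topspace X - W \<in> p"
      using z W by (auto simp: clopenin_def openin_diff)
    moreover have "(topspace X - W) \<inter> lift cells = {}"
      using c unfolding lift_def by blast
    ultimately show False
      using p_null mu_null_if_contained_off by blast
  qed
  moreover have "weak_P_point X z"
    unfolding weak_P_point_def
  proof (intro conjI allI impI)
    fix D
    assume D: "D \<subseteq> topspace X \<and> countable D \<and> z \<notin> D"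
    show "z \<notin> X closure_of D"
    proof (cases "D = {}")
      case False
      define d where "d = from_nat_into D"
      have d: "d k \<in> D" for k
        using from_nat_into[OF False] by (simp add: d_def)
      have d_surj: "\<exists>k. y = d k" if "y \<in> D" for y
        using from_nat_into_surj[of D y] D that by (auto simp: d_def)
      have "\<exists>V. clopenin X V \<and> z \<in> V \<and> d k \<notin> V" for k
      proof -
        have "d k \<in> topspace X" "z \<noteq> d k"
          using d[of k] D by blast+
        then have "openin X (topspace X - {d k})" "z \<in> topspace X - {d k}"
          using z(1) closedin_Hausdorff_singleton[OF Hausdorff] by (auto simp: openin_diff)
        then show ?thesis
          by (rule clopen_nbhd) blast
      qed
      then obtain V where V: "\<And>k. clopenin X (V k) \<and> z \<in> V k \<and> d k \<notin> V k"
        by metis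
      define U where "U k = (\<Inter>j\<in>{..k}. V j)" for k
      have U: "clopenin X (U k)" "z \<in> U k" "d k \<notin> U k" for k
        unfolding U_def using V by (auto intro!: clopenin_INT)
      have U_dec: "U l \<subseteq> U k" if "k \<le> l" for k l
        using that by (auto simp: U_def)
      obtain \<beta> where \<beta>: "\<beta> \<in> J" "\<And>k. U k \<in> supported (below \<beta>)"
        using countable_support[of U] unfolding below_def by blast
      have U_in: "U k \<in> G \<beta>" for k
      proof (rule ccontr)
        assume "U k \<notin> G \<beta>"
        then have "- U k \<in> p"
          using dec[OF \<beta>] \<beta>(1) unfolding p_def by blast
        moreover have "U k \<in> p"
          using U[of k] z(2) by (simp add: clopenin_def)
        ultimately show False
          using p_disjoint by blast
      qed
      have "\<exists>A H. m (slab \<beta> A) \<ge> 1 - 1 / real (k + 2) \<and> clopenin X H \<and> H \<inter> D = {} \<and>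
          \<mu> (lift (slab \<beta> A) - H) = 0 \<and> \<mu> (H - lift (slab \<beta> A)) = 0" for k
      proof -
        have "1 / real (k + 2) > 0"
          by simp
        then obtain A H where "\<And>n. n > 0 \<Longrightarrow> real (card (A n \<inter> {..<n})) \<ge> (1 - 1 / real (k + 2)) * real n"
          "clopenin X H" "H \<inter> D = {}" "covers {} (lift (slab \<beta> A) - H)" "covers {} (H - lift (slab \<beta> A))"
          using column_avoiding_countable[of D "1 / real (k + 2)" \<beta>] D by metis
        then show ?thesis
          using m_slab_ge[of "1 - 1 / real (k + 2)" A \<beta>] mu_covers by blast
      qed
      then obtain A H where AH: "\<And>k. m (slab \<beta> (A k)) \<ge> 1 - 1 / real (k + 2)"
        "\<And>k. clopenin X (H k)" "\<And>k. H k \<inter> D = {}"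
        "\<And>k. \<mu> (lift (slab \<beta> (A k)) - H k) = 0" "\<And>k. \<mu> (H k - lift (slab \<beta> (A k))) = 0"
        by metis
      \<comment> \<open>The interpolating set \<open>T\<close> is to contain the \<open>w k\<close> and to be disjoint from the \<open>u k\<close>. Then
        \<open>T\<close> differs from \<open>w 0 \<union> \<dots> \<union> w k\<close> only inside \<open>U (k + 1)\<close> and off \<open>H k\<close>, hence in a set of small
        measure, so \<open>T\<close> is supported by the columns up to \<open>\<beta>\<close>. The point \<open>d k\<close> is in \<open>u k\<close>, as it is in
        no \<open>H j\<close> and not in \<open>U k\<close>.\<close>
      define w where "w k = H k \<inter> U k" for k
      define L where "L k = (\<Union>j\<in>{..<k}. w j)" for k
      define u where "u k = topspace X - (L k \<union> U k)" for k
      have w: "clopenin X (w k)" for k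
        unfolding w_def using AH(2) U(1) by (rule clopenin_Int)
      have L: "clopenin X (L k)" for k
        unfolding L_def using w by (intro clopenin_UN) auto
      obtain T where T: "clopenin X T" "\<And>k. w k \<subseteq> T" "\<And>k. T \<inter> u k = {}"
      proof (rule countable_clopen_interpolation_nat[of w u])
        show "clopenin X (u k)" for k
          unfolding u_def using L U(1) by (intro clopenin_Diff clopenin_Un) auto
        show "w k \<inter> u l = {}" for k l
        proof (cases "k < l")
          case True
          then show ?thesis
            by (auto simp: u_def L_def)
        next
          case False
          then show ?thesis
            using U_dec[of l k] by (auto simp: u_def w_def)
        qed
      qed (use w in auto)
      have "T \<in> supported (upto \<beta>)"
      proof (rule supported_limit)
        fix e :: real
        assume "e > 0"
        then obtain k where k: "1 / real (Suc k) < e"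
          using nat_approx_posE by blast
        have H_sup: "H j \<in> supported (upto \<beta>)" for j
          by (rule supported_null[OF supported_lift[OF slab_cylinder] AH(4,5)]) (simp add: upto_def)
        have U_sup: "U j \<in> supported (upto \<beta>)" for j
          using \<beta>(2) supported_mono[of "below \<beta>" "upto \<beta>"] by (auto simp: upto_def)
        have w_sup: "w j \<in> supported (upto \<beta>)" for j
          unfolding w_def using H_sup U_sup by (rule supported_Int)
        have "L (Suc k) \<in> supported (upto \<beta>)"
          unfolding L_def
        proof (induction k)
          case 0
          then show ?case
            using w_sup by (simp add: lessThan_Suc)
        next
          case (Suc k)
          have "(\<Union>j\<in>{..<Suc (Suc k)}. w j) = (\<Union>j\<in>{..<Suc k}. w j) \<union> w (Suc k)"
            by (auto simp: lessThan_Suc)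
          then show ?case
            using Suc w_sup supported_Un by metis
        qed
        moreover have "\<mu> (T - L (Suc k)) + \<mu> (L (Suc k) - T) < e"
        proof -
          have "L (Suc k) - T = {}"
            using T(2) by (auto simp: L_def)
          then have "\<mu> (L (Suc k) - T) = 0"
            using mu_empty by (simp only:)
          moreover have "T - L (Suc k) \<subseteq> - lift (slab \<beta> (A k)) \<union> (lift (slab \<beta> (A k)) - H k)"
          proof -
            have "T - L (Suc k) \<subseteq> U (Suc k)"
              using T(3)[of "Suc k"] clopenin_subset[OF T(1)] by (auto simp: u_def)
            then have "T - L (Suc k) \<subseteq> U k - w k"
              using U_dec[of k "Suc k"] by (auto simp: L_def)
            then show ?thesis
              by (auto simp: w_def)
          qed
          then have "\<mu> (T - L (Suc k)) \<le> \<mu> (- lift (slab \<beta> (A k))) + \<mu> (lift (slab \<beta> (A k)) - H k)"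
            by (rule order_trans[OF mu_mono mu_subadd])
          moreover have "\<mu> (- lift (slab \<beta> (A k))) = 1 - m (slab \<beta> (A k))"
            using mu_add[of "lift (slab \<beta> (A k))" "- lift (slab \<beta> (A k))"] mu_UNIV
              mu_lift[OF slab_cylinder[OF \<beta>(1)]] by (simp add: Compl_partition)
          moreover have "1 / real (k + 2) \<le> 1 / real (Suc k)"
            by (simp add: field_simps)
          ultimately show ?thesis
            using AH(1)[of k] AH(4)[of k] k by linarith
        qed
        ultimately show "\<exists>b'\<in>supported (upto \<beta>). \<mu> (T - b') + \<mu> (b' - T) < e"
          by blast
      qed
      moreover have "\<mu> (U k \<inter> lift (slab \<beta> (A k)) - T) = 0" for k
      proof (rule mu_null_mono[OF AH(4)])
        show "U k \<inter> lift (slab \<beta> (A k)) - T \<subseteq> lift (slab \<beta> (A k)) - H k"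
          using T(2)[of k] by (auto simp: w_def)
      qed
      ultimately have "T \<in> traces \<beta> (G \<beta>)"
        unfolding traces_def using U_in AH(1) by blast
      moreover obtain \<beta>' where "\<beta>' \<in> J" "\<beta> \<sqsubset> \<beta>'"
        using strict_upper_bound[of "{\<beta>}"] \<beta>(1) by auto
      ultimately have "T \<in> p"
        using coh[of \<beta>' \<beta>] \<beta>(1) unfolding p_def by blast
      have "z \<in> T"
      proof (rule ccontr)
        assume "z \<notin> T"
        then have "topspace X - T \<in> p"
          using z T(1) by (auto simp: clopenin_def openin_diff)
        then show False
          using p_disjoint \<open>T \<in> p\<close> by blast
      qed
      moreover have "T \<inter> D = {}"
      proof -
        have "d k \<notin> T" for k
        proof -
          have "d k \<notin> L k" "d k \<in> topspace X"
            using AH(3) d[of k] D by (auto simp: L_def w_def)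
          then show ?thesis
            using U(3)[of k] T(3)[of k] by (auto simp: u_def)
        qed
        then show ?thesis
          using d_surj by blast
      qed
      ultimately show ?thesis
        using T(1) unfolding in_closure_of clopenin_def by blast
    qed simp
  qed (rule z(1))
  ultimately show ?thesis
    by blast
qed

end

text \<open>The cells are countably many of the pieces into which a clopen subset of \<open>U\<close> splits.\<close>

theorem (in parovicenko) weak_P_points_dense:
  assumes "openin X U" "U \<noteq> {}"
  shows "\<exists>z\<in>U. weak_P_point X z"
proof -
  obtain x where "x \<in> U"
    using assms(2) by blast
  then obtain W where W0: "clopenin X W" "x \<in> W" "W \<subseteq> U"
    using clopen_nbhd[OF assms(1)] by blast
  obtain J lt where "omega1 J lt"
    using omega1_exists by blast
  then interpret parovicenko_omega1 X J lt
    by (intro parovicenko_omega1.intro parovicenko_axioms)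
  obtain v where "splitting_tree X J lt v"
    using splitting_tree_exists by blast
  then interpret splitting_tree X J lt v .
  obtain F m where "block_measure F m"
    using block_measure_exists by blast
  then interpret block_measure F m .
  obtain f :: "nat \<Rightarrow> nat set" where f: "inj f" "range f \<subseteq> J"
    using uncountable countable_finite infinite_countable_subset by metis
  define c where "c i = v W (f (to_nat_on cells i))" for i
  have "cell_family X J lt v F m W c"
  proof unfold_locales
    show "clopenin X W"
      by (rule W0)
    show "clopenin X (c i) \<and> c i \<noteq> {} \<and> c i \<subseteq> W" if "i \<in> cells" for i
      unfolding c_def using W0 f by (intro v) auto
    show "c i \<inter> c i' = {}" if "i \<in> cells" "i' \<in> cells" "i \<noteq> i'" for i i'
    proof -
      have "f (to_nat_on cells i) \<noteq> f (to_nat_on cells i')"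
        using that inj_on_to_nat_on[OF countable_cells] f(1) by (auto simp: inj_on_def)
      then show ?thesis
        unfolding c_def using W0 f by (intro v_disjoint) auto
    qed
  qed
  then interpret cell_family X J lt v F m W c .
  interpret submodular_on_algebra "{a. \<exists>M\<in>cylinders J. coded M a}" outer
    by (rule coded_sets_submodular)
  obtain \<mu> where \<mu>: "\<mu> {} = 0" "\<And>a. \<mu> a \<ge> 0" "\<And>a b. a \<inter> b = {} \<Longrightarrow> \<mu> (a \<union> b) = \<mu> a + \<mu> b"
    "\<mu> UNIV = outer UNIV" "\<And>a. \<mu> a \<le> outer a"
    "\<And>b e. e > 0 \<Longrightarrow> \<exists>a\<in>{a. \<exists>M\<in>cylinders J. coded M a}. \<mu> (b - a) + \<mu> (a - b) < e"
    by (rule additive_measure_below) blast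
  have "\<exists>M\<in>cylinders J. \<exists>a. coded M a \<and> \<mu> (b - a) + \<mu> (a - b) < e" if "e > 0" for e b
    using \<mu>(6)[OF that, of b] by blast
  then interpret cell_measure X J lt v F m W c \<mu>
    using \<mu>(1-5) by unfold_locales (simp_all add: outer_UNIV)
  show ?thesis
    using weak_P_point_in W0(3) by blast
qed

section \<open>Dense sets of weak P-points in function spaces\<close>

lemma compact_open_subbasic:
  "compactin X C \<Longrightarrow> openin Y U \<Longrightarrow>
    openin (compact_open_topology X Y) {f \<in> continuous_maps X Y. f ` C \<subseteq> U}"
  unfolding compact_open_topology_def by (rule topology_generated_by_Basis) blast

lemma compact_open_dense:
  assumes D: "D \<subseteq> continuous_maps X Y"
    and meets: "\<And>f \<K>. f \<in> continuous_maps X Y \<Longrightarrow> finite \<K> \<Longrightarrow>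
      (\<And>C U. (C, U) \<in> \<K> \<Longrightarrow> compactin X C \<and> openin Y U \<and> f ` C \<subseteq> U) \<Longrightarrow>
      \<exists>g\<in>D. \<forall>(C, U)\<in>\<K>. g ` C \<subseteq> U"
  shows "dense_in (compact_open_topology X Y) D"
proof -
  define \<S> where "\<S> = {{f \<in> continuous_maps X Y. f ` C \<subseteq> U} | C U. compactin X C \<and> openin Y U}"
  have "\<exists>g\<in>D. g \<in> T" if T: "openin (compact_open_topology X Y) T" "f \<in> T" for f T
  proof -
    have f: "f \<in> continuous_maps X Y"
      using openin_subset[OF T(1)] T(2) by auto
    have "openin (topology_generated_by \<S>) T"
      using T(1) by (simp add: compact_open_topology_def \<S>_def)
    then have "generate_topology_on \<S> T"
      by (simp add: openin_topology_generated_by_iff)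
    then have "\<exists>\<F>. finite \<F> \<and> \<F> \<subseteq> \<S> \<and> f \<in> \<Inter>\<F> \<and> continuous_maps X Y \<inter> \<Inter>\<F> \<subseteq> T"
      using T(2)
    proof (induction arbitrary: rule: generate_topology_on.induct)
      case Empty
      then show ?case by simp
    next
      case (Int a b)
      then obtain \<F> \<G> where "finite \<F>" "\<F> \<subseteq> \<S>" "f \<in> \<Inter>\<F>" "continuous_maps X Y \<inter> \<Inter>\<F> \<subseteq> a"
        "finite \<G>" "\<G> \<subseteq> \<S>" "f \<in> \<Inter>\<G>" "continuous_maps X Y \<inter> \<Inter>\<G> \<subseteq> b"
        by auto
      then show ?case
        by (intro exI[of _ "\<F> \<union> \<G>"]) auto
    next
      case (UN K)
      then obtain k where k: "k \<in> K" "f \<in> k"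
        by blast
      obtain \<F> where "finite \<F>" "\<F> \<subseteq> \<S>" "f \<in> \<Inter>\<F>" "continuous_maps X Y \<inter> \<Inter>\<F> \<subseteq> k"
        using UN.IH[OF k] by blast
      moreover have "k \<subseteq> \<Union>K"
        using k(1) by blast
      ultimately show ?case
        by (intro exI[of _ \<F>]) auto
    next
      case (Basis s)
      then show ?case
        by (intro exI[of _ "{s}"]) auto
    qed
    then obtain \<F> where F: "finite \<F>" "\<F> \<subseteq> \<S>" "f \<in> \<Inter>\<F>" "continuous_maps X Y \<inter> \<Inter>\<F> \<subseteq> T"
      by blast
    have "\<forall>s\<in>\<F>. \<exists>p. s = {f \<in> continuous_maps X Y. f ` fst p \<subseteq> snd p} \<and> compactin X (fst p) \<and> openin Y (snd p)"
    proof
      fix s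
      assume "s \<in> \<F>"
      then obtain C U where "s = {f \<in> continuous_maps X Y. f ` C \<subseteq> U}" "compactin X C" "openin Y U"
        using F(2) unfolding \<S>_def by blast
      then show "\<exists>p. s = {f \<in> continuous_maps X Y. f ` fst p \<subseteq> snd p} \<and> compactin X (fst p) \<and> openin Y (snd p)"
        by (intro exI[of _ "(C, U)"]) simp
    qed
    from bchoice[OF this] obtain p where p: "\<forall>s\<in>\<F>. s = {f \<in> continuous_maps X Y. f ` fst (p s) \<subseteq> snd (p s)} \<and>
        compactin X (fst (p s)) \<and> openin Y (snd (p s))" ..
    define C where "C s = fst (p s)" for s
    define U where "U s = snd (p s)" for s
    have CU: "s = {f \<in> continuous_maps X Y. f ` C s \<subseteq> U s}" "compactin X (C s)" "openin Y (U s)" if "s \<in> \<F>" for s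
      unfolding C_def U_def using conjunct1[OF bspec[OF p that]] conjunct2[OF bspec[OF p that]] by blast+
    have "\<exists>g\<in>D. \<forall>(C, U)\<in>(\<lambda>s. (C s, U s)) ` \<F>. g ` C \<subseteq> U"
    proof (rule meets[OF f])
      show "finite ((\<lambda>s. (C s, U s)) ` \<F>)"
        using F(1) by simp
      fix C' U'
      assume "(C', U') \<in> (\<lambda>s. (C s, U s)) ` \<F>"
      then obtain s where s: "s \<in> \<F>" "C' = C s" "U' = U s"
        by blast
      then have "f \<in> s"
        using F(3) by blast
      then have "f ` C s \<subseteq> U s"
        by (subst (asm) CU(1)[OF s(1)]) simp
      then show "compactin X C' \<and> openin Y U' \<and> f ` C' \<subseteq> U'"
        using CU(2,3)[OF s(1)] s(2,3) by simp
    qed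
    then obtain g where g: "g \<in> D" "\<And>s. s \<in> \<F> \<Longrightarrow> g ` C s \<subseteq> U s"
      by auto
    have "g \<in> s" if "s \<in> \<F>" for s
      by (subst CU(1)[OF that]) (use g(2)[OF that] g(1) D in blast)
    then show ?thesis
      using F(4) g(1) D by blast
  qed
  then have "f \<in> compact_open_topology X Y closure_of D" if "f \<in> continuous_maps X Y" for f
    using that unfolding in_closure_of by auto
  then show ?thesis
    using D closure_of_subset_topspace[of "compact_open_topology X Y" D] unfolding dense_in_def by auto
qed

lemma weak_P_point_compact_openI:
  assumes f: "f \<in> continuous_maps X Y"
    and sep: "\<And>D. countable D \<Longrightarrow> D \<subseteq> continuous_maps X Y \<Longrightarrow> f \<notin> D \<Longrightarrow>
      \<exists>\<K>. finite \<K> \<and> (\<forall>(C, U)\<in>\<K>. compactin X C \<and> openin Y U \<and> f ` C \<subseteq> U) \<and>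
        (\<forall>g\<in>D. \<exists>(C, U)\<in>\<K>. \<not> g ` C \<subseteq> U)"
  shows "weak_P_point (compact_open_topology X Y) f"
  unfolding weak_P_point_def
proof (intro conjI allI impI)
  show "f \<in> topspace (compact_open_topology X Y)"
    using f by simp
  fix D
  assume D: "D \<subseteq> topspace (compact_open_topology X Y) \<and> countable D \<and> f \<notin> D"
  then obtain \<K> where K0: "finite \<K>" "\<forall>(C, U)\<in>\<K>. compactin X C \<and> openin Y U \<and> f ` C \<subseteq> U"
    "\<forall>g\<in>D. \<exists>(C, U)\<in>\<K>. \<not> g ` C \<subseteq> U"
    using sep[of D] by auto
  have K: "compactin X C \<and> openin Y U \<and> f ` C \<subseteq> U" if "(C, U) \<in> \<K>" for C U
    using bspec[OF K0(2) that] by simp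
  define T where "T = continuous_maps X Y \<inter> (\<Inter>(C, U)\<in>\<K>. {f \<in> continuous_maps X Y. f ` C \<subseteq> U})"
  have "openin (compact_open_topology X Y) T"
  proof (cases "\<K> = {}")
    case True
    then show ?thesis
      using openin_topspace[of "compact_open_topology X Y"] by (simp add: T_def)
  next
    case False
    have "openin (compact_open_topology X Y) (\<Inter>(C, U)\<in>\<K>. {f \<in> continuous_maps X Y. f ` C \<subseteq> U})"
      using False K0(1) K by (intro openin_INT2) (auto intro: compact_open_subbasic)
    then show ?thesis
      using openin_topspace[of "compact_open_topology X Y"] unfolding T_def by auto
  qed
  moreover have "f \<in> T"
    using f K by (auto simp: T_def)
  moreover have "g \<notin> T" if g: "g \<in> D" for g
  proof -
    obtain C U where "(C, U) \<in> \<K>" "\<not> g ` C \<subseteq> U"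
      using bspec[OF K0(3) g] by blast
    then show ?thesis
      unfolding T_def by blast
  qed
  ultimately show "f \<notin> compact_open_topology X Y closure_of D"
    unfolding in_closure_of by blast
qed

text \<open>Choose for each \<open>h \<in> D\<close> a point \<open>x h\<close> where \<open>h\<close> differs from \<open>g\<close>. For each value \<open>y\<close> of \<open>g\<close> the
  countable set of all \<open>h (x h)\<close> with \<open>g (x h) = y\<close> does not contain \<open>y\<close>, so a neighbourhood of \<open>y\<close>
  misses it. Requiring that the fibre of \<open>y\<close> be mapped into this neighbourhood excludes those \<open>h\<close>.\<close>

lemma finite_range_weak_P_point:
  assumes "Hausdorff_space X" "compact_space X"
    and g: "g \<in> continuous_maps X X" "finite (g ` topspace X)"
    and wP: "\<And>x. x \<in> topspace X \<Longrightarrow> weak_P_point X (g x)"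
  shows "weak_P_point (compact_open_topology X X) g"
proof (rule weak_P_point_compact_openI[OF g(1)])
  fix D
  assume D: "countable D" "D \<subseteq> continuous_maps X X" "g \<notin> D"
  have "\<exists>x\<in>topspace X. h x \<noteq> g x" if "h \<in> D" for h
  proof (rule ccontr)
    assume "\<not> ?thesis"
    then have "h = g"
      using D(2) that g(1) by (intro extensionalityI[of h "topspace X" g]) (auto simp: continuous_maps_def)
    then show False
      using D(3) that by simp
  qed
  then obtain x where x: "\<And>h. h \<in> D \<Longrightarrow> x h \<in> topspace X \<and> h (x h) \<noteq> g (x h)"
    by metis
  have "\<exists>V. openin X V \<and> y \<in> V \<and> (\<forall>h\<in>D. g (x h) = y \<longrightarrow> h (x h) \<notin> V)" if "y \<in> g ` topspace X" for y
  proof -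
    define E where "E = (\<lambda>h. h (x h)) ` {h \<in> D. g (x h) = y}"
    have "weak_P_point X y"
      using that wP by blast
    moreover have "countable E"
      using D(1) by (simp add: E_def)
    moreover have "y \<notin> E"
    proof
      assume "y \<in> E"
      then obtain h where "h \<in> D" "g (x h) = y" "y = h (x h)"
        by (auto simp: E_def)
      then show False
        using x[of h] by simp
    qed
    moreover have "E \<subseteq> topspace X"
    proof -
      have "h (x h) \<in> topspace X" if "h \<in> D" for h
        using D(2) that x[OF that] continuous_map_image_subset_topspace[of X X h]
        by (auto simp: continuous_maps_def)
      then show ?thesis
        by (auto simp: E_def)
    qed
    ultimately have "y \<notin> X closure_of E" "y \<in> topspace X"
      unfolding weak_P_point_def by auto
    then obtain V where "openin X V" "y \<in> V" "\<forall>e\<in>E. e \<notin> V"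
      unfolding in_closure_of by blast
    then show ?thesis
      by (intro exI[of _ V]) (auto simp: E_def)
  qed
  then obtain V where V: "\<And>y. y \<in> g ` topspace X \<Longrightarrow>
      openin X (V y) \<and> y \<in> V y \<and> (\<forall>h\<in>D. g (x h) = y \<longrightarrow> h (x h) \<notin> V y)"
    by metis
  define P where "P y = {x \<in> topspace X. g x = y}" for y
  define \<K> where "\<K> = (\<lambda>y. (P y, V y)) ` (g ` topspace X)"
  have P: "compactin X (P y)" if "y \<in> g ` topspace X" for y
  proof -
    have gc: "continuous_map X X g"
      using g(1) by (simp add: continuous_maps_def)
    then have "y \<in> topspace X"
      using that continuous_map_image_subset_topspace by blast
    then have "closedin X {x \<in> topspace X. g x \<in> {y}}"
      using gc assms(1) by (intro closedin_continuous_map_preimage closedin_Hausdorff_singleton)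
    then show ?thesis
      using assms(2) by (simp add: closedin_compact_space P_def)
  qed
  show "\<exists>\<K>. finite \<K> \<and> (\<forall>(C, U)\<in>\<K>. compactin X C \<and> openin X U \<and> g ` C \<subseteq> U) \<and>
      (\<forall>h\<in>D. \<exists>(C, U)\<in>\<K>. \<not> h ` C \<subseteq> U)"
  proof (intro exI[of _ \<K>] conjI)
    show "finite \<K>"
      using g(2) by (simp add: \<K>_def)
    show "\<forall>(C, U)\<in>\<K>. compactin X C \<and> openin X U \<and> g ` C \<subseteq> U"
      using P V by (auto simp: \<K>_def P_def)
    show "\<forall>h\<in>D. \<exists>(C, U)\<in>\<K>. \<not> h ` C \<subseteq> U"
    proof
      fix h
      assume h: "h \<in> D"
      have "(P (g (x h)), V (g (x h))) \<in> \<K>"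
        using x[OF h] by (simp add: \<K>_def)
      moreover have "\<not> h ` P (g (x h)) \<subseteq> V (g (x h))"
        using x[OF h] V[of "g (x h)"] h by (auto simp: P_def)
      ultimately show "\<exists>(C, U)\<in>\<K>. \<not> h ` C \<subseteq> U"
        by blast
    qed
  qed
qed

text \<open>Near \<open>x\<close> only the conditions whose compact set contains \<open>x\<close> are relevant, and the value \<open>f x\<close>
  satisfies them together with all values in \<open>V\<close>.\<close>

lemma closed_pieces_neighbourhood:
  assumes X: "Hausdorff_space X" and f: "continuous_map X Y f" and x: "x \<in> topspace X"
    and K: "finite \<K>" "\<And>C U. (C, U) \<in> \<K> \<Longrightarrow> compactin X C \<and> openin Y U \<and> f ` C \<subseteq> U"
  obtains O' V where "openin X O'" "x \<in> O'" "openin Y V" "f x \<in> V"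
    "\<And>C U y. (C, U) \<in> \<K> \<Longrightarrow> y \<in> O' \<Longrightarrow> y \<in> C \<Longrightarrow> V \<subseteq> U"
proof -
  define O' where "O' = topspace X - (\<Union>(C, U)\<in>{(C, U) \<in> \<K>. x \<notin> C}. C)"
  define V where "V = topspace Y \<inter> (\<Inter>(C, U)\<in>{(C, U) \<in> \<K>. x \<in> C}. U)"
  have fin: "finite {(C, U) \<in> \<K>. x \<notin> C}" "finite {(C, U) \<in> \<K>. x \<in> C}"
    using K(1) by (auto intro: finite_subset[rotated])
  show thesis
  proof (rule that)
    have "closedin X (\<Union>(C, U)\<in>{(C, U) \<in> \<K>. x \<notin> C}. C)"
      using fin(1) K(2) X by (intro closedin_Union) (auto intro: compactin_imp_closedin)
    then show "openin X O'"
      unfolding O'_def by (rule openin_diff[OF openin_topspace])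
    show "x \<in> O'"
      using x by (auto simp: O'_def)
    have "openin Y (topspace Y \<inter> \<Inter>(snd ` {(C, U) \<in> \<K>. x \<in> C}))"
    proof (cases "{(C, U) \<in> \<K>. x \<in> C} = {}")
      case False
      then show ?thesis
        using fin(2) K(2) by (intro openin_Int openin_topspace openin_Inter) auto
    qed (simp only: image_empty Inter_empty Int_UNIV_right openin_topspace)
    moreover have "topspace Y \<inter> \<Inter>(snd ` {(C, U) \<in> \<K>. x \<in> C}) = V"
      by (auto simp: V_def)
    ultimately show "openin Y V"
      by simp
    show "f x \<in> V"
      using K(2) x continuous_map_image_subset_topspace[OF f] by (fastforce simp: V_def)
    show "V \<subseteq> U" if "(C, U) \<in> \<K>" "y \<in> O'" "y \<in> C" for C U y
      using that by (auto simp: O'_def V_def)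
  qed
qed

text \<open>Cover \<open>X\<close> by finitely many clopen sets \<open>b s\<close> on each of which one weak P-point \<open>z s\<close> is an
  acceptable value for all conditions. Sending each point to the \<open>z s\<close> of the first \<open>b s\<close> that
  contains it is continuous.\<close>

lemma (in parovicenko) finite_range_maps_dense:
  assumes wP: "\<And>U. openin X U \<Longrightarrow> U \<noteq> {} \<Longrightarrow> \<exists>z\<in>U. weak_P_point X z"
  shows "dense_in (compact_open_topology X X)
    {g \<in> continuous_maps X X. finite (g ` topspace X) \<and> (\<forall>x\<in>topspace X. weak_P_point X (g x))}"
proof (rule compact_open_dense)
  fix f \<K>
  assume f: "f \<in> continuous_maps X X" and \<K>: "finite \<K>"
    and K: "\<And>C U. (C, U) \<in> \<K> \<Longrightarrow> compactin X C \<and> openin X U \<and> f ` C \<subseteq> U"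
  have fc: "continuous_map X X f"
    using f by (simp add: continuous_maps_def)
  have "\<exists>b z. clopenin X b \<and> x \<in> b \<and> weak_P_point X z \<and> (\<forall>(C, U)\<in>\<K>. b \<inter> C \<noteq> {} \<longrightarrow> z \<in> U)"
    if x: "x \<in> topspace X" for x
  proof -
    obtain O' V where OV: "openin X O'" "x \<in> O'" "openin X V" "f x \<in> V"
      "\<And>C U y. (C, U) \<in> \<K> \<Longrightarrow> y \<in> O' \<Longrightarrow> y \<in> C \<Longrightarrow> V \<subseteq> U"
      using closed_pieces_neighbourhood[OF Hausdorff fc x \<K> K] by blast
    obtain b where b: "clopenin X b" "x \<in> b" "b \<subseteq> O'"
      using clopen_nbhd[OF OV(1,2)] .
    obtain z where z: "z \<in> V" "weak_P_point X z"
      using wP[OF OV(3)] OV(4) by blast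
    have "z \<in> U" if "(C, U) \<in> \<K>" "b \<inter> C \<noteq> {}" for C U
      using OV(5)[OF that(1)] that(2) b(3) z(1) by blast
    then show ?thesis
      using b z by (intro exI[of _ b] exI[of _ z]) auto
  qed
  then obtain b z where bz: "\<And>x. x \<in> topspace X \<Longrightarrow> clopenin X (b x) \<and> x \<in> b x \<and> weak_P_point X (z x) \<and>
      (\<forall>(C, U)\<in>\<K>. b x \<inter> C \<noteq> {} \<longrightarrow> z x \<in> U)"
    by metis
  have "\<forall>V\<in>b ` topspace X. openin X V" "topspace X \<subseteq> \<Union>(b ` topspace X)"
    using bz by (auto simp: clopenin_def)
  then obtain \<F> where F: "finite \<F>" "\<F> \<subseteq> b ` topspace X" "topspace X \<subseteq> \<Union>\<F>"
    using compact unfolding compact_space_alt by metis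
  obtain S where S: "S \<subseteq> topspace X" "finite S" "\<F> = b ` S"
    using finite_subset_image[OF F(1,2)] by blast
  obtain xs where xs: "set xs = S"
    using finite_list[OF S(2)] by blast
  have cover: "\<exists>s\<in>set xs. y \<in> b s" if "y \<in> topspace X" for y
    using F(3) S(3) xs that by blast
  define sel where "sel y = the (List.find (\<lambda>s. y \<in> b s) xs)" for y
  have sel: "sel y \<in> S \<and> y \<in> b (sel y)" if "y \<in> topspace X" for y
  proof (cases "List.find (\<lambda>s. y \<in> b s) xs")
    case None
    then show ?thesis
      using cover[OF that] by (auto simp: find_None_iff)
  next
    case (Some s)
    then have "s \<in> set xs" "y \<in> b s"
      by (auto simp: find_Some_iff)
    moreover have "sel y = s"
      by (simp add: sel_def Some)
    ultimately show ?thesis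
      using xs by simp
  qed
  have sel_open: "openin X {y \<in> topspace X. sel y = s}" for s
  proof -
    have "clopenin X {y \<in> topspace X. List.find (\<lambda>s. y \<in> b s) ys = r}" if "set ys \<subseteq> S" for ys r
      using that
    proof (induction ys)
      case Nil
      then show ?case
        by (cases "r = None") auto
    next
      case (Cons a ys)
      have a: "clopenin X (b a)"
        using Cons.prems S(1) bz by auto
      have eq: "{y \<in> topspace X. List.find (\<lambda>s. y \<in> b s) (a # ys) = r} =
          (if r = Some a then b a else {}) \<union> ({y \<in> topspace X. List.find (\<lambda>s. y \<in> b s) ys = r} - b a)"
        using clopenin_subset[OF a] by auto
      show ?case
        unfolding eq using Cons a by (intro clopenin_Un clopenin_Diff) auto
    qed
    then have "clopenin X {y \<in> topspace X. List.find (\<lambda>s. y \<in> b s) xs = Some s}"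
      using xs by blast
    moreover have "{y \<in> topspace X. sel y = s} = {y \<in> topspace X. List.find (\<lambda>s. y \<in> b s) xs = Some s}"
    proof -
      have "List.find (\<lambda>s. y \<in> b s) xs \<noteq> None" if "y \<in> topspace X" for y
        using cover[OF that] by (auto simp: find_None_iff)
      then show ?thesis
        by (auto simp: sel_def)
    qed
    ultimately show ?thesis
      by (simp add: clopenin_def)
  qed
  define g where "g = (\<lambda>y\<in>topspace X. z (sel y))"
  have zS: "weak_P_point X (z s)" "z s \<in> topspace X" if "s \<in> S" for s
    using that S(1) bz by (auto simp: weak_P_point_def)
  have "continuous_map X X g"
    unfolding continuous_map_def
  proof (intro conjI allI impI)
    show "g \<in> topspace X \<rightarrow> topspace X"
      using sel zS by (auto simp: g_def)
    fix U
    have "{x \<in> topspace X. g x \<in> U} = (\<Union>s\<in>{s. z s \<in> U}. {y \<in> topspace X. sel y = s})"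
      by (auto simp: g_def)
    then show "openin X {x \<in> topspace X. g x \<in> U}"
      using sel_open by auto
  qed
  then have "g \<in> continuous_maps X X"
    by (simp add: continuous_maps_def g_def)
  moreover have "g ` topspace X \<subseteq> z ` S"
    using sel by (auto simp: g_def)
  then have "finite (g ` topspace X)"
    using S(2) finite_subset by blast
  moreover have "\<forall>x\<in>topspace X. weak_P_point X (g x)"
    using sel zS by (auto simp: g_def)
  moreover have "g ` C \<subseteq> U" if CU: "(C, U) \<in> \<K>" for C U
  proof
    fix w
    assume "w \<in> g ` C"
    then obtain y where y: "y \<in> C" "w = g y"
      by blast
    then have yX: "y \<in> topspace X"
      using K[OF CU] compactin_subset_topspace by blast
    then have s: "sel y \<in> topspace X" "y \<in> b (sel y)"
      using sel S(1) by auto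
    then have "b (sel y) \<inter> C \<noteq> {}"
      using y by blast
    then have "z (sel y) \<in> U"
      using bz[OF s(1)] CU by blast
    then show "w \<in> U"
      using y yX by (simp add: g_def)
  qed
  then have "\<forall>(C, U)\<in>\<K>. g ` C \<subseteq> U"
    by blast
  ultimately show "\<exists>g\<in>{g \<in> continuous_maps X X. finite (g ` topspace X) \<and>
      (\<forall>x\<in>topspace X. weak_P_point X (g x))}. \<forall>(C, U)\<in>\<K>. g ` C \<subseteq> U"
    by (intro bexI[of _ g]) simp_all
qed auto

section \<open>Infinite sets of natural numbers\<close>

lemma injective_choice:
  fixes Q :: "nat \<Rightarrow> nat set"
  assumes "\<And>n. infinite (Q n)"
  obtains \<phi> where "inj \<phi>" "\<And>n. \<phi> n \<in> Q n"
proof -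
  have "\<exists>\<phi>. \<forall>n. \<phi> n \<in> Q n \<and> \<phi> n \<notin> \<phi> ` {..<n}"
  proof (rule dependent_wf_choice[OF wf_less_than])
    fix f g :: "nat \<Rightarrow> nat" and n r
    assume "\<And>z. (z, n) \<in> less_than \<Longrightarrow> f z = g z"
    then have "f ` {..<n} = g ` {..<n}"
      by (intro image_cong) auto
    then show "(r \<in> Q n \<and> r \<notin> f ` {..<n}) = (r \<in> Q n \<and> r \<notin> g ` {..<n})"
      by simp
  next
    fix n and f :: "nat \<Rightarrow> nat"
    have "infinite (Q n - f ` {..<n})"
      using assms by simp
    then have "Q n - f ` {..<n} \<noteq> {}"
      by (rule infinite_imp_nonempty)
    then show "\<exists>r. r \<in> Q n \<and> r \<notin> f ` {..<n}"
      by blast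
  qed
  then obtain \<phi> where \<phi>: "\<And>n. \<phi> n \<in> Q n" "\<And>n. \<phi> n \<notin> \<phi> ` {..<n}"
    by blast
  have "inj \<phi>"
  proof (rule linorder_injI)
    show "\<phi> m \<noteq> \<phi> n" if "m < n" for m n
      using \<phi>(2)[of n] that by (metis imageI lessThan_iff)
  qed
  then show thesis
    using \<phi>(1) that by blast
qed

text \<open>Enumerate with repetition each \<open>S n\<close> infinitely often and choose distinct elements.\<close>

lemma disjoint_infinite_refinement:
  fixes S :: "nat \<Rightarrow> nat set"
  assumes "\<And>n. infinite (S n)"
  obtains S' where "\<And>n. S' n \<subseteq> S n" "\<And>n. infinite (S' n)" "\<And>m n. m \<noteq> n \<Longrightarrow> S' m \<inter> S' n = {}"
proof -
  obtain a where a: "inj a" "\<And>k. a k \<in> S (fst (prod_decode k))"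
    using injective_choice[of "\<lambda>k. S (fst (prod_decode k))"] assms by blast
  define S' where "S' n = range (\<lambda>j. a (prod_encode (n, j)))" for n
  have "inj (\<lambda>j. a (prod_encode (n, j)))" for n
    using a(1) by (auto simp: inj_def dest!: injD[OF a(1)])
  then have "infinite (S' n)" for n
    unfolding S'_def by (rule range_inj_infinite)
  moreover have "S' n \<subseteq> S n" for n
    using a(2)[of "prod_encode (n, _)"] by (auto simp: S'_def)
  moreover have "S' m \<inter> S' n = {}" if "m \<noteq> n" for m n
    using that by (auto simp: S'_def dest!: injD[OF a(1)])
  ultimately show thesis
    using that by blast
qed

section \<open>The remainder of the Stone--Cech compactification of the natural numbers\<close>

locale beta_omega =
  fixes e :: "nat \<Rightarrow> 'b" and B :: "'b topology"
  assumes SC: "Stone_Cech_compactification (discrete_topology UNIV) e B"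
begin

lemma compact_B: "compact_space B" and Hausdorff_B: "Hausdorff_space B"
  and embedding: "embedding_map (discrete_topology UNIV) B e"
  and dense: "B closure_of (range e) = topspace B"
  and range_e: "range e \<subseteq> topspace B"
  and C_star: "C_star_embedded_in B (range e)"
  using SC by (auto simp: Stone_Cech_compactification_def dense_in_def)

definition cl :: "nat set \<Rightarrow> 'b set" where
  "cl S = B closure_of (e ` S)"

definition R :: "'b topology" where
  "R = Stone_Cech_remainder (discrete_topology UNIV) e B"

definition star :: "nat set \<Rightarrow> 'b set" where
  "star S = cl S - range e"

lemma R_eq: "R = subtopology B (topspace B - range e)"
  by (simp add: R_def Stone_Cech_remainder_def)

lemma topspace_R: "topspace R = topspace B - range e"
  by (auto simp: R_eq)

lemma inj_e: "inj e"
  using embedding by (auto simp: embedding_map_def homeomorphic_map_def dest: injective_quotient_map homeomorphic_imp_injective_map)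

lemma openin_range_e: "openin (subtopology B (range e)) (e ` S)"
proof -
  have "homeomorphic_map (discrete_topology UNIV) (subtopology B (range e)) e"
    using embedding by (simp add: embedding_map_def)
  then have "open_map (discrete_topology UNIV) (subtopology B (range e)) e"
    by (rule homeomorphic_imp_open_map)
  then show ?thesis
    by (simp add: open_map_def)
qed

lemma cl_subset: "cl S \<subseteq> topspace B"
  by (simp add: cl_def closure_of_subset_topspace)

lemma closedin_cl: "closedin B (cl S)"
  by (simp add: cl_def)

lemma cl_mono: "S \<subseteq> T \<Longrightarrow> cl S \<subseteq> cl T"
  unfolding cl_def by (intro closure_of_mono image_mono)

lemma cl_Un: "cl (S \<union> T) = cl S \<union> cl T"
  by (simp add: cl_def image_Un closure_of_Un)

lemma cl_UNIV: "cl UNIV = topspace B"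
  by (simp add: cl_def dense)

lemma e_in_cl: "n \<in> S \<Longrightarrow> e n \<in> cl S"
  unfolding cl_def using range_e by (intro subsetD[OF closure_of_subset]) auto

lemma cl_finite: "finite S \<Longrightarrow> cl S = e ` S"
  unfolding cl_def using range_e Hausdorff_B
  by (intro closure_of_closedin closedin_Hausdorff_finite) auto

text \<open>The characteristic function of \<open>S\<close> is bounded and extends continuously to \<open>B\<close>.\<close>

lemma cl_Compl_disjoint: "cl S \<inter> cl (- S) = {}"
proof -
  define f where "f y = (if y \<in> e ` S then 1 else 0 :: real)" for y
  have "continuous_map (subtopology B (range e)) euclideanreal f"
    unfolding continuous_map_def
  proof (intro conjI allI impI)
    fix U :: "real set"
    have "{x \<in> topspace (subtopology B (range e)). f x \<in> U} = e ` {n. f (e n) \<in> U}"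
      using range_e by auto
    then show "openin (subtopology B (range e)) {x \<in> topspace (subtopology B (range e)). f x \<in> U}"
      using openin_range_e by simp
  qed simp
  moreover have "bounded (f ` range e)"
    by (rule bounded_subset[of "{0, 1}"]) (auto simp: f_def)
  ultimately obtain g where g: "continuous_map B euclideanreal g" "\<forall>x\<in>range e. g x = f x"
    using C_star unfolding C_star_embedded_in_def by blast
  have closed: "closedin B {x \<in> topspace B. g x \<in> {r}}" for r
    by (rule closedin_continuous_map_preimage[OF g(1)]) simp
  have "cl S \<subseteq> {x \<in> topspace B. g x \<in> {1}}"
    unfolding cl_def using g(2) range_e by (intro closure_of_minimal closed) (auto simp: f_def)
  moreover have "cl (- S) \<subseteq> {x \<in> topspace B. g x \<in> {0}}"
  proof -
    have "f (e n) = 0" if "n \<notin> S" for n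
      using that inj_e by (auto simp: f_def inj_on_def)
    then show ?thesis
      unfolding cl_def using g(2) range_e by (intro closure_of_minimal closed) auto
  qed
  ultimately show ?thesis
    by fastforce
qed

lemma cl_cases:
  assumes "x \<in> topspace B"
  shows "x \<in> cl S \<or> x \<in> cl (- S)"
  using assms cl_Un[of S "- S"] cl_UNIV by auto

lemma cl_Int: "cl S \<inter> cl T = cl (S \<inter> T)"
proof
  show "cl S \<inter> cl T \<subseteq> cl (S \<inter> T)"
  proof
    fix x
    assume x: "x \<in> cl S \<inter> cl T"
    have "S = (S \<inter> T) \<union> (S - T)"
      by blast
    then have "x \<in> cl (S \<inter> T) \<or> x \<in> cl (S - T)"
      using x cl_Un[of "S \<inter> T" "S - T"] by auto
    moreover have "x \<notin> cl (S - T)"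
    proof
      assume "x \<in> cl (S - T)"
      moreover have "x \<in> cl (- (S - T))"
        using x cl_mono[of T "- (S - T)"] by auto
      ultimately show False
        using cl_Compl_disjoint by blast
    qed
    ultimately show "x \<in> cl (S \<inter> T)"
      by blast
  qed
qed (auto dest: subsetD[OF cl_mono, rotated])

lemma openin_cl: "openin B (cl S)"
proof -
  have "cl S = topspace B - cl (- S)"
    using cl_cases[of _ S] cl_Compl_disjoint[of S] cl_subset[of S] by auto
  then show ?thesis
    using closedin_cl by (metis openin_closedin_eq openin_diff openin_topspace)
qed

text \<open>The closures of sets of natural numbers are a base of \<open>B\<close>, by regularity and the density of
  the natural numbers.\<close>

lemma cl_base:
  assumes "openin B U" "x \<in> U"
  obtains S where "x \<in> cl S" "cl S \<subseteq> U"
proof -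
  have "regular_space B"
    using compact_B Hausdorff_B compact_Hausdorff_or_regular_imp_normal_space
    by (simp add: compact_Hausdorff_imp_regular_space)
  then have "neighbourhood_base_of (closedin B) B"
    by (simp only: neighbourhood_base_of_closedin)
  then have "\<exists>V K. openin B V \<and> closedin B K \<and> x \<in> V \<and> V \<subseteq> K \<and> K \<subseteq> U"
    using assms unfolding neighbourhood_base_of by simp
  then obtain V K where VK: "openin B V" "closedin B K" "x \<in> V" "V \<subseteq> K" "K \<subseteq> U"
    by (elim exE conjE)
  define S where "S = {n. e n \<in> V}"
  have "x \<in> cl S"
    unfolding cl_def in_closure_of
  proof (intro conjI allI impI)
    show "x \<in> topspace B"
      using VK openin_subset by blast
    fix T
    assume "x \<in> T \<and> openin B T"
    then have "openin B (T \<inter> V)" "x \<in> T \<inter> V"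
      using VK by auto
    moreover have "x \<in> B closure_of (range e)"
      using VK openin_subset dense by blast
    ultimately have "\<exists>y\<in>range e. y \<in> T \<inter> V"
      unfolding in_closure_of by blast
    then show "\<exists>y. y \<in> e ` S \<and> y \<in> T"
      by (auto simp: S_def)
  qed
  moreover have "cl S \<subseteq> K"
    unfolding cl_def using VK by (intro closure_of_minimal) (auto simp: S_def)
  ultimately show thesis
    using that VK by blast
qed

text \<open>The value at \<open>x\<close> has to lie in \<open>cl (\<phi> ` S)\<close> for all \<open>S\<close> with \<open>x \<in> cl S\<close>. By \<open>cl_Int\<close> these closed
  sets have the finite intersection property, and any choice of a common point is continuous.\<close>

lemma continuous_extension_exists:
  fixes \<phi> :: "nat \<Rightarrow> nat"
  obtains h where "continuous_map B B h" "\<And>n. h (e n) = e (\<phi> n)"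
proof -
  have ex: "\<exists>y\<in>topspace B. \<forall>S. x \<in> cl S \<longrightarrow> y \<in> cl (\<phi> ` S)" if x: "x \<in> topspace B" for x
  proof -
    define \<U> where "\<U> = {cl (\<phi> ` S) | S. x \<in> cl S}"
    have "\<Inter>\<F> \<noteq> {}" if F: "finite \<F>" "\<F> \<subseteq> \<U>" for \<F>
    proof -
      have "\<exists>S. x \<in> cl S \<and> (\<forall>T\<in>\<F>. cl (\<phi> ` S) \<subseteq> T)"
        using F
      proof (induction \<F> rule: finite_induct)
        case empty
        then show ?case
          using x cl_UNIV by auto
      next
        case (insert T \<F>)
        then obtain S S' where S: "x \<in> cl S" "\<forall>T\<in>\<F>. cl (\<phi> ` S) \<subseteq> T" "x \<in> cl S'" "T = cl (\<phi> ` S')"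
          by (auto simp: \<U>_def)
        have "cl (\<phi> ` (S \<inter> S')) \<subseteq> cl (\<phi> ` S)" "cl (\<phi> ` (S \<inter> S')) \<subseteq> cl (\<phi> ` S')"
          by (intro cl_mono image_mono Int_lower1 Int_lower2)+
        then have "\<forall>T'\<in>insert T \<F>. cl (\<phi> ` (S \<inter> S')) \<subseteq> T'"
          using S(2,4) by (metis insert_iff order_trans)
        moreover have "x \<in> cl (S \<inter> S')"
          using S(1,3) cl_Int[of S S'] by blast
        ultimately show ?case
          by (intro exI[of _ "S \<inter> S'"] conjI)
      qed
      then obtain S where S: "x \<in> cl S" "\<forall>T\<in>\<F>. cl (\<phi> ` S) \<subseteq> T"
        by blast
      have "S \<noteq> {}"
        using S(1) cl_finite[of "{}"] by auto
      then obtain n where "n \<in> S"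
        by blast
      then have "e (\<phi> n) \<in> cl (\<phi> ` S)"
        by (intro e_in_cl) simp
      then show ?thesis
        using S(2) by blast
    qed
    moreover have "\<forall>C\<in>\<U>. closedin B C"
      using closedin_cl by (auto simp: \<U>_def)
    ultimately have "\<Inter>\<U> \<noteq> {}"
      using compact_B[unfolded compact_space_fip, rule_format, of \<U>] by simp
    then obtain y where y: "y \<in> \<Inter>\<U>"
      by blast
    then have "\<forall>S. x \<in> cl S \<longrightarrow> y \<in> cl (\<phi> ` S)"
      by (auto simp: \<U>_def)
    moreover have "y \<in> topspace B"
      using calculation x cl_UNIV cl_subset by blast
    ultimately show ?thesis
      by blast
  qed
  then obtain h where h: "\<And>x. x \<in> topspace B \<Longrightarrow> h x \<in> topspace B \<and> (\<forall>S. x \<in> cl S \<longrightarrow> h x \<in> cl (\<phi> ` S))"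
    by metis
  have "continuous_map B B h"
    unfolding continuous_map_def
  proof (intro conjI allI impI)
    show "h \<in> topspace B \<rightarrow> topspace B"
      using h by blast
    fix U
    assume U: "openin B U"
    show "openin B {x \<in> topspace B. h x \<in> U}"
    proof (subst openin_subopen, intro ballI)
      fix x
      assume x: "x \<in> {x \<in> topspace B. h x \<in> U}"
      then obtain T where T: "h x \<in> cl T" "cl T \<subseteq> U"
        using cl_base[OF U] by blast
      have sub: "h y \<in> cl T" if "y \<in> cl (\<phi> -` T)" for y
        using h[of y] that cl_subset cl_mono[of "\<phi> ` (\<phi> -` T)" T] by blast
      have "x \<in> cl (\<phi> -` T)"
      proof (rule ccontr)
        assume "x \<notin> cl (\<phi> -` T)"
        then have "x \<in> cl (- (\<phi> -` T))"
          using cl_cases x by blast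
        then have "h x \<in> cl (\<phi> ` (- (\<phi> -` T)))"
          using h x by blast
        then have "h x \<in> cl (- T)"
          using cl_mono[of "\<phi> ` (- (\<phi> -` T))" "- T"] by blast
        then show False
          using T(1) cl_Compl_disjoint by blast
      qed
      then show "\<exists>V. openin B V \<and> x \<in> V \<and> V \<subseteq> {x \<in> topspace B. h x \<in> U}"
        using sub T(2) cl_subset by (intro exI[of _ "cl (\<phi> -` T)"]) (auto simp: openin_cl)
    qed
  qed
  moreover have "h (e n) = e (\<phi> n)" for n
  proof -
    have "h (e n) \<in> cl (\<phi> ` {n})"
      using h[of "e n"] range_e e_in_cl[of n "{n}"] by blast
    then show ?thesis
      by (simp add: cl_finite)
  qed
  ultimately show thesis
    using that by blast
qed

definition ext :: "(nat \<Rightarrow> nat) \<Rightarrow> 'b \<Rightarrow> 'b" where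
  "ext \<phi> = Stone_Cech_extension (discrete_topology UNIV) e B \<phi>"

text \<open>Two continuous maps that agree on the dense set of natural numbers are equal, so that the definite
  description is meaningful.\<close>

lemma ext: "continuous_map B B (ext \<phi>)" "ext \<phi> (e n) = e (\<phi> n)"
proof -
  let ?P = "\<lambda>h. h \<in> continuous_maps B B \<and> (\<forall>x\<in>topspace (discrete_topology UNIV). h (e x) = e (\<phi> x))"
  have "\<exists>!h. ?P h"
  proof (rule ex_ex1I)
    obtain h where h: "continuous_map B B h" "\<And>n. h (e n) = e (\<phi> n)"
      using continuous_extension_exists by blast
    have "continuous_map B B (restrict h (topspace B))"
      using h(1) by (rule continuous_map_eq) simp
    moreover have "restrict h (topspace B) (e n) = e (\<phi> n)" for n
    proof -
      have "e n \<in> topspace B"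
        using range_e by blast
      then show ?thesis
        using h(2) by simp
    qed
    ultimately show "\<exists>h. ?P h"
      by (intro exI[of _ "restrict h (topspace B)"]) (auto simp: continuous_maps_def)
  next
    fix h h'
    assume *: "?P h" "?P h'"
    have "h x = h' x" if x: "x \<in> topspace B" for x
    proof (rule forall_in_closure_of_eq[where X = B and Y = B and S = "range e" and f = h and g = h' and x = x])
      show "x \<in> B closure_of (range e)"
        using x dense by simp
    qed (use * Hausdorff_B in \<open>auto simp: continuous_maps_def\<close>)
    then show "h = h'"
      using * by (intro extensionalityI[of h "topspace B" h']) (auto simp: continuous_maps_def)
  qed
  then have "?P (ext \<phi>)"
    unfolding ext_def Stone_Cech_extension_def by (rule theI')
  then show "continuous_map B B (ext \<phi>)" "ext \<phi> (e n) = e (\<phi> n)"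
    by (auto simp: continuous_maps_def)
qed

lemma ext_in_topspace: "x \<in> topspace B \<Longrightarrow> ext \<phi> x \<in> topspace B"
  using continuous_map_image_subset_topspace[OF ext(1)] by blast

lemma ext_cl: "x \<in> cl S \<Longrightarrow> ext \<phi> x \<in> cl (\<phi> ` S)"
proof -
  assume "x \<in> cl S"
  then have "ext \<phi> x \<in> B closure_of (ext \<phi> ` e ` S)"
    using continuous_map_image_closure_subset[OF ext(1)] unfolding cl_def by blast
  moreover have "ext \<phi> ` e ` S = e ` \<phi> ` S"
    by (auto simp: ext(2) image_iff)
  ultimately show ?thesis
    by (simp add: cl_def)
qed

lemma ext_cl_vimage: "x \<in> topspace B \<Longrightarrow> ext \<phi> x \<in> cl T \<longleftrightarrow> x \<in> cl (\<phi> -` T)"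
proof
  show "ext \<phi> x \<in> cl T" if "x \<in> cl (\<phi> -` T)"
    using ext_cl[OF that, of \<phi>] cl_mono[of "\<phi> ` (\<phi> -` T)" T] by blast
  show "x \<in> cl (\<phi> -` T)" if "x \<in> topspace B" "ext \<phi> x \<in> cl T"
  proof (rule ccontr)
    assume "x \<notin> cl (\<phi> -` T)"
    then have "x \<in> cl (- (\<phi> -` T))"
      using cl_cases that(1) by blast
    then have "ext \<phi> x \<in> cl (- T)"
      using ext_cl[of x "- (\<phi> -` T)" \<phi>] cl_mono[of "\<phi> ` (- (\<phi> -` T))" "- T"] by blast
    then show False
      using that(2) cl_Compl_disjoint by blast
  qed
qed

lemma ext_remainder:
  assumes "inj \<phi>" "x \<in> topspace R"
  shows "ext \<phi> x \<in> topspace R"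
proof -
  have "ext \<phi> x \<noteq> e k" for k
  proof
    assume "ext \<phi> x = e k"
    then have "x \<in> cl (\<phi> -` {k})"
      using ext_cl_vimage[of x \<phi> "{k}"] assms(2) by (simp add: topspace_R cl_finite)
    moreover have "finite (\<phi> -` {k})"
      using assms(1) by (simp add: finite_vimageI)
    ultimately show False
      using assms(2) by (auto simp: cl_finite topspace_R)
  qed
  then show ?thesis
    using ext_in_topspace assms(2) by (auto simp: topspace_R)
qed

lemma openin_range: "openin B (range e)"
proof -
  have "openin B (\<Union>n. cl {n})"
    by (intro openin_Union) (auto simp: openin_cl)
  moreover have "(\<Union>n. cl {n}) = range e"
    by (auto simp: cl_finite)
  ultimately show ?thesis
    by simp
qed

lemma Hausdorff_R: "Hausdorff_space R"
  unfolding R_eq by (rule Hausdorff_space_subtopology[OF Hausdorff_B])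

lemma compact_R: "compact_space R"
  unfolding R_eq using openin_range compact_B
  by (intro compact_space_subtopology closedin_compact_space) auto

lemma star_subset: "star S \<subseteq> topspace R"
  using cl_subset by (auto simp: star_def topspace_R)

lemma star_in: "x \<in> topspace R \<Longrightarrow> x \<in> star S \<longleftrightarrow> x \<in> cl S"
  by (auto simp: star_def topspace_R)

lemma openin_star: "openin R (star S)"
  unfolding R_eq openin_subtopology using openin_cl cl_subset by (auto simp: star_def intro!: exI[of _ "cl S"])

lemma closedin_star: "closedin R (star S)"
  unfolding R_eq closedin_subtopology using closedin_cl cl_subset by (auto simp: star_def intro!: exI[of _ "cl S"])

text \<open>Together with the complement rule below, this identifies the clopen sets \<open>star S\<close> as a base of
  the remainder.\<close>

lemma star_base:
  assumes "openin R U" "x \<in> U"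
  obtains S where "x \<in> star S" "star S \<subseteq> U"
proof -
  obtain V where V: "openin B V" "U = V \<inter> topspace R"
    using assms(1) unfolding R_eq openin_subtopology by auto
  obtain S where "x \<in> cl S" "cl S \<subseteq> V"
    using cl_base[OF V(1)] V(2) assms(2) by blast
  then show thesis
    using that[of S] V(2) assms(2) star_in[of x S] star_subset by (auto simp: star_def)
qed

lemma star_Un: "star (S \<union> T) = star S \<union> star T"
  by (auto simp: star_def cl_Un)

lemma star_Int: "star S \<inter> star T = star (S \<inter> T)"
  using cl_Int[of S T] by (auto simp: star_def)

lemma star_mono: "S \<subseteq> T \<Longrightarrow> star S \<subseteq> star T"
  using cl_mono by (auto simp: star_def)

lemma star_finite: "finite S \<Longrightarrow> star S = {}"
  by (auto simp: star_def cl_finite)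

lemma star_almost_mono: "finite (S - T) \<Longrightarrow> star S \<subseteq> star T"
  using star_Un[of "S \<inter> T" "S - T"] star_finite[of "S - T"] star_mono[of "S \<inter> T" T]
  by (simp add: Int_Diff_Un)

lemma star_Compl: "x \<in> topspace R \<Longrightarrow> x \<notin> star S \<longleftrightarrow> x \<in> star (- S)"
  using cl_cases[of x S] cl_Compl_disjoint[of S] by (auto simp: star_def topspace_R)

lemma star_nonempty:
  assumes "infinite S"
  shows "star S \<noteq> {}"
proof
  assume "star S = {}"
  then have "cl S \<subseteq> \<Union>((\<lambda>n. cl {n}) ` UNIV)"
    by (auto simp: star_def cl_finite)
  moreover have "compactin B (cl S)"
    using closedin_compact_space[OF compact_B closedin_cl] .
  moreover have "\<forall>V\<in>(\<lambda>n. cl {n}) ` UNIV. openin B V"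
    using openin_cl by blast
  ultimately obtain \<F> where F: "finite \<F>" "\<F> \<subseteq> (\<lambda>n. cl {n}) ` UNIV" "cl S \<subseteq> \<Union>\<F>"
    by (meson compactinD)
  have "finite (\<Union>\<F>)"
    using F(1,2) by (auto simp: cl_finite)
  moreover have "e ` S \<subseteq> \<Union>\<F>"
    using F(3) e_in_cl by blast
  ultimately have "finite (e ` S)"
    using finite_subset by blast
  then show False
    using assms inj_e finite_imageD by (metis inj_on_subset subset_UNIV)
qed

lemma restrict_ext_continuous:
  assumes "inj \<phi>"
  shows "restrict (ext \<phi>) (topspace R) \<in> continuous_maps R R"
proof -
  have "continuous_map R B (ext \<phi>)"
    unfolding R_eq by (rule continuous_map_from_subtopology[OF ext(1)])
  then have "continuous_map R R (ext \<phi>)"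
    using ext_remainder[OF assms] unfolding R_eq continuous_map_in_subtopology
    by (auto simp: R_eq[symmetric] topspace_R)
  then have "continuous_map R R (restrict (ext \<phi>) (topspace R))"
    by (rule continuous_map_eq) simp
  then show ?thesis
    by (simp add: continuous_maps_def)
qed

text \<open>Cover the remainder by finitely many \<open>star (S x)\<close> such that on each of them the values may be taken
  in \<open>star (T x)\<close>, for an infinite set \<open>T x\<close>. If \<open>\<phi>\<close> maps \<open>n\<close> into \<open>T x\<close> for one \<open>x\<close> with \<open>n \<in> S x\<close>, then
  its extension satisfies the conditions.\<close>

theorem extensions_of_injections_dense:
  "dense_in (compact_open_topology R R) {restrict (ext \<phi>) (topspace R) | \<phi>. inj \<phi>}"
proof (rule compact_open_dense)
  show "{restrict (ext \<phi>) (topspace R) | \<phi>. inj \<phi>} \<subseteq> continuous_maps R R"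
    using restrict_ext_continuous by blast
  fix f \<K>
  assume f: "f \<in> continuous_maps R R" and \<K>: "finite \<K>"
    and K: "\<And>C U. (C, U) \<in> \<K> \<Longrightarrow> compactin R C \<and> openin R U \<and> f ` C \<subseteq> U"
  have fc: "continuous_map R R f"
    using f by (simp add: continuous_maps_def)
  have "\<exists>S T. x \<in> star S \<and> infinite T \<and> (\<forall>(C, U)\<in>\<K>. star S \<inter> C \<noteq> {} \<longrightarrow> star T \<subseteq> U)"
    if x: "x \<in> topspace R" for x
  proof -
    obtain O' V where OV: "openin R O'" "x \<in> O'" "openin R V" "f x \<in> V"
      "\<And>C U y. (C, U) \<in> \<K> \<Longrightarrow> y \<in> O' \<Longrightarrow> y \<in> C \<Longrightarrow> V \<subseteq> U"
      using closed_pieces_neighbourhood[OF Hausdorff_R fc x \<K> K] by blast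
    obtain S where S: "x \<in> star S" "star S \<subseteq> O'"
      using star_base[OF OV(1,2)] .
    obtain T where T: "f x \<in> star T" "star T \<subseteq> V"
      using star_base[OF OV(3,4)] .
    have "infinite T"
      using T(1) star_finite by blast
    moreover have "star T \<subseteq> U" if "(C, U) \<in> \<K>" "star S \<inter> C \<noteq> {}" for C U
      using OV(5)[OF that(1)] that(2) S(2) T(2) by blast
    ultimately show ?thesis
      using S(1) by (intro exI[of _ S] exI[of _ T]) auto
  qed
  then obtain S T where ST: "\<And>x. x \<in> topspace R \<Longrightarrow> x \<in> star (S x) \<and> infinite (T x) \<and>
      (\<forall>(C, U)\<in>\<K>. star (S x) \<inter> C \<noteq> {} \<longrightarrow> star (T x) \<subseteq> U)"
    by metis
  have "\<forall>V\<in>(\<lambda>x. star (S x)) ` topspace R. openin R V" "topspace R \<subseteq> \<Union>((\<lambda>x. star (S x)) ` topspace R)"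
    using ST openin_star by blast+
  then obtain \<F> where F: "finite \<F>" "\<F> \<subseteq> (\<lambda>x. star (S x)) ` topspace R" "topspace R \<subseteq> \<Union>\<F>"
    using compact_R unfolding compact_space_alt by metis
  obtain P where P: "P \<subseteq> topspace R" "finite P" "\<F> = (\<lambda>x. star (S x)) ` P"
    using finite_subset_image[OF F(1,2)] by blast
  define sel where "sel n = (SOME x. x \<in> P \<and> n \<in> S x)" for n
  have sel: "sel n \<in> P \<and> n \<in> S (sel n)" if "\<exists>x\<in>P. n \<in> S x" for n
  proof -
    have "\<exists>x. x \<in> P \<and> n \<in> S x"
      using that by blast
    then show ?thesis
      unfolding sel_def by (rule someI_ex)
  qed
  define Q where "Q n = (if \<exists>x\<in>P. n \<in> S x then T (sel n) else UNIV)" for n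
  have "infinite (Q n)" for n
    using sel[of n] ST P(1) by (auto simp: Q_def)
  then obtain \<phi> where \<phi>: "inj \<phi>" "\<And>n. \<phi> n \<in> Q n"
    using injective_choice by blast
  define N where "N x = {n. (\<exists>x\<in>P. n \<in> S x) \<and> sel n = x}" for x
  have key: "\<exists>x\<in>P. y \<in> star (N x)" if y: "y \<in> topspace R" for y
  proof -
    obtain x where x: "x \<in> P" "y \<in> star (S x)"
      using F(3) P(3) y by blast
    have "S x \<subseteq> (\<Union>x\<in>P. N x)"
      using sel x(1) by (auto simp: N_def)
    then have "y \<in> star (\<Union>x\<in>P. N x)"
      using x(2) star_mono by blast
    moreover have "star (\<Union>x\<in>P. N x) = (\<Union>x\<in>P. star (N x))"
      using P(2) by (induction P rule: finite_induct) (auto simp: star_Un star_finite)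
    ultimately show ?thesis
      by blast
  qed
  have "restrict (ext \<phi>) (topspace R) ` C \<subseteq> U" if CU: "(C, U) \<in> \<K>" for C U
  proof
    fix w
    assume "w \<in> restrict (ext \<phi>) (topspace R) ` C"
    then obtain y where y: "y \<in> C" "w = restrict (ext \<phi>) (topspace R) y"
      by blast
    then have yR: "y \<in> topspace R"
      using K[OF CU] compactin_subset_topspace by blast
    obtain x where x: "x \<in> P" "y \<in> star (N x)"
      using key[OF yR] by blast
    have "N x \<subseteq> S x"
      using sel by (auto simp: N_def)
    then have "y \<in> star (S x)"
      using x(2) star_mono by blast
    then have TU: "star (T x) \<subseteq> U"
      using ST[of x] x(1) P(1) CU y(1) by blast
    have "\<phi> ` N x \<subseteq> T x"
    proof
      fix k
      assume "k \<in> \<phi> ` N x"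
      then obtain n where "k = \<phi> n" "\<exists>x\<in>P. n \<in> S x" "sel n = x"
        by (auto simp: N_def)
      then show "k \<in> T x"
        using \<phi>(2)[of n] by (simp add: Q_def)
    qed
    moreover have "ext \<phi> y \<in> cl (\<phi> ` N x)"
      using x(2) by (intro ext_cl) (auto simp: star_def)
    ultimately have "ext \<phi> y \<in> star (T x)"
      using cl_mono[of "\<phi> ` N x" "T x"] ext_remainder[OF \<phi>(1) yR] by (auto simp: star_in)
    then show "w \<in> U"
      using TU y yR by auto
  qed
  then have "\<forall>(C, U)\<in>\<K>. restrict (ext \<phi>) (topspace R) ` C \<subseteq> U"
    by blast
  then show "\<exists>g\<in>{restrict (ext \<phi>) (topspace R) | \<phi>. inj \<phi>}. \<forall>(C, U)\<in>\<K>. g ` C \<subseteq> U"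
    using \<phi>(1) by blast
qed

text \<open>Split each \<open>s k\<close> into two halves \<open>A k\<close> and \<open>A' k\<close>. The value of \<open>G\<close> at a chosen point of
  \<open>star (s n)\<close> cannot be both in the star of the union of all \<open>\<phi> ` A k\<close> and in that of all
  \<open>\<phi> ` A' k\<close>, because \<open>\<phi>\<close> is injective. Keep the halves whose star it avoids, for \<open>k \<noteq> n\<close>, and by
  continuity shrink \<open>s n\<close> such that the whole of it avoids that star.\<close>

lemma fusion_step:
  fixes s :: "nat \<Rightarrow> nat set"
  assumes \<phi>: "inj \<phi>" and G: "continuous_map R R G"
    and s: "\<And>k. infinite (s k)" "\<And>j k. j \<noteq> k \<Longrightarrow> s j \<inter> s k = {}"
    and n: "\<And>x. x \<in> star (s n) \<Longrightarrow> G x \<notin> star (\<phi> ` s n)"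
  obtains s' where "\<And>k. s' k \<subseteq> s k" "\<And>k. infinite (s' k)"
    "\<And>x. x \<in> star (s' n) \<Longrightarrow> G x \<notin> star (\<Union>k. \<phi> ` s' k)"
proof -
  have "\<exists>A A'. A \<subseteq> s k \<and> A' \<subseteq> s k \<and> infinite A \<and> infinite A' \<and> A \<inter> A' = {}" for k
  proof (rule disjoint_infinite_refinement[of "\<lambda>_. s k", OF s(1)])
    fix S' :: "nat \<Rightarrow> nat set"
    assume "\<And>i. S' i \<subseteq> s k" "\<And>i. infinite (S' i)" "\<And>i j. i \<noteq> j \<Longrightarrow> S' i \<inter> S' j = {}"
    then show ?thesis
      by (intro exI[of _ "S' 0"] exI[of _ "S' 1"]) simp
  qed
  then obtain A A' where A: "\<And>k. A k \<subseteq> s k" "\<And>k. A' k \<subseteq> s k" "\<And>k. infinite (A k)" "\<And>k. infinite (A' k)"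
    "\<And>k. A k \<inter> A' k = {}"
    by metis
  obtain x where x: "x \<in> star (s n)"
    using star_nonempty[OF s(1)] by blast
  have "A j \<inter> A' k = {}" for j k
    using A(1,2,5) s(2)[of j k] by (cases "j = k") blast+
  then have "(\<Union>k\<in>- {n}. \<phi> ` A k) \<inter> (\<Union>k\<in>- {n}. \<phi> ` A' k) = {}"
    using \<phi> by (auto simp: inj_eq disjoint_iff)
  then have "star (\<Union>k\<in>- {n}. \<phi> ` A k) \<inter> star (\<Union>k\<in>- {n}. \<phi> ` A' k) = {}"
    by (simp add: star_Int star_finite)
  then obtain H where H: "H = A \<or> H = A'" "G x \<notin> star (\<Union>k\<in>- {n}. \<phi> ` H k)"
    by blast
  define V where "V = (\<Union>k\<in>- {n}. \<phi> ` H k)"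
  have xR: "x \<in> topspace R" "G x \<in> topspace R"
    using x star_subset continuous_map_image_subset_topspace[OF G] by blast+
  have "openin R {x \<in> topspace R. G x \<in> star (- V)}"
    by (rule openin_continuous_map_preimage[OF G openin_star])
  moreover have "x \<in> {x \<in> topspace R. G x \<in> star (- V)}"
    using xR H(2) star_Compl[of "G x" V] by (simp add: V_def)
  ultimately obtain S where S: "x \<in> star S" "star S \<subseteq> {x \<in> topspace R. G x \<in> star (- V)}"
    using star_base by blast
  define s' where "s' = H(n := S \<inter> s n)"
  have H_sub: "H k \<subseteq> s k" "infinite (H k)" for k
    using H(1) A by auto
  have "x \<in> star (S \<inter> s n)"
    using S(1) x star_Int by blast
  then have "infinite (S \<inter> s n)"
    using star_finite by blast
  then have s'_inf: "infinite (s' k)" for k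
    using H_sub by (simp add: s'_def)
  have s'_sub: "s' k \<subseteq> s k" for k
    using H_sub by (simp add: s'_def)
  show thesis
  proof (rule that)
    fix y
    assume y: "y \<in> star (s' n)"
    then have yS: "y \<in> star S" "y \<in> star (s n)"
      using star_mono[of "S \<inter> s n" S] star_mono[of "S \<inter> s n" "s n"] by (auto simp: s'_def)
    have "(\<Union>k. \<phi> ` s' k) \<subseteq> V \<union> \<phi> ` s n"
      unfolding s'_def V_def by (fastforce split: if_splits)
    then have "star (\<Union>k. \<phi> ` s' k) \<subseteq> star V \<union> star (\<phi> ` s n)"
      using star_mono star_Un by metis
    moreover have "G y \<notin> star V"
      using yS(1) S(2) star_Compl[of "G y" V] star_subset by blast
    ultimately show "G y \<notin> star (\<Union>k. \<phi> ` s' k)"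
      using n[OF yS(2)] by blast
  qed (use s'_inf s'_sub in auto)
qed

text \<open>The \<open>n\<close>-th element of \<open>T k\<close> comes from \<open>s n k\<close>, for \<open>n \<ge> k\<close>. Starting at \<open>n = k\<close> puts \<open>T k\<close>
  inside \<open>s k k\<close>, so that for \<open>k > n\<close> it is contained in \<open>s (n + 1) k\<close> entirely.\<close>

lemma fusion_limit:
  fixes s :: "nat \<Rightarrow> nat \<Rightarrow> nat set"
  assumes inf: "\<And>n k. infinite (s n k)" and dec: "\<And>n k. s (Suc n) k \<subseteq> s n k"
  obtains T where "\<And>k. infinite (T k)" "\<And>k. T k \<subseteq> s k k" "\<And>n k. finite (T k - s n k)"
proof -
  have "\<exists>a\<in>s n k. n \<le> a" for n k
    using inf[of n k] by (metis infinite_nat_iff_unbounded_le)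
  then obtain a where a: "\<And>n k. a n k \<in> s n k \<and> n \<le> a n k"
    by metis
  have dec': "s n k \<subseteq> s m k" if "m \<le> n" for m n k
    using that by (induction rule: dec_induct) (use dec in blast)+
  define T where "T k = {a n k | n. k \<le> n}" for k
  show thesis
  proof (rule that)
    show "infinite (T k)" for k
      unfolding infinite_nat_iff_unbounded_le
    proof
      fix m
      have "a (max m k) k \<in> T k" "m \<le> a (max m k) k"
        using a[of "max m k" k] by (auto simp: T_def)
      then show "\<exists>n\<ge>m. n \<in> T k"
        by blast
    qed
    show "T k \<subseteq> s k k" for k
      using a dec'[of k _ k] by (fastforce simp: T_def)
    show "finite (T k - s n k)" for n k
    proof (rule finite_subset)
      show "T k - s n k \<subseteq> (\<lambda>m. a m k) ` {..<n}"
      proof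
        fix y
        assume "y \<in> T k - s n k"
        then obtain m where "y = a m k" "a m k \<notin> s n k"
          by (auto simp: T_def)
        moreover from this have "m < n"
          using a[of m k] dec'[of n m k] by (meson not_le subsetD)
        ultimately show "y \<in> (\<lambda>m. a m k) ` {..<n}"
          by blast
      qed
    qed simp
  qed
qed

text \<open>In the fusion, step \<open>n\<close> takes care of the map \<open>G n\<close>: after it, \<open>G n\<close> maps the star of the current
  \<open>n\<close>-th set off the star of the union of all the current images. The limit sets are, up to finite
  errors in finitely many of them, contained in the current ones, so this persists; stars ignore finite
  errors.\<close>

theorem extension_of_injection_weak_P_point:
  assumes \<phi>: "inj \<phi>"
  shows "weak_P_point (compact_open_topology R R) (restrict (ext \<phi>) (topspace R))"
proof (rule weak_P_point_compact_openI[OF restrict_ext_continuous[OF \<phi>]])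
  fix D
  assume D: "countable D" "D \<subseteq> continuous_maps R R" "restrict (ext \<phi>) (topspace R) \<notin> D"
  let ?f = "restrict (ext \<phi>) (topspace R)"
  show "\<exists>\<K>. finite \<K> \<and> (\<forall>(C, U)\<in>\<K>. compactin R C \<and> openin R U \<and> ?f ` C \<subseteq> U) \<and>
      (\<forall>g\<in>D. \<exists>(C, U)\<in>\<K>. \<not> g ` C \<subseteq> U)"
  proof (cases "D = {}")
    case True
    then show ?thesis
      by (intro exI[of _ "{}"]) simp
  next
    case False
    define G where "G = from_nat_into D"
    have GD: "G n \<in> D" for n
      using from_nat_into[OF False] by (simp add: G_def)
    have G_surj: "\<exists>n. g = G n" if "g \<in> D" for g
      using from_nat_into_surj[OF D(1) that] by (auto simp: G_def)
    have Gc: "continuous_map R R (G n)" for n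
      using GD D(2) by (auto simp: continuous_maps_def)
    \<comment> \<open>At some point the two maps have different values. These are separated by some \<open>star T\<close> and its
      complement, and near that point the separation persists.\<close>
    have "\<exists>S. infinite S \<and> (\<forall>x\<in>star S. G n x \<notin> star (\<phi> ` S))" for n
    proof -
      have "\<exists>x\<in>topspace R. G n x \<noteq> ext \<phi> x"
      proof (rule ccontr)
        assume "\<not> ?thesis"
        then have "G n = ?f"
          using GD[of n] D(2) by (intro extensionalityI[of "G n" "topspace R"]) (auto simp: continuous_maps_def)
        then show False
          using D(3) GD[of n] by simp
      qed
      then obtain x where x: "x \<in> topspace R" "G n x \<noteq> ext \<phi> x"
        by blast
      have fx: "ext \<phi> x \<in> topspace R" "G n x \<in> topspace R"
        using ext_remainder[OF \<phi> x(1)] continuous_map_image_subset_topspace[OF Gc] x(1) by blast+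
      have "openin R (topspace R - {G n x})"
        using closedin_Hausdorff_singleton[OF Hausdorff_R fx(2)] by auto
      then obtain T where T: "ext \<phi> x \<in> star T" "star T \<subseteq> topspace R - {G n x}"
        using star_base[of "topspace R - {G n x}" "ext \<phi> x"] fx x(2) by auto
      have "openin R {x \<in> topspace R. G n x \<in> star (- T)}"
        by (rule openin_continuous_map_preimage[OF Gc openin_star])
      moreover have "x \<in> {x \<in> topspace R. G n x \<in> star (- T)}"
        using x(1) T(2) star_Compl[OF fx(2), of T] by blast
      ultimately obtain S where S: "x \<in> star S" "star S \<subseteq> {x \<in> topspace R. G n x \<in> star (- T)}"
        using star_base by blast
      have "x \<in> star (\<phi> -` T)"
        using ext_cl_vimage[of x \<phi> T] T(1) x(1) by (auto simp: star_def topspace_R)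
      then have xS: "x \<in> star (S \<inter> \<phi> -` T)"
        using S(1) star_Int by blast
      then have "infinite (S \<inter> \<phi> -` T)"
        using star_finite by blast
      moreover have "G n y \<notin> star (\<phi> ` (S \<inter> \<phi> -` T))" if "y \<in> star (S \<inter> \<phi> -` T)" for y
      proof -
        have "y \<in> star S"
          using that star_mono[of "S \<inter> \<phi> -` T" S] by blast
        then have "G n y \<in> topspace R" "G n y \<in> star (- T)"
          using S(2) star_subset by blast+
        then have "G n y \<notin> star T"
          using star_Compl by blast
        moreover have "\<phi> ` (S \<inter> \<phi> -` T) \<subseteq> T"
          by blast
        ultimately show ?thesis
          using star_mono by blast
      qed
      ultimately show ?thesis
        by blast
    qed
    then obtain S0 where S0: "\<And>n. infinite (S0 n)" "\<And>n x. x \<in> star (S0 n) \<Longrightarrow> G n x \<notin> star (\<phi> ` S0 n)"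
      by metis
    obtain S1 where S1: "\<And>n. S1 n \<subseteq> S0 n" "\<And>n. infinite (S1 n)" "\<And>m n. m \<noteq> n \<Longrightarrow> S1 m \<inter> S1 n = {}"
    proof (rule disjoint_infinite_refinement[of S0, OF S0(1)])
      fix S1
      assume "\<And>n. S1 n \<subseteq> S0 n" "\<And>n. infinite (S1 n)" "\<And>m n. m \<noteq> n \<Longrightarrow> S1 m \<inter> S1 n = {}"
      then show thesis
        by (rule that)
    qed
    define refines_S1 where "refines_S1 s \<longleftrightarrow> (\<forall>k. infinite (s k) \<and> s k \<subseteq> S1 k)" for s :: "nat \<Rightarrow> nat set"
    define step where "step n s s' \<longleftrightarrow> (\<forall>k. s' k \<subseteq> s k) \<and>
      (\<forall>x\<in>star (s' n). G n x \<notin> star (\<Union>k. \<phi> ` s' k))" for n and s s' :: "nat \<Rightarrow> nat set"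
    have "\<exists>s. \<forall>n. refines_S1 (s n) \<and> step n (s n) (s (Suc n))"
    proof (rule dependent_nat_choice)
      show "\<exists>s. refines_S1 s"
        using S1(2) by (intro exI[of _ S1]) (simp add: refines_S1_def)
      fix s n
      assume s: "refines_S1 s"
      have sub: "s k \<subseteq> S0 k" for k
        using s S1(1) unfolding refines_S1_def by blast
      obtain s' where "\<And>k. s' k \<subseteq> s k" "\<And>k. infinite (s' k)"
        "\<And>x. x \<in> star (s' n) \<Longrightarrow> G n x \<notin> star (\<Union>k. \<phi> ` s' k)"
      proof (rule fusion_step[OF \<phi> Gc, of s n])
        show "infinite (s k)" for k
          using s by (simp add: refines_S1_def)
        show "s j \<inter> s k = {}" if "j \<noteq> k" for j k
          using s S1(3)[OF that] unfolding refines_S1_def by blast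
        show "G n x \<notin> star (\<phi> ` s n)" if "x \<in> star (s n)" for x
          using S0(2)[of x n] that star_mono[OF sub[of n]] star_mono[OF image_mono[OF sub[of n]]] by blast
      qed blast
      then show "\<exists>s'. refines_S1 s' \<and> step n s s'"
        using s unfolding refines_S1_def step_def by (intro exI[of _ s']) blast
    qed
    then obtain s where s: "\<And>n. refines_S1 (s n)" "\<And>n. step n (s n) (s (Suc n))"
      by blast
    obtain T where T: "\<And>k. infinite (T k)" "\<And>k. T k \<subseteq> s k k" "\<And>n k. finite (T k - s n k)"
      using fusion_limit[of s] s unfolding refines_S1_def step_def by metis
    have dec: "s n k \<subseteq> s m k" if "m \<le> n" for m n k
      using that by (induction rule: dec_induct) (use s(2) in \<open>auto simp: step_def\<close>)
    define E where "E = (\<Union>k. \<phi> ` T k)"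
    have avoid: "G n x \<notin> star E" if x: "x \<in> star (T n)" for n x
    proof -
      have "E - (\<Union>k. \<phi> ` s (Suc n) k) \<subseteq> (\<Union>k\<in>{..n}. \<phi> ` (T k - s (Suc n) k))"
      proof
        fix y
        assume y: "y \<in> E - (\<Union>k. \<phi> ` s (Suc n) k)"
        then obtain k t where kt: "t \<in> T k" "y = \<phi> t" "t \<notin> s (Suc n) k"
          by (auto simp: E_def)
        have "k \<le> n"
        proof (rule ccontr)
          assume "\<not> k \<le> n"
          then show False
            using T(2)[of k] dec[of "Suc n" k k] kt by auto
        qed
        then show "y \<in> (\<Union>k\<in>{..n}. \<phi> ` (T k - s (Suc n) k))"
          using kt by blast
      qed
      moreover have "finite (\<Union>k\<in>{..n}. \<phi> ` (T k - s (Suc n) k))"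
        using T(3) by simp
      ultimately have "star E \<subseteq> star (\<Union>k. \<phi> ` s (Suc n) k)"
        by (intro star_almost_mono) (rule finite_subset)
      moreover have "x \<in> star (s (Suc n) n)"
        using x star_almost_mono[OF T(3)] by blast
      ultimately show ?thesis
        using s(2)[of n] unfolding step_def by blast
    qed
    let ?K = "{(star (\<phi> -` E), star E)}"
    have "?f ` star (\<phi> -` E) \<subseteq> star E"
    proof
      fix w
      assume "w \<in> ?f ` star (\<phi> -` E)"
      then obtain y where y: "y \<in> star (\<phi> -` E)" "w = ?f y"
        by blast
      then have yR: "y \<in> topspace R"
        using star_subset by blast
      have "ext \<phi> y \<in> cl E"
        using ext_cl_vimage[of y \<phi> E] y(1) yR by (auto simp: star_def topspace_R)
      then show "w \<in> star E"
        using y(2) yR ext_remainder[OF \<phi> yR] by (simp add: star_in)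
    qed
    moreover have "compactin R (star (\<phi> -` E))"
      using closedin_compact_space[OF compact_R closedin_star] .
    moreover have "\<not> g ` star (\<phi> -` E) \<subseteq> star E" if g: "g \<in> D" for g
    proof -
      obtain n where n: "g = G n"
        using G_surj[OF g] by blast
      obtain x where x: "x \<in> star (T n)"
        using star_nonempty[OF T(1)] by blast
      have "T n \<subseteq> \<phi> -` E"
        by (auto simp: E_def)
      then have "x \<in> star (\<phi> -` E)"
        using x star_mono by blast
      then show ?thesis
        using avoid[OF x] n by blast
    qed
    ultimately show ?thesis
      using openin_star by (intro exI[of _ ?K]) simp
  qed
qed

end

section \<open>Weak P-points of the function spaces\<close>

theorem corollary6p14:
  shows "(\<forall>X :: 'a topology. Parovicenko_space X \<longrightarrow>
            (\<exists>D. dense_in (compact_open_topology X X) D \<and>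
                 (\<forall>p\<in>D. weak_P_point (compact_open_topology X X) p)))
       \<and> (\<forall>(e :: nat \<Rightarrow> 'b) B.
            Stone_Cech_compactification (discrete_topology UNIV) e B \<longrightarrow>
            (let R = Stone_Cech_remainder (discrete_topology UNIV) e B;
                 D = {restrict (Stone_Cech_extension (discrete_topology UNIV) e B \<phi>) (topspace R)
                       | \<phi>. inj \<phi>}
             in dense_in (compact_open_topology R R) D \<and>
                (\<forall>p\<in>D. weak_P_point (compact_open_topology R R) p)))"
proof (intro conjI allI impI)
  fix X :: "'a topology"
  assume "Parovicenko_space X"
  then interpret parovicenko X
    by unfold_locales
  let ?D = "{g \<in> continuous_maps X X. finite (g ` topspace X) \<and> (\<forall>x\<in>topspace X. weak_P_point X (g x))}"
  have "dense_in (compact_open_topology X X) ?D"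
    using weak_P_points_dense by (rule finite_range_maps_dense)
  moreover have "weak_P_point (compact_open_topology X X) p" if "p \<in> ?D" for p
    using that by (intro finite_range_weak_P_point[OF Hausdorff compact]) auto
  ultimately show "\<exists>D. dense_in (compact_open_topology X X) D \<and>
      (\<forall>p\<in>D. weak_P_point (compact_open_topology X X) p)"
    by blast
next
  fix e :: "nat \<Rightarrow> 'b" and B
  assume "Stone_Cech_compactification (discrete_topology UNIV) e B"
  then interpret beta_omega e B
    by unfold_locales
  show "let R = Stone_Cech_remainder (discrete_topology UNIV) e B;
            D = {restrict (Stone_Cech_extension (discrete_topology UNIV) e B \<phi>) (topspace R)
                  | \<phi>. inj \<phi>}
        in dense_in (compact_open_topology R R) D \<and>
           (\<forall>p\<in>D. weak_P_point (compact_open_topology R R) p)"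
    using extensions_of_injections_dense extension_of_injection_weak_P_point
    unfolding Let_def R_def ext_def by blast
qed

end
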